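(* Let $(A,I)$ be a fixed independence alphabet and let $\alpha \le |A|$ be the size of a largest clique of the complementary graph $(A,I)^c = (A, (A\times A)\setminus I)$. Let $u_1, u_2, \ldots, u_n \in \mathbb{G}(A,I) \setminus \{1\}$, $v_0, v_1, \ldots, v_n \in \mathbb{G}(A,I)$, and let $x_1, \ldots, x_n$ be variables (we may have $x_i = x_j$ for $i \neq j$) ranging over $\mathbb{N}$. Then the set of solutions of the exponent equation $$v_0 u_1^{x_1} v_1 u_2^{x_2} v_2 \cdots u_n^{x_n} v_n = 1$$ is semilinear. Moreover, if there is a solution, then there is a solution with $$x_i \in O\big((\alpha n)! \cdot 2^{2\alpha^2 n(n+3)} \cdot \mu^{8\alpha(n+1)} \cdot \nu^{8\alpha |A|(n+1)}\big),$$ where $\mu \in O(|A|^{\alpha} \cdot 2^{2\alpha^2 n} \cdot \lambda^{\alpha})$, $\nu \in O(\lambda^{\alpha})$, and $\lambda = \max\{|u_1|, |u_2|, \ldots, |u_n|, |v_0|, |v_1|, \ldots, |v_n|\}$.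
   Context: An independence alphabet is a finite simple graph $(A,I)$, i.e. $A$ is a finite set and $I \subseteq A \times A$ is irreflexive and symmetric. The associated graph group (right-angled Artin group) is $\mathbb{G}(A,I) = \langle A \mid ab = ba \ ((a,b)\in I)\rangle$. A clique of the complementary graph $(A,(A\times A)\setminus I)$ is thus a set of letters no two of which are related by $I$. For a group element $g \in \mathbb{G}(A,I)$, $|g|$ denotes the length of the unique irreducible trace representing $g$. Here $A^{\pm1} = A \cup A^{-1}$, where $A^{-1} = \{a^{-1} \mid a \in A\}$ is a disjoint copy of $A$; $I$ is extended to $A^{\pm 1}$ by $(a^x,b^y)\in I$ for $(a,b)\in I$, $x,y\in\{1,-1\}$; $\mathbb{M}(A^{\pm1},I)$ is the quotient of the free monoid $(A^{\pm 1})^*$ by the congruence generated by $ab = ba$ for $(a,b)\in I$, and its elements are called traces; the length of a trace is the length of any word representing it; a trace is irreducible if it has no factorization $u[aa^{-1}]v$ with traces $u,v$ and $a \in A^{\pm1}$, where $[aa^{-1}]$ is the trace represented by the word $aa^{-1}$ and $(a^{-1})^{-1}=a$. Every group element is represented by exactly one irreducible trace. $\mathbb{N} = \{0,1,2,\ldots\}$. A solution is an assignment of natural numbers to the pairwise distinct variables among $x_1,\dots,x_n$ making the equation true in $\mathbb{G}(A,I)$; if there are $k$ distinct variables, the set of solutions is a subset of $\mathbb{N}^k$. A subset of $\mathbb{N}^k$ is linear if it has the form $\{a + \lambda_1 b_1 + \cdots + \lambda_r b_r \mid \lambda_1,\dots,\lambda_r \in \mathbb{N}\}$ with $a,b_1,\dots,b_r\in\mathbb{N}^k$,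 and semilinear if it is a finite union of linear sets. *)

theory Defs
  imports "HOL-Algebra.Group" "HOL-Library.Ramsey" "HOL-Library.Landau_Symbols" Complex_Main
begin

section \<open>Monoids presented by generators and relations\<close>

inductive_set presentation_cong :: "'b set \<Rightarrow> ('b list \<times> 'b list) set \<Rightarrow> ('b list \<times> 'b list) set"
  for X :: "'b set" and R :: "('b list \<times> 'b list) set" where
  base: "(l, r) \<in> R \<Longrightarrow> l \<in> lists X \<Longrightarrow> r \<in> lists X \<Longrightarrow> (l, r) \<in> presentation_cong X R"
| refl: "w \<in> lists X \<Longrightarrow> (w, w) \<in> presentation_cong X R"
| sym: "(v, w) \<in> presentation_cong X R \<Longrightarrow> (w, v) \<in> presentation_cong X R"
| trans: "(u, v) \<in> presentation_cong X R \<Longrightarrow> (v, w) \<in> presentation_cong X R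
    \<Longrightarrow> (u, w) \<in> presentation_cong X R"
| append: "(v, w) \<in> presentation_cong X R \<Longrightarrow> (v', w') \<in> presentation_cong X R
    \<Longrightarrow> (v @ v', w @ w') \<in> presentation_cong X R"

definition presented_monoid :: "'b set \<Rightarrow> ('b list \<times> 'b list) set \<Rightarrow> 'b list set monoid" where
  "presented_monoid X R =
    \<lparr> carrier = lists X // presentation_cong X R,
      monoid.mult = (\<lambda>S T. {w. \<exists>s\<in>S. \<exists>t\<in>T. (s @ t, w) \<in> presentation_cong X R}),
      one = presentation_cong X R `` {[]} \<rparr>"

section \<open>Independence alphabets, traces and graph groups\<close>

definition independence_alphabet :: "'a set \<Rightarrow> ('a \<times> 'a) set \<Rightarrow> bool" where
  "independence_alphabet A I \<longleftrightarrow> finite A \<and> I \<subseteq> A \<times> A \<and> irrefl I \<and> sym I"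

definition complement_edges :: "'a set \<Rightarrow> ('a \<times> 'a) set \<Rightarrow> 'a set set" where
  "complement_edges A I = {{a, b} | a b. (a, b) \<in> A \<times> A - I}"

definition complement_clique_number :: "'a set \<Rightarrow> ('a \<times> 'a) set \<Rightarrow> nat" where
  "complement_clique_number A I = Max (card ` {C. C \<subseteq> A \<and> clique C (complement_edges A I)})"

text \<open>The letter \<open>a\<close> is encoded as \<open>(a, True)\<close> and its formal inverse as \<open>(a, False)\<close>.\<close>

type_synonym 'a signed = "'a \<times> bool"

definition signed_letters :: "'a set \<Rightarrow> 'a signed set" where
  "signed_letters A = A \<times> UNIV"

definition inv_letter :: "'a signed \<Rightarrow> 'a signed" where
  "inv_letter p = (fst p, \<not> snd p)"

definition signed_independence :: "('a \<times> 'a) set \<Rightarrow> ('a signed \<times> 'a signed) set" where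
  "signed_independence I = {(p, q). (fst p, fst q) \<in> I}"

definition trace_monoid :: "'a set \<Rightarrow> ('a \<times> 'a) set \<Rightarrow> 'a signed list set monoid" where
  "trace_monoid A I = presented_monoid (signed_letters A)
     {([p, q], [q, p]) | p q. (p, q) \<in> signed_independence I}"

text \<open>The group presentation with generators \<open>A\<close> and relations \<open>ab = ba\<close> is read as the monoid
  presentation over the signed letters with the cancellation rules added. Commutation of
  formal inverses then follows.\<close>

definition graph_group :: "'a set \<Rightarrow> ('a \<times> 'a) set \<Rightarrow> 'a signed list set monoid" where
  "graph_group A I = presented_monoid (signed_letters A)
     ({([p, inv_letter p], []) | p. p \<in> signed_letters A} \<union>
      {([(a, True), (b, True)], [(b, True), (a, True)]) | a b. (a, b) \<in> I})"

definition trace_of :: "'a set \<Rightarrow> ('a \<times> 'a) set \<Rightarrow> 'a signed list \<Rightarrow> 'a signed list set" where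
  "trace_of A I w = (THE t. t \<in> carrier (trace_monoid A I) \<and> w \<in> t)"

definition trace_length :: "'a signed list set \<Rightarrow> nat" where
  "trace_length t = (THE m. \<exists>w\<in>t. length w = m)"

definition irreducible_trace :: "'a set \<Rightarrow> ('a \<times> 'a) set \<Rightarrow> 'a signed list set \<Rightarrow> bool" where
  "irreducible_trace A I t \<longleftrightarrow>
     t \<in> carrier (trace_monoid A I) \<and>
     \<not> (\<exists>u \<in> carrier (trace_monoid A I). \<exists>v \<in> carrier (trace_monoid A I). \<exists>p \<in> signed_letters A.
          t = u \<otimes>\<^bsub>trace_monoid A I\<^esub> trace_of A I [p, inv_letter p] \<otimes>\<^bsub>trace_monoid A I\<^esub> v)"

text \<open>Traces and group elements are both sets of words, so a trace \<open>t\<close> represents \<open>g\<close> exactly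
  when \<open>t \<subseteq> g\<close>.\<close>

definition group_norm :: "'a set \<Rightarrow> ('a \<times> 'a) set \<Rightarrow> 'a signed list set \<Rightarrow> nat" where
  "group_norm A I g = trace_length (THE t. irreducible_trace A I t \<and> t \<subseteq> g)"

section \<open>Semilinear sets\<close>

text \<open>Vectors of dimension \<open>k\<close> over the natural numbers are functions that vanish from
  index \<open>k\<close> on.\<close>

definition nat_vectors :: "nat \<Rightarrow> (nat \<Rightarrow> nat) set" where
  "nat_vectors k = {f. \<forall>i\<ge>k. f i = 0}"

definition linear_set :: "nat \<Rightarrow> (nat \<Rightarrow> nat) set \<Rightarrow> bool" where
  "linear_set k S \<longleftrightarrow>
     (\<exists>a r b. a \<in> nat_vectors k \<and> (\<forall>j<r. b j \<in> nat_vectors k) \<and>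
        S = {(\<lambda>i. a i + (\<Sum>j<r. c j * b j i)) | c :: nat \<Rightarrow> nat. True})"

definition semilinear_set :: "nat \<Rightarrow> (nat \<Rightarrow> nat) set \<Rightarrow> bool" where
  "semilinear_set k S \<longleftrightarrow> (\<exists>F. finite F \<and> (\<forall>L\<in>F. linear_set k L) \<and> S = \<Union>F)"

section \<open>Exponent equations\<close>

primrec exponent_product ::
  "('g, 'm) monoid_scheme \<Rightarrow> (nat \<Rightarrow> 'g) \<Rightarrow> (nat \<Rightarrow> 'g) \<Rightarrow> (nat \<Rightarrow> nat) \<Rightarrow> nat \<Rightarrow> 'g" where
  "exponent_product G u v y 0 = v 0"
| "exponent_product G u v y (Suc n) =
     exponent_product G u v y n \<otimes>\<^bsub>G\<^esub> u (Suc n) [^]\<^bsub>G\<^esub> y (Suc n) \<otimes>\<^bsub>G\<^esub> v (Suc n)"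

text \<open>The distinct variables are numbered \<open>0, \<dots>, k - 1\<close>, and \<open>x i\<close> is the number of the variable
  that stands in the \<open>i\<close>-th exponent.\<close>

definition exponent_equation ::
  "('g, 'm) monoid_scheme \<Rightarrow> nat \<Rightarrow> nat \<Rightarrow> (nat \<Rightarrow> nat) \<Rightarrow> (nat \<Rightarrow> 'g) \<Rightarrow> (nat \<Rightarrow> 'g) \<Rightarrow> bool" where
  "exponent_equation G n k x u v \<longleftrightarrow>
     (\<forall>i\<in>{1..n}. u i \<in> carrier G - {\<one>\<^bsub>G\<^esub>}) \<and> (\<forall>i\<in>{0..n}. v i \<in> carrier G) \<and>
     x ` {1..n} = {..<k}"

definition solutions ::
  "('g, 'm) monoid_scheme \<Rightarrow> nat \<Rightarrow> nat \<Rightarrow> (nat \<Rightarrow> nat) \<Rightarrow> (nat \<Rightarrow> 'g) \<Rightarrow> (nat \<Rightarrow> 'g)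
     \<Rightarrow> (nat \<Rightarrow> nat) set" where
  "solutions G n k x u v =
     {s \<in> nat_vectors k. exponent_product G u v (\<lambda>i. s (x i)) n = \<one>\<^bsub>G\<^esub>}"

definition max_norm ::
  "'a set \<Rightarrow> ('a \<times> 'a) set \<Rightarrow> nat \<Rightarrow> (nat \<Rightarrow> 'a signed list set) \<Rightarrow> (nat \<Rightarrow> 'a signed list set) \<Rightarrow> nat"
  where
  "max_norm A I n u v =
     Max ((\<lambda>i. group_norm A I (u i)) ` {1..n} \<union> (\<lambda>i. group_norm A I (v i)) ` {0..n})"

section \<open>Graph groups are groups\<close>

lemma presentation_cong_lists:
  "(v, w) \<in> presentation_cong X R \<Longrightarrow> v \<in> lists X \<and> w \<in> lists X"
  by (induction rule: presentation_cong.induct) auto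

lemma equiv_presentation_cong: "equiv (lists X) (presentation_cong X R)"
  by (rule equivI)
    (auto intro!: refl_onI symI transI
       intro: presentation_cong.refl presentation_cong.sym presentation_cong.trans
       dest: presentation_cong_lists)

lemma carrier_presented_monoid:
  "S \<in> carrier (presented_monoid X R) \<longleftrightarrow> (\<exists>w\<in>lists X. S = presentation_cong X R `` {w})"
  by (auto simp: presented_monoid_def quotient_def)

lemma one_presented_monoid: "\<one>\<^bsub>presented_monoid X R\<^esub> = presentation_cong X R `` {[]}"
  by (simp add: presented_monoid_def)

lemma mult_presented_monoid:
  assumes "v \<in> lists X" "w \<in> lists X"
  shows "presentation_cong X R `` {v} \<otimes>\<^bsub>presented_monoid X R\<^esub> presentation_cong X R `` {w}
    = presentation_cong X R `` {v @ w}"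
  using assms
  by (auto simp: presented_monoid_def
      intro: presentation_cong.refl presentation_cong.trans presentation_cong.append)

lemma monoid_presented_monoid: "monoid (presented_monoid X R)"
proof (rule monoidI, goal_cases)
  case (1 S T)
  then show ?case
    by (metis append_in_lists_conv carrier_presented_monoid mult_presented_monoid)
next
  case 2
  then show ?case
    by (metis carrier_presented_monoid lists.Nil one_presented_monoid)
next
  case (3 S T U)
  then obtain s t w where "s \<in> lists X" "t \<in> lists X" "w \<in> lists X"
    and "S = presentation_cong X R `` {s}" "T = presentation_cong X R `` {t}"
      "U = presentation_cong X R `` {w}"
    unfolding carrier_presented_monoid by blast
  then show ?case
    by (simp add: mult_presented_monoid)
next
  case (4 S)
  then show ?case
    by (metis append_Nil carrier_presented_monoid lists.Nil mult_presented_monoid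
        one_presented_monoid)
next
  case (5 S)
  then show ?case
    by (metis append_Nil2 carrier_presented_monoid lists.Nil mult_presented_monoid
        one_presented_monoid)
qed

lemma inv_letter_inv_letter [simp]: "inv_letter (inv_letter p) = p"
  by (simp add: inv_letter_def)

lemma inv_letter_in_signed_letters [simp]:
  "inv_letter p \<in> signed_letters A \<longleftrightarrow> p \<in> signed_letters A"
  by (cases p) (auto simp: inv_letter_def signed_letters_def)

lemma group_graph_group: "group (graph_group A I)"
proof -
  define X where "X = signed_letters A"
  define R where "R = {([p, inv_letter p], []) | p. p \<in> signed_letters A} \<union>
    {([(a, True), (b, True)], [(b, True), (a, True)]) | a b. (a, b) \<in> I}"
  have G: "graph_group A I = presented_monoid X R"
    by (simp add: graph_group_def X_def R_def)
  have cancel: "([inv_letter p, p], []) \<in> presentation_cong X R" if "p \<in> X" for p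
  proof (rule presentation_cong.base)
    have "([inv_letter p, inv_letter (inv_letter p)], []) \<in> R"
      using that unfolding R_def X_def by (intro UnI1 CollectI exI[of _ "inv_letter p"]) simp
    then show "([inv_letter p, p], []) \<in> R"
      by simp
  qed (use that in \<open>auto simp: X_def\<close>)
  have inverse: "(map inv_letter (rev w) @ w, []) \<in> presentation_cong X R" if "w \<in> lists X" for w
    using that
  proof induction
    case Nil
    then show ?case by (simp add: presentation_cong.refl)
  next
    case (Cons p w)
    have W: "map inv_letter (rev w) \<in> lists X"
      using Cons.hyps by (auto simp: X_def)
    have "([inv_letter p, p] @ w, [] @ w) \<in> presentation_cong X R"
      by (intro presentation_cong.append cancel Cons.hyps presentation_cong.refl)
    then have "(map inv_letter (rev w) @ [inv_letter p, p] @ w, map inv_letter (rev w) @ [] @ w)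
        \<in> presentation_cong X R"
      by (rule presentation_cong.append[OF presentation_cong.refl[OF W]])
    then show ?case
      using Cons.IH by (auto intro: presentation_cong.trans)
  qed
  interpret monoid "presented_monoid X R"
    by (rule monoid_presented_monoid)
  show ?thesis
    unfolding G
  proof (rule groupI, goal_cases)
    case (5 S)
    then obtain w where w: "w \<in> lists X" "S = presentation_cong X R `` {w}"
      by (auto simp: carrier_presented_monoid simp del: in_lists_conv_set)
    have W: "map inv_letter (rev w) \<in> lists X"
      using w(1) by (auto simp: X_def)
    have "presentation_cong X R `` {map inv_letter (rev w) @ w} = presentation_cong X R `` {[]}"
      by (rule equiv_class_eq[OF equiv_presentation_cong inverse[OF w(1)]])
    then show ?case
      using w W by (metis carrier_presented_monoid mult_presented_monoid one_presented_monoid)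
  qed (auto simp: m_assoc)
qed

end

theory Submission
  imports Defs "HOL-Library.Multiset"
begin

text \<open>
A word over signed letters represents the trivial element of a graph group exactly when its letters
can be joined in pairs of formal inverses by chords such that any two crossing chords carry independent
letters. If the word is a product of reduced blocks, let \<open>M P Q\<close> be the part of block \<open>P\<close> whose
chords end in block \<open>Q\<close>. Then \<open>M Q P\<close> is inverse to \<open>M P Q\<close>, words whose chords cross are
independent, and every block is the product of its words \<open>M P Q\<close> in the cyclic order of the \<open>Q\<close>
(\<open>trivial_product_matching\<close>). Conversely, any words with these properties have blocks whose product is trivial
(\<open>matching_trivial_product\<close>).

An exponent equation becomes a product of powers of connected words all of whose powers are reduced:
every \<open>u i\<close> is conjugated to a cyclically reduced word and split into its connected components, and the
constants are cut into single letters. A trace factor of a power of a connected word \<open>u\<close> has the form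
\<open>r\<inverse> u\<^sup>d r'\<close> with short \<open>r\<close> and \<open>r'\<close> (\<open>cuts_of_power\<close>), so every \<open>M P Q\<close> is described by two
exponents, one for each of the two blocks. If both are large, the two periods have proportional letter
counts, and suitable multiples of them can be inserted or removed on both sides without changing the
matching (\<open>pump_pair\<close>). As the matching only requires pairs to be inverse and letters to be independent,
all pairs can be pumped at the same time (\<open>pumpable_product\<close>). The exponents of the blocks therefore
run through a linear family with small constants and small coefficients.

It remains to impose that blocks with the same variable have the same exponent. This is a linear system over
the natural numbers with at most \<open>2 * card A * n\<close> rows. By a pigeonhole argument each of its solutions
is the sum of a bounded solution and of bounded solutions of the homogeneous system
(\<open>solution_decomposition\<close>). So every solution of the exponent equation lies in a cone of solutions with
bounded apex and generators (\<open>solutions_bounded_cones\<close>). There are only finitely many such cones, which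
gives semilinearity, and the apex of one of them is a small solution. The bound obtained is a constant
multiple of \<open>n * l ^ 4\<close>, with \<open>l\<close> the largest norm, to the power \<open>2 * card A * n\<close>. The claimed bound
dominates it: its exponent of \<open>l\<close> contains the summand \<open>8 * \<alpha>\<^sup>2 * card A * (n + 1)\<close>, which is at least
\<open>8 * card A * n\<close>, and the powers of \<open>n\<close> are absorbed by a power of two that is quadratic in \<open>n\<close>.
\<close>

section \<open>Traces over an alphabet with an involution\<close>

locale trace_alphabet =
  fixes ind :: "'b \<Rightarrow> 'b \<Rightarrow> bool" and iv :: "'b \<Rightarrow> 'b"
  assumes ind_sym: "ind a b \<Longrightarrow> ind b a"
    and ind_irrefl [simp]: "\<not> ind a a"
    and iv_iv [simp]: "iv (iv a) = a"
    and iv_neq [simp]: "iv a \<noteq> a"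
    and ind_iv_left [simp]: "ind (iv a) b \<longleftrightarrow> ind a b"
begin

lemma ind_commute: "ind a b \<longleftrightarrow> ind b a"
  using ind_sym by blast

lemma ind_iv_right [simp]: "ind a (iv b) \<longleftrightarrow> ind a b"
  using ind_commute ind_iv_left by blast

lemma iv_eq_iff [simp]: "iv a = iv b \<longleftrightarrow> a = b"
  by (metis iv_iv)

text \<open>Trace equality is defined through the projections of a word to all pairs of dependent letters,
  the case \<open>a = b\<close> included. This makes cancellation and the passage to subalphabets trivial; that
  it is the congruence generated by commuting independent letters is the content of
  \<open>teq_Cons_split\<close>, from which everything else is derived.\<close>

definition teq :: "'b list \<Rightarrow> 'b list \<Rightarrow> bool" (infix "\<simeq>" 50) where
  "x \<simeq> y \<longleftrightarrow> (\<forall>a b. \<not> ind a b \<longrightarrow> filter (\<lambda>c. c = a \<or> c = b) x = filter (\<lambda>c. c = a \<or> c = b) y)"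

lemma teqI:
  "(\<And>a b. \<not> ind a b \<Longrightarrow> filter (\<lambda>c. c = a \<or> c = b) x = filter (\<lambda>c. c = a \<or> c = b) y) \<Longrightarrow> x \<simeq> y"
  by (simp add: teq_def)

lemma teqD:
  "x \<simeq> y \<Longrightarrow> \<not> ind a b \<Longrightarrow> filter (\<lambda>c. c = a \<or> c = b) x = filter (\<lambda>c. c = a \<or> c = b) y"
  by (simp add: teq_def)

lemma teq_refl [simp, intro!]: "x \<simeq> x"
  by (simp add: teq_def)

lemma teq_sym: "x \<simeq> y \<Longrightarrow> y \<simeq> x"
  by (simp add: teq_def)

lemma teq_trans [trans]: "x \<simeq> y \<Longrightarrow> y \<simeq> z \<Longrightarrow> x \<simeq> z"
  by (simp add: teq_def)

lemma teq_append: "x \<simeq> x' \<Longrightarrow> y \<simeq> y' \<Longrightarrow> x @ y \<simeq> x' @ y'"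
  by (simp add: teq_def)

lemma teq_Cons: "x \<simeq> y \<Longrightarrow> a # x \<simeq> a # y"
  by (simp add: teq_def)

lemma teq_append_left [simp]: "x @ y \<simeq> x @ z \<longleftrightarrow> y \<simeq> z"
  by (simp add: teq_def)

lemma teq_append_right [simp]: "y @ x \<simeq> z @ x \<longleftrightarrow> y \<simeq> z"
  by (simp add: teq_def)

lemma teq_Cons_iff [simp]: "a # y \<simeq> a # z \<longleftrightarrow> y \<simeq> z"
  using teq_append_left [of "[a]"] by simp

lemma teq_mset: "x \<simeq> y \<Longrightarrow> mset x = mset y"
proof (rule multiset_eqI)
  fix a assume "x \<simeq> y"
  then have "filter (\<lambda>c. c = a \<or> c = a) x = filter (\<lambda>c. c = a \<or> c = a) y"
    by (rule teqD) simp
  then have "count_list x a = count_list y a"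
    by (metis (mono_tags, lifting) count_list_eq_length_filter filter_cong)
  then show "count (mset x) a = count (mset y) a"
    by (simp add: count_mset)
qed

lemma teq_set: "x \<simeq> y \<Longrightarrow> set x = set y"
  by (metis teq_mset mset_eq_setD)

lemma teq_length: "x \<simeq> y \<Longrightarrow> length x = length y"
  by (metis teq_mset mset_eq_length)

lemma teq_Nil_iff [simp]: "x \<simeq> [] \<longleftrightarrow> x = []" "[] \<simeq> x \<longleftrightarrow> x = []"
  using teq_length by fastforce+

definition indw :: "'b list \<Rightarrow> 'b list \<Rightarrow> bool" where
  "indw x y \<longleftrightarrow> (\<forall>a\<in>set x. \<forall>b\<in>set y. ind a b)"

lemma teq_commute:
  assumes "indw x y"
  shows "x @ y \<simeq> y @ x"
proof (rule teqI)
  fix a b assume ab: "\<not> ind a b"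
  then have ba: "\<not> ind b a" using ind_sym by blast
  have "filter (\<lambda>c. c = a \<or> c = b) x = [] \<or> filter (\<lambda>c. c = a \<or> c = b) y = []"
    using assms ab ba unfolding indw_def filter_empty_conv by (metis ind_irrefl)
  then show "filter (\<lambda>c. c = a \<or> c = b) (x @ y) = filter (\<lambda>c. c = a \<or> c = b) (y @ x)"
    by auto
qed

lemma teq_move_front: "\<forall>b\<in>set y1. ind a b \<Longrightarrow> y1 @ a # y2 \<simeq> a # y1 @ y2"
  using teq_append[OF teq_commute[of "[a]" y1] teq_refl[of y2]]
  by (auto simp: indw_def intro: teq_sym)

text \<open>If a dependent letter preceded the first \<open>a\<close> of \<open>y\<close>, the projection to this letter and \<open>a\<close>
  would not start with \<open>a\<close>. So the first \<open>a\<close> of \<open>y\<close> can be moved to the front.\<close>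

lemma teq_Cons_split:
  assumes "a # x \<simeq> y"
  obtains y1 y2 where "y = y1 @ a # y2" "a \<notin> set y1" "\<forall>b\<in>set y1. ind a b" "x \<simeq> y1 @ y2"
proof -
  have "a \<in> set y" using teq_set[OF assms] by auto
  then obtain y1 y2 where y: "y = y1 @ a # y2" "a \<notin> set y1"
    by (meson split_list_first)
  have indep: "\<forall>b\<in>set y1. ind a b"
  proof (rule ccontr)
    assume "\<not> (\<forall>b\<in>set y1. ind a b)"
    then obtain b where b: "b \<in> set y1" "\<not> ind a b" by blast
    have eq: "filter (\<lambda>c. c = a \<or> c = b) (a # x) = filter (\<lambda>c. c = a \<or> c = b) y"
      using assms b(2) by (rule teqD)
    have ne: "filter (\<lambda>c. c = a \<or> c = b) y1 \<noteq> []"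
      using b(1) by (auto simp: filter_empty_conv)
    then have "hd (filter (\<lambda>c. c = a \<or> c = b) y) = hd (filter (\<lambda>c. c = a \<or> c = b) y1)"
      using y(1) by simp
    then have "hd (filter (\<lambda>c. c = a \<or> c = b) y1) = a"
      using arg_cong[OF eq, of hd] by simp
    moreover have "hd (filter (\<lambda>c. c = a \<or> c = b) y1) \<in> set y1"
      using hd_in_set[OF ne] by auto
    ultimately show False using y(2) by simp
  qed
  have "a # x \<simeq> a # y1 @ y2"
    using teq_trans[OF assms] teq_move_front[OF indep] y(1) by blast
  then have "x \<simeq> y1 @ y2" by simp
  then show ?thesis using that y indep by blast
qed

lemma teq_diamond:
  assumes "a # x \<simeq> b # y" "a \<noteq> b"
  obtains z where "ind a b" "x \<simeq> b # z" "y \<simeq> a # z"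
proof -
  obtain y1 y2 where *: "b # y = y1 @ a # y2" "a \<notin> set y1" "\<forall>b\<in>set y1. ind a b" "x \<simeq> y1 @ y2"
    using teq_Cons_split[OF assms(1)] by metis
  then obtain y1' where y1: "y1 = b # y1'" "y = y1' @ a # y2"
    using assms(2) by (cases y1) auto
  show ?thesis
    using that[of "y1' @ y2"] * y1 teq_move_front[of y1' a y2] by auto
qed

text \<open>Equal letters never commute, so a prefix of a trace is the same as a down-closed set of
  occurrences and is determined by the number of its letters of each kind. Inclusion of prefixes is
  therefore inclusion of multisets. This replaces all periodicity arguments below by counting.\<close>

lemma teq_prefix:
  assumes "p @ s \<simeq> q @ t" "mset p \<subseteq># mset q"
  shows "\<exists>r. q \<simeq> p @ r"
  using assms
proof (induction p arbitrary: q)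
  case Nil
  then show ?case by auto
next
  case (Cons a p)
  obtain y1 y2 where y: "q @ t = y1 @ a # y2" "a \<notin> set y1" "\<forall>b\<in>set y1. ind a b" "p @ s \<simeq> y1 @ y2"
    using teq_Cons_split[of a "p @ s" "q @ t"] Cons.prems(1) by auto
  have "a \<in> set q" using Cons.prems(2) by (metis list.set_intros(1) set_mset_mset mset_subset_eqD)
  then obtain y1' q2 where q': "q = y1' @ a # q2" "a \<notin> set y1'"
    by (meson split_list_first)
  have "y1' @ a # (q2 @ t) = y1 @ a # y2"
    using y(1) q'(1) by simp
  moreover have "takeWhile (\<lambda>c. c \<noteq> a) (y1' @ a # (q2 @ t)) = y1'"
    "takeWhile (\<lambda>c. c \<noteq> a) (y1 @ a # y2) = y1"
    using y(2) q'(2) by (auto simp: takeWhile_tail)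
  ultimately have eq: "y1' = y1" "q2 @ t = y2"
    by auto
  have q: "q = y1 @ a # q2" "y2 = q2 @ t"
    using q' eq by auto
  have "mset p \<subseteq># mset (y1 @ q2)" using Cons.prems(2) q(1) by simp
  moreover have "p @ s \<simeq> (y1 @ q2) @ t" using y(4) q(2) by simp
  ultimately obtain r where "y1 @ q2 \<simeq> p @ r" using Cons.IH by blast
  then have "q \<simeq> a # p @ r"
    using teq_trans[OF teq_move_front[OF y(3)]] q(1) teq_Cons by blast
  then show ?case by auto
qed

lemma teq_prefix_eq:
  assumes "p @ s \<simeq> q @ t" "mset p = mset q"
  shows "p \<simeq> q"
proof -
  obtain r where "q \<simeq> p @ r" using teq_prefix[OF assms(1)] assms(2) by auto
  moreover from this have "r = []" using teq_length[of q "p @ r"] mset_eq_length[OF assms(2)] by simp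
  ultimately show ?thesis by (simp add: teq_sym)
qed

section \<open>Normal forms and equality in the group\<close>

text \<open>Removes a leading \<open>a\<close>, where leading means that \<open>a\<close> can be commuted to the front.\<close>

fun strip :: "'b \<Rightarrow> 'b list \<Rightarrow> 'b list option" where
  "strip a [] = None"
| "strip a (b # w) = (if b = a then Some w else if ind a b then map_option (Cons b) (strip a w) else None)"

lemma strip_SomeD: "strip a w = Some w' \<Longrightarrow> \<exists>w1 w2. w = w1 @ a # w2 \<and> w' = w1 @ w2 \<and> (\<forall>b\<in>set w1. ind a b)"
proof (induction w arbitrary: w')
  case (Cons b w)
  show ?case
  proof (cases "b = a")
    case True
    then show ?thesis using Cons.prems by (intro exI[of _ "[]"] exI[of _ w]) auto
  next
    case False
    with Cons.prems obtain v where v: "ind a b" "strip a w = Some v" "w' = b # v"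
      by (auto split: if_splits)
    obtain w1 w2 where "w = w1 @ a # w2" "v = w1 @ w2" "\<forall>b\<in>set w1. ind a b"
      using Cons.IH[OF v(2)] by blast
    then show ?thesis using v by (intro exI[of _ "b # w1"] exI[of _ w2]) auto
  qed
qed simp

lemma strip_teq: "strip a w = Some w' \<Longrightarrow> w \<simeq> a # w'"
  using strip_SomeD teq_move_front by blast

lemma strip_split: "\<forall>b\<in>set w1. ind a b \<Longrightarrow> strip a (w1 @ a # w2) = Some (w1 @ w2)"
  by (induction w1) auto

lemma strip_complete:
  assumes "w \<simeq> a # w'"
  obtains v where "strip a w = Some v" "v \<simeq> w'"
proof -
  obtain y1 y2 where y: "w = y1 @ a # y2" "\<forall>b\<in>set y1. ind a b" "w' \<simeq> y1 @ y2"
    using teq_Cons_split[OF teq_sym[OF assms]] by metis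
  then show ?thesis using that[of "y1 @ y2"] strip_split[of y1 a y2] teq_sym by blast
qed

lemma strip_None_iff: "strip a w = None \<longleftrightarrow> (\<nexists>w'. w \<simeq> a # w')"
  by (metis strip_complete strip_teq not_None_eq option.distinct(1))

fun reduced :: "'b list \<Rightarrow> bool" where
  "reduced [] = True"
| "reduced (a # w) = (reduced w \<and> strip (iv a) w = None)"

text \<open>The recursive definition only looks for a cancelling pair whose first letter is the head. The
  characterisation is visibly invariant under trace equality.\<close>

lemma reduced_iff: "reduced w \<longleftrightarrow> (\<nexists>x a z. w \<simeq> x @ [a, iv a] @ z)"
proof (induction w)
  case Nil
  then show ?case by simp
next
  case (Cons b v)
  show ?case
  proof (rule iffI, rule notI)
    assume r: "reduced (b # v)" and "\<exists>x a z. b # v \<simeq> x @ [a, iv a] @ z"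
    then obtain x a z where "b # v \<simeq> x @ [a, iv a] @ z" by blast
    then obtain y1 y2 where y: "x @ [a, iv a] @ z = y1 @ b # y2" "\<forall>c\<in>set y1. ind b c" "v \<simeq> y1 @ y2"
      using teq_Cons_split by metis
    have IH: "\<And>x a z. \<not> v \<simeq> x @ [a, iv a] @ z" using r Cons.IH by simp
    from y(1) consider (x) us where "x = y1 @ b # us" "us @ [a, iv a] @ z = y2"
      | (r) us where "y1 = x @ us" "[a, iv a] @ z = us @ b # y2"
      by (auto simp: append_eq_append_conv2 append_eq_Cons_conv Cons_eq_append_conv)
    then show False
    proof cases
      case x
      then show ?thesis using IH[of "y1 @ us" a z] y(3) by simp
    next
      case r
      then consider "us = []" "b = a" "y2 = iv a # z" | "us = [a]" "b = iv a"
        | us' where "us = a # iv a # us'" "z = us' @ b # y2"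
        by (auto simp: Cons_eq_append_conv)
      then show ?thesis
      proof cases
        case 1
        then have "v \<simeq> iv a # x @ z"
          using y r(1) teq_move_front[of x "iv a" z] teq_trans by auto
        then show ?thesis using \<open>reduced (b # v)\<close> 1 by (simp add: strip_None_iff)
      next
        case 2
        then show ?thesis using y(2) r(1) by auto
      next
        case 3
        then show ?thesis using IH[of x a "us' @ y2"] y(3) r(1) by simp
      qed
    qed
  next
    assume n: "\<nexists>x a z. b # v \<simeq> x @ [a, iv a] @ z"
    have "\<not> v \<simeq> x @ [a, iv a] @ z" for x a z
      using n teq_Cons[of v "x @ [a, iv a] @ z" b] by (metis append_Cons)
    moreover have "\<not> v \<simeq> iv b # w" for w
      using n teq_Cons[of v "iv b # w" b] by (metis append_Cons append_Nil)
    ultimately show "reduced (b # v)"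
      using Cons.IH by (simp add: strip_None_iff)
  qed
qed

lemma reduced_teq: "x \<simeq> y \<Longrightarrow> reduced x \<longleftrightarrow> reduced y"
  unfolding reduced_iff using teq_trans teq_sym by blast

lemma reduced_factor: "reduced (x @ y @ z) \<Longrightarrow> reduced y"
proof (rule ccontr)
  assume "reduced (x @ y @ z)" "\<not> reduced y"
  then obtain u a v where "y \<simeq> u @ [a, iv a] @ v" using reduced_iff by blast
  then have "x @ y @ z \<simeq> (x @ u) @ [a, iv a] @ (v @ z)"
    using teq_append[OF teq_refl[of x] teq_append[OF _ teq_refl[of z]]] by fastforce
  then show False using \<open>reduced (x @ y @ z)\<close> reduced_iff by blast
qed

text \<open>The letter \<open>a\<close> acts on reduced traces by left multiplication followed by cancellation. Since this
  is an action of the group (van der Waerden's argument), normal forms are unique and no confluence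
  proof for a rewriting system is needed.\<close>

definition act :: "'b \<Rightarrow> 'b list \<Rightarrow> 'b list" where
  "act a w = (case strip (iv a) w of None \<Rightarrow> a # w | Some w' \<Rightarrow> w')"

lemma act_cancel: "w \<simeq> iv a # v \<Longrightarrow> act a w \<simeq> v"
  by (erule strip_complete) (simp add: act_def)

lemma act_add: "(\<nexists>v. w \<simeq> iv a # v) \<Longrightarrow> act a w = a # w"
  using strip_None_iff[of "iv a" w] by (simp add: act_def)

lemma act_teq: "x \<simeq> y \<Longrightarrow> act a x \<simeq> act a y"
  by (cases "\<exists>v. y \<simeq> iv a # v")
    (metis act_cancel teq_sym teq_trans, metis act_add teq_Cons teq_sym teq_trans)

lemma reduced_act: "reduced w \<Longrightarrow> reduced (act a w)"
proof (cases "\<exists>v. w \<simeq> iv a # v")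
  case True
  assume "reduced w"
  then obtain v where v: "w \<simeq> iv a # v" using True by blast
  then have "reduced (iv a # v)" using \<open>reduced w\<close> reduced_teq by blast
  then show ?thesis using act_cancel[OF v] reduced_teq by auto
next
  case False
  assume "reduced w"
  then show ?thesis using False act_add[OF False] by (simp add: strip_None_iff)
qed

lemma act_act_iv: "reduced w \<Longrightarrow> act a (act (iv a) w) \<simeq> w"
proof (cases "\<exists>v. w \<simeq> a # v")
  case True
  assume r: "reduced w"
  obtain v where v: "w \<simeq> a # v" using True by blast
  then have "reduced (a # v)" using r reduced_teq by blast
  then have "act a v = a # v" by (intro act_add) (simp add: strip_None_iff)
  moreover have "act (iv a) w \<simeq> v" using v act_cancel[of w "iv a" v] by simp
  ultimately show ?thesis using act_teq[of "act (iv a) w" v a] v teq_sym teq_trans by metis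
next
  case False
  then have "act (iv a) w = iv a # w" by (intro act_add) simp
  then show ?thesis by (simp add: act_def)
qed

lemma head_indep:
  assumes "w \<simeq> a # v" "ind a b"
  shows "(\<exists>u. w \<simeq> b # u) \<longleftrightarrow> (\<exists>u. v \<simeq> b # u)"
proof
  assume "\<exists>u. w \<simeq> b # u"
  then obtain u where "a # v \<simeq> b # u" using assms teq_sym teq_trans by blast
  moreover have "a \<noteq> b" using assms(2) by auto
  ultimately show "\<exists>u. v \<simeq> b # u" using teq_diamond by metis
next
  assume "\<exists>u. v \<simeq> b # u"
  then obtain u where "v \<simeq> b # u" by blast
  then have "w \<simeq> a # b # u" using assms(1) teq_trans teq_Cons by blast
  moreover have "a # b # u \<simeq> b # a # u" using teq_move_front[of "[a]" b u] assms(2) ind_sym by auto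
  ultimately show "\<exists>u. w \<simeq> b # u" using teq_trans by blast
qed

lemma swap2: "ind a b \<Longrightarrow> a # b # u \<simeq> b # a # u"
  using teq_move_front[of "[a]" b u] ind_sym by auto

text \<open>Multiplying by \<open>b\<close> does not change whether \<open>iv a\<close> is a leading letter, because \<open>a\<close> and \<open>b\<close>
  are independent.\<close>

lemma act_commute_aux:
  assumes "ind a b" "w \<simeq> iv a # v" "\<nexists>u. w \<simeq> iv b # u"
  shows "act a (act b w) \<simeq> act b (act a w)"
proof -
  have nv: "\<nexists>u. v \<simeq> iv b # u" using head_indep[OF assms(2), of "iv b"] assms by simp
  have "act b w = b # w" by (rule act_add[OF assms(3)])
  moreover have "b # w \<simeq> iv a # b # v"
    using teq_trans[OF teq_Cons[OF assms(2)] swap2[of b "iv a" v]] assms(1) ind_sym by auto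
  ultimately have 1: "act a (act b w) \<simeq> b # v" using act_cancel by simp
  have "act b (act a w) \<simeq> act b v" using act_teq act_cancel assms(2) by blast
  also have "act b v = b # v" by (rule act_add[OF nv])
  finally show ?thesis using 1 teq_sym teq_trans by blast
qed

lemma act_commute:
  assumes "ind a b"
  shows "act a (act b w) \<simeq> act b (act a w)"
proof (cases "\<exists>v. w \<simeq> iv a # v")
  case True
  then obtain v where v: "w \<simeq> iv a # v" by blast
  show ?thesis
  proof (cases "\<exists>v. w \<simeq> iv b # v")
    case True
    then obtain u where u: "w \<simeq> iv b # u" by blast
    have "iv a \<noteq> iv b" using assms by auto
    moreover have "iv a # v \<simeq> iv b # u" using u v teq_sym teq_trans by blast
    ultimately obtain z where z: "v \<simeq> iv b # z" "u \<simeq> iv a # z" using teq_diamond by metis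
    have "act a (act b w) \<simeq> act a u" using u act_cancel act_teq by blast
    moreover have "act a u \<simeq> z" using z act_cancel by blast
    moreover have "act b (act a w) \<simeq> act b v" using v act_cancel act_teq by blast
    moreover have "act b v \<simeq> z" using z act_cancel by blast
    ultimately show ?thesis by (meson teq_sym teq_trans)
  next
    case False
    then show ?thesis using act_commute_aux[OF assms v] by simp
  qed
next
  case na: False
  show ?thesis
  proof (cases "\<exists>v. w \<simeq> iv b # v")
    case True
    then obtain u where u: "w \<simeq> iv b # u" by blast
    show ?thesis using act_commute_aux[OF ind_sym[OF assms] u na] by (rule teq_sym)
  next
    case False
    have "\<nexists>v. b # w \<simeq> iv a # v"
    proof
      assume "\<exists>v. b # w \<simeq> iv a # v"
      then obtain v where "b # w \<simeq> iv a # v" by blast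
      moreover have "b \<noteq> iv a" using assms by auto
      ultimately show False using na teq_diamond by metis
    qed
    moreover have "\<nexists>v. a # w \<simeq> iv b # v"
    proof
      assume "\<exists>v. a # w \<simeq> iv b # v"
      then obtain v where "a # w \<simeq> iv b # v" by blast
      moreover have "a \<noteq> iv b" using assms by auto
      ultimately show False using False teq_diamond by metis
    qed
    ultimately have "act a (act b w) = a # b # w" "act b (act a w) = b # a # w"
      using act_add na False by simp_all
    then show ?thesis using swap2[OF assms] by simp
  qed
qed

definition acts :: "'b list \<Rightarrow> 'b list \<Rightarrow> 'b list" where
  "acts w s = foldr act w s"

lemma acts_simps [simp]: "acts [] s = s" "acts (a # w) s = act a (acts w s)"
  "acts (x @ y) s = acts x (acts y s)"
  by (simp_all add: acts_def)

lemma acts_teq: "s \<simeq> t \<Longrightarrow> acts w s \<simeq> acts w t"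
  by (induction w) (auto intro: act_teq)

lemma reduced_acts: "reduced s \<Longrightarrow> reduced (acts w s)"
  by (induction w) (auto intro: reduced_act)

lemma acts_act_commute: "\<forall>b\<in>set y. ind a b \<Longrightarrow> acts y (act a s) \<simeq> act a (acts y s)"
proof (induction y)
  case (Cons b y)
  then have "act b (acts y (act a s)) \<simeq> act b (act a (acts y s))" by (intro act_teq) simp
  also have "act b (act a (acts y s)) \<simeq> act a (act b (acts y s))"
    using Cons.prems by (intro act_commute) (simp add: ind_sym)
  finally show ?case by simp
qed simp

lemma acts_cong: "x \<simeq> y \<Longrightarrow> acts x s \<simeq> acts y s"
proof (induction x arbitrary: y)
  case Nil
  then show ?case by simp
next
  case (Cons a x)
  then obtain y1 y2 where y: "y = y1 @ a # y2" "\<forall>b\<in>set y1. ind a b" "x \<simeq> y1 @ y2"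
    using teq_Cons_split by metis
  have "act a (acts x s) \<simeq> act a (acts (y1 @ y2) s)" using Cons.IH[OF y(3)] act_teq by blast
  also have "\<dots> \<simeq> acts y s" using acts_act_commute[OF y(2)] y(1) teq_sym by simp
  finally show ?case by simp
qed

text \<open>Equality in the group: two words are identified when they act in the same way on the reduced
  traces. That this is a congruence is immediate from the form of the definition.\<close>

definition geq :: "'b list \<Rightarrow> 'b list \<Rightarrow> bool" (infix "\<doteq>" 50) where
  "x \<doteq> y \<longleftrightarrow> (\<forall>s. reduced s \<longrightarrow> acts x s \<simeq> acts y s)"

lemma geq_refl [simp, intro!]: "x \<doteq> x"
  by (simp add: geq_def)

lemma geq_sym: "x \<doteq> y \<Longrightarrow> y \<doteq> x"
  by (simp add: geq_def teq_sym)

lemma geq_trans [trans]: "x \<doteq> y \<Longrightarrow> y \<doteq> z \<Longrightarrow> x \<doteq> z"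
  unfolding geq_def using teq_trans by blast

lemma geq_append: "x \<doteq> x' \<Longrightarrow> y \<doteq> y' \<Longrightarrow> x @ y \<doteq> x' @ y'"
  unfolding geq_def acts_simps by (meson acts_teq reduced_acts teq_trans)

lemma teq_geq: "x \<simeq> y \<Longrightarrow> x \<doteq> y"
  by (simp add: geq_def acts_cong)

lemma geq_cancel_letter: "[a, iv a] \<doteq> []"
  by (simp add: geq_def act_act_iv)

definition normal_form :: "'b list \<Rightarrow> 'b list" where "normal_form w = acts w []"

lemma reduced_normal_form: "reduced (normal_form w)"
  by (simp add: normal_form_def reduced_acts)

lemma normal_form_Cons: "normal_form (a # w) = act a (normal_form w)"
  by (simp add: normal_form_def)

lemma normal_form_red: "reduced w \<Longrightarrow> normal_form w = w"
proof (induction w)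
  case (Cons a w)
  then show ?case by (simp add: normal_form_Cons act_def)
qed (simp add: normal_form_def)

lemma reduced_geq_teq: "reduced x \<Longrightarrow> reduced y \<Longrightarrow> x \<doteq> y \<Longrightarrow> x \<simeq> y"
  by (metis geq_def normal_form_def normal_form_red reduced.simps(1))

lemma set_act: "set (act a w) \<subseteq> insert a (set w)"
  using strip_SomeD[of "iv a" w] by (fastforce simp: act_def split: option.splits)

lemma set_normal_form: "set (normal_form w) \<subseteq> set w"
proof (induction w)
  case (Cons a w)
  then show ?case using set_act[of a "normal_form w"] by (auto simp: normal_form_Cons)
qed (simp add: normal_form_def)

definition winv :: "'b list \<Rightarrow> 'b list" where "winv w = rev (map iv w)"

lemma winv_simps [simp]: "winv [] = []" "winv (x @ y) = winv y @ winv x" "winv (winv x) = x"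
  "length (winv x) = length x" "set (winv x) = iv ` set x"
  by (simp_all add: winv_def rev_map o_def)

lemma winv_Cons: "winv (a # x) = winv x @ [iv a]"
  by (simp add: winv_def)

lemma geq_winv_right: "x @ winv x \<doteq> []"
proof (induction x)
  case (Cons a x)
  have "[a] @ (x @ winv x) @ [iv a] \<doteq> [a] @ [] @ [iv a]"
    by (intro geq_append geq_refl Cons)
  also have "\<dots> \<doteq> []" using geq_cancel_letter by simp
  finally show ?case by (simp add: winv_Cons)
qed simp

lemma geq_winv_left: "winv x @ x \<doteq> []"
  using geq_winv_right[of "winv x"] by simp

lemma geq_cancel_left [simp]: "x @ y \<doteq> x @ z \<longleftrightarrow> y \<doteq> z"
proof
  assume "x @ y \<doteq> x @ z"
  then have "(winv x @ x) @ y \<doteq> (winv x @ x) @ z"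
    using geq_append[OF geq_refl[of "winv x"]] by simp
  then show "y \<doteq> z"
    using geq_append[OF geq_winv_left[of x] geq_refl[of y]] geq_append[OF geq_winv_left[of x] geq_refl[of z]]
    by (metis append_Nil geq_sym geq_trans)
qed (simp add: geq_append)

lemma geq_cancel_right [simp]: "y @ x \<doteq> z @ x \<longleftrightarrow> y \<doteq> z"
proof
  assume "y @ x \<doteq> z @ x"
  then have "y @ (x @ winv x) \<doteq> z @ (x @ winv x)"
    using geq_append[OF _ geq_refl[of "winv x"]] by fastforce
  then show "y \<doteq> z"
    using geq_append[OF geq_refl[of y] geq_winv_right[of x]] geq_append[OF geq_refl[of z] geq_winv_right[of x]]
    by (metis append_Nil2 geq_sym geq_trans)
qed (simp add: geq_append)

lemma geq_winv: 
  assumes "x \<doteq> y" shows "winv x \<doteq> winv y"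
proof -
  have "x @ winv x \<doteq> x @ winv y"
    using geq_winv_right[of x] geq_winv_right[of y] geq_append[OF assms geq_refl[of "winv y"]]
    by (meson geq_sym geq_trans)
  then show ?thesis by simp
qed

lemma teq_winv: 
  assumes "x \<simeq> y" shows "winv x \<simeq> winv y"
proof (rule teqI)
  fix a b assume "\<not> ind a b"
  have *: "filter (\<lambda>c. c = a \<or> c = b) (winv x) = rev (map iv (filter (\<lambda>c. c = iv a \<or> c = iv b) x))" for x
    unfolding winv_def rev_filter[symmetric] filter_map o_def
    by (rule arg_cong[where f="\<lambda>P. rev (map iv (filter P x))"]) (metis iv_iv)
  show "filter (\<lambda>c. c = a \<or> c = b) (winv x) = filter (\<lambda>c. c = a \<or> c = b) (winv y)"
    unfolding * using teqD[OF assms, of "iv a" "iv b"] \<open>\<not> ind a b\<close> by simp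
qed

lemma geq_Nil_normal_form: "w \<doteq> [] \<Longrightarrow> normal_form w = []"
  by (metis geq_def normal_form_def acts_simps(1) reduced.simps(1) teq_Nil_iff(1))

section \<open>Matchings of trivial products\<close>

text \<open>The normal form is computed from the right. Whenever the letter at position \<open>p\<close> cancels with a
  surviving letter at position \<open>q\<close>, the chord from \<open>p\<close> to \<open>q\<close> is drawn, and all survivors
  below it are independent of the letter at \<open>p\<close>. When two chords cross, the right end of the one
  drawn later was a survivor below the one drawn earlier. Hence crossing chords carry independent letters.
  \<open>S\<close> lists the survivors and \<open>F\<close> is the involution that exchanges the ends of the chords.\<close>

lemma chords_of_word:
  fixes lab :: "nat \<Rightarrow> 'b"
  assumes "sorted_wrt (<) xs"
  shows "\<exists>S F. sorted_wrt (<) S \<and> set S \<subseteq> set xs \<and> map lab S = normal_form (map lab xs) \<and>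
    (\<forall>p\<in>set xs - set S. F p \<in> set xs - set S \<and> F p \<noteq> p \<and> F (F p) = p \<and> lab (F p) = iv (lab p)) \<and>
    (\<forall>p\<in>set xs - set S. \<forall>q\<in>set xs - set S. p < q \<and> q < F p \<and> F p < F q \<longrightarrow> ind (lab p) (lab q)) \<and>
    (\<forall>p\<in>set xs - set S. \<forall>q\<in>set S. p < q \<and> q < F p \<longrightarrow> ind (lab p) (lab q))"
  using assms
proof (induction xs)
  case Nil
  then show ?case by (auto simp: normal_form_def)
next
  case (Cons p xs)
  then obtain S F where S: "sorted_wrt (<) S" "set S \<subseteq> set xs" "map lab S = normal_form (map lab xs)"
    and F: "\<forall>r\<in>set xs - set S. F r \<in> set xs - set S \<and> F r \<noteq> r \<and> F (F r) = r \<and> lab (F r) = iv (lab r)"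
    and cross: "\<forall>r\<in>set xs - set S. \<forall>q\<in>set xs - set S. r < q \<and> q < F r \<and> F r < F q \<longrightarrow> ind (lab r) (lab q)"
    and surv: "\<forall>r\<in>set xs - set S. \<forall>q\<in>set S. r < q \<and> q < F r \<longrightarrow> ind (lab r) (lab q)"
    by auto
  have p: "\<forall>r\<in>set xs. p < r" using Cons.prems by simp
  show ?case
  proof (cases "strip (iv (lab p)) (map lab S)")
    case None
    have D: "set (p # xs) - set (p # S) = set xs - set S" using p by auto
    show ?thesis
    proof (intro exI[of _ "p # S"] exI[of _ F], unfold D, intro conjI)
      show "sorted_wrt (<) (p # S)" using S p by auto
      show "map lab (p # S) = normal_form (map lab (p # xs))"
        using None S(3) by (simp add: normal_form_Cons act_def)
      show "\<forall>r\<in>set xs - set S. \<forall>q\<in>set (p # S). r < q \<and> q < F r \<longrightarrow> ind (lab r) (lab q)"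
        using surv p by auto
    qed (use S F cross in auto)
  next
    case (Some w)
    from strip_SomeD[OF Some] obtain w1 w2 where w: "map lab S = w1 @ iv (lab p) # w2" "w = w1 @ w2"
      "\<forall>b\<in>set w1. ind (iv (lab p)) b" by blast
    from w(1) obtain S1 q S2 where q: "S = S1 @ q # S2" "w1 = map lab S1" "lab q = iv (lab p)" "w2 = map lab S2"
      by (auto simp: map_eq_append_conv map_eq_Cons_conv)
    have qs: "q \<in> set S" "q \<in> set xs" "p < q" using q S(2) p by auto
    have s1: "r < q" if "r \<in> set S1" for r using S(1) q(1) that by (auto simp: sorted_wrt_append)
    have s2: "q < r" if "r \<in> set S2" for r using S(1) q(1) that by (auto simp: sorted_wrt_append)
    have pS: "p \<notin> set S" "p \<notin> set xs" using p S(2) by auto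
    have qn: "q \<notin> set (S1 @ S2)" using s1 s2 by fastforce
    define F' where "F' = F(p := q, q := p)"
    have D: "set (p # xs) - set (S1 @ S2) = insert p (insert q (set xs - set S))"
      using q(1) qs pS qn by auto
    have F'old: "F' r = F r" if "r \<in> set xs - set S" for r
      using that qs pS by (auto simp: F'_def)
    have F'p: "F' p = q" "F' q = p" using qs by (auto simp: F'_def)
    have q_notin: "q \<notin> set xs - set S" "p \<notin> set xs - set S" using qs pS by auto
    have ind1: "ind (lab p) (lab r)" if "r \<in> set S1" for r using w(3) q(2) that by simp
    have Flt: "p < F r" "F r \<noteq> q" if "r \<in> set xs - set S" for r using that F p qs by blast+
    show ?thesis
    proof (intro exI[of _ "S1 @ S2"] exI[of _ F'], unfold D, intro conjI)
      show "sorted_wrt (<) (S1 @ S2)" using S(1) q(1) by (auto simp: sorted_wrt_append)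
      show "set (S1 @ S2) \<subseteq> set (p # xs)" using S(2) q(1) by auto
      show "map lab (S1 @ S2) = normal_form (map lab (p # xs))"
        using Some S(3) w(2) q by (simp add: normal_form_Cons act_def)
      show "\<forall>r\<in>insert p (insert q (set xs - set S)).
         F' r \<in> insert p (insert q (set xs - set S)) \<and> F' r \<noteq> r \<and> F' (F' r) = r \<and> lab (F' r) = iv (lab r)"
        using F F'old F'p q(3) qs(3) by auto
      show "\<forall>r\<in>insert p (insert q (set xs - set S)). \<forall>t\<in>insert p (insert q (set xs - set S)).
          r < t \<and> t < F' r \<and> F' r < F' t \<longrightarrow> ind (lab r) (lab t)"
      proof (intro ballI impI)
        fix r t assume r: "r \<in> insert p (insert q (set xs - set S))"
          and t: "t \<in> insert p (insert q (set xs - set S))" and h: "r < t \<and> t < F' r \<and> F' r < F' t"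
        consider "r = p" | "r = q" | "r \<in> set xs - set S" using r by blast
        then show "ind (lab r) (lab t)"
        proof cases
          case 1
          then have t': "t \<in> set xs - set S" using t h F'p by auto
          then have "ind (lab t) (lab q)" using surv qs(1) h F'p 1 F'old[OF t'] by auto
          then show ?thesis using 1 q(3) ind_sym by simp
        next
          case 2
          then show ?thesis using h F'p qs(3) by simp
        next
          case 3
          then have "p < r" using p by auto
          then have "t \<noteq> p" using h by auto
          moreover have "t \<noteq> q" using h F'p Flt(1)[OF 3] F'old[OF 3] by auto
          ultimately have "t \<in> set xs - set S" using t by blast
          then show ?thesis using cross 3 h F'old by metis
        qed
      qed
      show "\<forall>r\<in>insert p (insert q (set xs - set S)). \<forall>s\<in>set (S1 @ S2). r < s \<and> s < F' r \<longrightarrow> ind (lab r) (lab s)"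
      proof (intro ballI impI)
        fix r s assume r: "r \<in> insert p (insert q (set xs - set S))"
          and s: "s \<in> set (S1 @ S2)" and h: "r < s \<and> s < F' r"
        consider "r = p" | "r = q" | "r \<in> set xs - set S" using r by blast
        then show "ind (lab r) (lab s)"
        proof cases
          case 1
          then have "s < q" using h F'p by simp
          then have "s \<in> set S1" using s s2 by fastforce
          then show ?thesis using ind1 1 by simp
        next
          case 2
          then show ?thesis using h F'p qs(3) by simp
        next
          case 3
          then show ?thesis using surv h F'old[OF 3] s q(1) by auto
        qed
      qed
    qed
  qed
qed

end

lemma concat_filter_keys:
  assumes "sorted_wrt (\<lambda>q q'. rk q > (rk q' :: nat)) qs" "sorted_wrt (\<lambda>p p'. rk (key p) \<ge> rk (key p')) ps"
    and "key ` set ps \<subseteq> set qs"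
  shows "concat (map (\<lambda>q. filter (\<lambda>p. key p = q) ps) qs) = ps"
  using assms(2,3)
proof (induction ps)
  case Nil
  then show ?case by (induction qs) auto
next
  case (Cons p ps)
  then obtain q1 q2 where q: "qs = q1 @ key p # q2" by (auto dest: split_list)
  have l: "rk q > rk (key p)" if "q \<in> set q1" for q using assms(1) that q by (auto simp: sorted_wrt_append)
  have r: "rk q < rk (key p)" if "q \<in> set q2" for q using assms(1) that q by (auto simp: sorted_wrt_append)
  have 1: "filter (\<lambda>p. key p = q) (p # ps) = []" if "q \<in> set q1" for q
    using l[OF that] Cons.prems(1) by (auto simp: filter_empty_conv)
  then have 2: "filter (\<lambda>p. key p = q) ps = []" if "q \<in> set q1" for q
    using that by (metis (mono_tags, lifting) filter.simps(2) list.discI)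
  have 3: "filter (\<lambda>p. key p = q) (p # ps) = filter (\<lambda>p. key p = q) ps" if "q \<in> set q2" for q
    using r[OF that] by auto
  have c1: "concat (map (\<lambda>q. filter (\<lambda>p. key p = q) (p # ps)) q1) = []"
    using 1 by (simp only: concat_eq_Nil_conv) auto
  have c2: "concat (map (\<lambda>q. filter (\<lambda>p. key p = q) ps) q1) = []"
    using 2 by (simp only: concat_eq_Nil_conv) auto
  have c3: "map (\<lambda>q. filter (\<lambda>p. key p = q) (p # ps)) q2 = map (\<lambda>q. filter (\<lambda>p. key p = q) ps) q2"
    using 3 by simp
  have IH: "concat (map (\<lambda>q. filter (\<lambda>p. key p = q) ps) qs) = ps"
    using Cons by auto
  show ?case using IH unfolding q map_append list.map concat_append concat.simps c1 c2 c3 by simp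
qed

text \<open>The other blocks in the order in which the letters of block \<open>P\<close> meet them: seen from \<open>P\<close>, chords
  that do not cross have their far ends in reversed cyclic order.\<close>

definition around :: "nat \<Rightarrow> nat \<Rightarrow> nat list" where
  "around m P = rev [0..<P] @ rev [Suc P..<m]"

lemma set_around: "P < m \<Longrightarrow> set (around m P) = {..<m} - {P}"
  by (auto simp: around_def)

lemma around_sorted: "P < m \<Longrightarrow>
  sorted_wrt (\<lambda>q q'. (if q < P then m + q else q) > (if q' < P then m + q' else q')) (around m P)"
  unfolding around_def sorted_wrt_append
proof (intro conjI ballI)
  show "sorted_wrt (\<lambda>q q'. (if q < P then m + q else q) > (if q' < P then m + q' else q')) (rev [0..<P])"
    unfolding sorted_wrt_rev by (rule sorted_wrt_mono_rel[OF _ sorted_wrt_upt]) auto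
  show "sorted_wrt (\<lambda>q q'. (if q < P then m + q else q) > (if q' < P then m + q' else q')) (rev [Suc P..<m])"
    unfolding sorted_wrt_rev by (rule sorted_wrt_mono_rel[OF _ sorted_wrt_upt]) auto
qed auto

context trace_alphabet
begin

lemma blocks_positions:
  obtains lab :: "nat \<Rightarrow> 'b" and bl :: "nat \<Rightarrow> nat" and L where
    "\<And>p q. p \<le> q \<Longrightarrow> q < L \<Longrightarrow> bl p \<le> bl q"
    "\<And>p. p < L \<Longrightarrow> bl p < m"
    "\<And>P. P < m \<Longrightarrow> map lab (filter (\<lambda>p. bl p = P) [0..<L]) = B P"
    "map lab [0..<L] = concat (map B [0..<m])"
proof -
  define Z where "Z = concat (map (\<lambda>P. map (Pair P) (B P)) [0..<m])"
  have Z: "Z = map ((!) Z) [0..<length Z]" by (simp add: map_nth)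
  have "sorted (map fst (concat (map (\<lambda>P. map (Pair P) (B P)) [0..<m])))"
    by (induction m) (auto simp: sorted_append o_def sorted_map_same map_replicate_const)
  then have sZ: "sorted (map fst Z)" unfolding Z_def .
  show ?thesis
  proof (rule that[of "length Z" "\<lambda>p. fst (Z ! p)" "\<lambda>p. snd (Z ! p)"])
    show "fst (Z ! p) \<le> fst (Z ! q)" if "p \<le> q" "q < length Z" for p q
      using sorted_nth_mono[OF sZ that(1)] that by simp
    show "fst (Z ! p) < m" if "p < length Z" for p
      using nth_mem[OF that] unfolding Z_def by auto
    show "map (\<lambda>p. snd (Z ! p)) (filter (\<lambda>p. fst (Z ! p) = P) [0..<length Z]) = B P" if "P < m" for P
    proof -
      have "map (\<lambda>p. snd (Z ! p)) (filter (\<lambda>p. fst (Z ! p) = P) [0..<length Z])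
          = map snd (filter (\<lambda>z. fst z = P) (map ((!) Z) [0..<length Z]))"
        unfolding filter_map map_map o_def ..
      also have "\<dots> = map snd (filter (\<lambda>z. fst z = P) Z)" using Z by simp
      also have "\<dots> = B P"
        using that unfolding Z_def
      proof (induction m)
        case (Suc m)
        have e: "filter (\<lambda>z. fst z = P) (map (Pair m) (B m)) = (if P = m then map (Pair m) (B m) else [])"
          by (auto simp: filter_map o_def)
        show ?case
        proof (cases "P = m")
          case True
          have "filter (\<lambda>z. fst z = P) (concat (map (\<lambda>P. map (Pair P) (B P)) [0..<m])) = []"
            using True by (auto simp: filter_empty_conv)
          then show ?thesis using e True by (simp add: o_def)
        next
          case False
          then show ?thesis using Suc e by simp
        qed
      qed simp
      finally show ?thesis .
    qed
    have "map (\<lambda>p. snd (Z ! p)) [0..<length Z] = map snd (map ((!) Z) [0..<length Z])" by simp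
    also have "\<dots> = map snd Z" using Z by simp
    also have "\<dots> = concat (map B [0..<m])" unfolding Z_def by (induction m) (auto simp: o_def)
    finally show "map (\<lambda>p. snd (Z ! p)) [0..<length Z] = concat (map B [0..<m])" .
  qed
qed

lemma strict_sorted_eqI:
  "sorted_wrt (<) (xs :: nat list) \<Longrightarrow> sorted_wrt (<) ys \<Longrightarrow> set xs = set ys \<Longrightarrow> xs = ys"
  by (simp add: strict_sorted_equal)

lemma upt_filter_sorted: "sorted_wrt (<) (filter Q [0..<L])"
  by (rule sorted_wrt_filter) simp

text \<open>The geometric core. The word \<open>M P Q\<close> collects the letters of block \<open>P\<close> whose chord ends in block
  \<open>Q\<close>. No chord stays inside a block: between the ends of a shortest such chord all chords leave and
  therefore cross it, so that its two letters would cancel within the block. Dependent letters have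
  chords that do not cross, and this gives the order of the words \<open>M P Q\<close> along block \<open>P\<close> as well as
  the reversal of order between \<open>M P Q\<close> and \<open>M Q P\<close>.\<close>

theorem trivial_product_matching:
  assumes triv: "concat (map B [0..<m]) \<doteq> []" and redB: "\<And>P. P < m \<Longrightarrow> reduced (B P)"
  obtains M :: "nat \<Rightarrow> nat \<Rightarrow> 'b list" where
    "\<And>P. P < m \<Longrightarrow> B P \<simeq> concat (map (M P) (around m P))"
    "\<And>P Q. P < m \<Longrightarrow> Q < m \<Longrightarrow> P \<noteq> Q \<Longrightarrow> M Q P \<simeq> winv (M P Q)"
    "\<And>P R Q S. P < R \<Longrightarrow> R < Q \<Longrightarrow> Q < S \<Longrightarrow> S < m \<Longrightarrow> indw (M P Q) (M R S)"
proof -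
  obtain lab :: "nat \<Rightarrow> 'b" and bl L where bl_mono: "\<And>p q. p \<le> q \<Longrightarrow> q < L \<Longrightarrow> bl p \<le> bl q"
    and bl_m: "\<And>p. p < L \<Longrightarrow> bl p < m"
    and labB: "\<And>P. P < m \<Longrightarrow> map lab (filter (\<lambda>p. bl p = P) [0..<L]) = B P"
    and labW: "map lab [0..<L] = concat (map B [0..<m])"
    using blocks_positions[of m B] by metis
  obtain S F where SF: "map lab S = normal_form (map lab [0..<L])"
    "\<forall>p\<in>set [0..<L] - set S. F p \<in> set [0..<L] - set S \<and> F p \<noteq> p \<and> F (F p) = p \<and> lab (F p) = iv (lab p)"
    "\<forall>p\<in>set [0..<L] - set S. \<forall>q\<in>set [0..<L] - set S. p < q \<and> q < F p \<and> F p < F q \<longrightarrow> ind (lab p) (lab q)"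
    using chords_of_word[of "[0..<L]" lab] by auto
  have "S = []" using SF(1) triv labW geq_Nil_normal_form by simp
  then have F: "F p < L" "F p \<noteq> p" "F (F p) = p" "lab (F p) = iv (lab p)" if "p < L" for p
    using SF(2) that by auto
  have cross: "ind (lab p) (lab q)" if "p < q" "q < F p" "F p < F q" "p < L" "q < L" for p q
    using SF(3) that \<open>S = []\<close> by auto
  have pos_lt: "p < q" if "bl p < bl q" "p < L" for p q
    using that bl_mono[of q p] by (meson leD not_le_imp_less)
  have out: "bl (F p) \<noteq> bl p" if "p < L" for p
  proof
    assume "bl (F p) = bl p"
    then have ex: "\<exists>k p. p < L \<and> F p = p + k \<and> bl (F p) = bl p"
    proof (cases "p \<le> F p")
      case True
      then show ?thesis using that \<open>bl (F p) = bl p\<close> by (metis le_add_diff_inverse)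
    next
      case False
      then show ?thesis using that \<open>bl (F p) = bl p\<close> F[OF that] by (metis le_add_diff_inverse nat_le_linear)
    qed
    \<comment> \<open>a chord inside a block of minimal width \<open>k\<close>\<close>
    define k where "k = (LEAST k. \<exists>p. p < L \<and> F p = p + k \<and> bl (F p) = bl p)"
    have "\<exists>p. p < L \<and> F p = p + k \<and> bl (F p) = bl p" unfolding k_def using ex by (rule LeastI_ex)
    then obtain p where p: "p < L" "F p = p + k" "bl (F p) = bl p" by blast
    have least: "\<not> (r < L \<and> F r = r + j \<and> bl (F r) = bl r)" if "j < k" for j r
      using that not_less_Least unfolding k_def by blast
    define q where "q = F p"
    have q: "q < L" "p < q" "bl q = bl p" "lab q = iv (lab p)" "F q = p" using F[OF p(1)] p by (auto simp: q_def)
    have between: "ind (lab p) (lab r)" if r: "p < r" "r < q" for r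
    proof -
      have rL: "r < L" using r q by simp
      have blr: "bl r = bl p" using bl_mono[of p r] bl_mono[of r q] r q by auto
      have ne: "F r \<noteq> p" "F r \<noteq> q" using F[OF rL] F[OF p(1)] q r q_def by (metis less_irrefl)+
      have "\<not> (p < F r \<and> F r < q)"
      proof
        assume a: "p < F r \<and> F r < q"
        have b: "bl (F r) = bl p" using bl_mono[of p "F r"] bl_mono[of "F r" q] a q by auto
        show False
        proof (cases "r < F r")
          case True
          then have "F r - r < k" "F r = r + (F r - r)" using a r p q_def by auto
          then show False using least[of "F r - r" r] rL blr b by auto
        next
          case False
          then have "F r < r" using F(2)[OF rL] by linarith
          then have "r - F r < k" "r = F r + (r - F r)" using a r p q_def by auto
          then show False using least[of "r - F r" "F r"] F[OF rL] blr b by auto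
        qed
      qed
      then consider "F r < p" | "F r > q" using ne by linarith
      then show ?thesis
      proof cases
        case 1
        have "ind (lab (F r)) (lab p)" using cross[of "F r" p] F[OF rL] 1 r p(1) q_def by simp
        then show ?thesis using F[OF rL] ind_sym by simp
      next
        case 2
        then show ?thesis using cross[of p r] r q_def p(1) rL by simp
      qed
    qed
    have split: "[0..<L] = [0..<p] @ p # [Suc p..<q] @ q # [Suc q..<L]"
      using upt_add_eq_append[of 0 p "L - p"] upt_conv_Cons[of p L] upt_conv_Cons[of q L]
        upt_add_eq_append[of "Suc p" q "L - q"] q by simp
    have "B (bl p) = map lab (filter (\<lambda>r. bl r = bl p) ([0..<p] @ p # [Suc p..<q] @ q # [Suc q..<L]))"
      using labB[OF bl_m[OF p(1)]] split by simp
    also have "\<dots> = map lab (filter (\<lambda>r. bl r = bl p) [0..<p]) @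
       (lab p # map lab (filter (\<lambda>r. bl r = bl p) [Suc p..<q]) @ [iv (lab p)]) @
       map lab (filter (\<lambda>r. bl r = bl p) [Suc q..<L])"
      using q by simp
    finally have "reduced (lab p # map lab (filter (\<lambda>r. bl r = bl p) [Suc p..<q]) @ [iv (lab p)])"
      using redB[OF bl_m[OF p(1)]] by (metis reduced_factor)
    moreover have "\<forall>b\<in>set (map lab (filter (\<lambda>r. bl r = bl p) [Suc p..<q])). ind (iv (lab p)) b"
      using between by auto
    ultimately show False
      using strip_split by fastforce
  qed
  define M where "M P Q = map lab (filter (\<lambda>p. bl p = P \<and> bl (F p) = Q) [0..<L])" for P Q
  \<comment> \<open>the rank realises the cyclic order of \<open>around\<close> as a decreasing order on numbers\<close>
  define rk where "rk P q = (if q < P then m + q else q)" for P q :: nat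
  show ?thesis
  proof (rule that[of M])
    fix P assume P: "P < m"
    show "B P \<simeq> concat (map (M P) (around m P))"
    proof (rule teqI)
      fix a b assume ab: "\<not> ind a b"
      define ps where "ps = filter (\<lambda>p. bl p = P \<and> (lab p = a \<or> lab p = b)) [0..<L]"
      have dep: "\<not> ind (lab p) (lab q)" if "p \<in> set ps" "q \<in> set ps" for p q
        using that ab ind_sym unfolding ps_def by auto
      have L: "filter (\<lambda>c. c = a \<or> c = b) (B P) = map lab ps"
        unfolding labB[OF P, symmetric] ps_def filter_map filter_filter by (simp add: o_def conj_commute)
      have "filter (\<lambda>c. c = a \<or> c = b) (M P Q) = map lab (filter (\<lambda>p. bl (F p) = Q) ps)" for Q
        unfolding M_def ps_def filter_map filter_filter o_def
        by (rule arg_cong[where f="\<lambda>R. map lab (filter R [0..<L])"]) auto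
      then have "filter (\<lambda>c. c = a \<or> c = b) (concat (map (M P) (around m P)))
         = map lab (concat (map (\<lambda>Q. filter (\<lambda>p. bl (F p) = Q) ps) (around m P)))"
        by (simp add: filter_concat map_concat o_def)
      also have "concat (map (\<lambda>Q. filter (\<lambda>p. bl (F p) = Q) ps) (around m P)) = ps"
      proof (rule concat_filter_keys[where rk="rk P"])
        show "sorted_wrt (\<lambda>q q'. rk P q' < rk P q) (around m P)"
          using around_sorted[OF P] unfolding rk_def by simp
        show "(\<lambda>p. bl (F p)) ` set ps \<subseteq> set (around m P)"
          using out bl_m F(1) unfolding set_around[OF P] ps_def by auto
        have "sorted_wrt (<) ps" unfolding ps_def by (rule upt_filter_sorted)
        then show "sorted_wrt (\<lambda>p p'. rk P (bl (F p')) \<le> rk P (bl (F p))) ps"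
        proof (rule sorted_wrt_mono_rel[rotated])
          fix p p' assume pp: "p \<in> set ps" "p' \<in> set ps" "p < p'"
          have d: "\<not> ind (lab p) (lab p')" "\<not> ind (lab p') (lab p)" using dep pp by auto
          have bnd: "p < L" "p' < L" "bl p = P" "bl p' = P" using pp by (auto simp: ps_def)
          have ne: "bl (F p) \<noteq> P" "bl (F p') \<noteq> P" using out bnd by metis+
          have lt: "bl (F p) < m" "bl (F p') < m" using bl_m F(1) bnd by blast+
          have FF: "F p \<noteq> F p'" using F(3) bnd pp(3) by (metis less_irrefl)
          consider "bl (F p) < P" "bl (F p') > P" | "bl (F p) < P" "bl (F p') < P"
            | "bl (F p) > P" "bl (F p') < P" | "bl (F p) > P" "bl (F p') > P"
            using ne by linarith
          then show "rk P (bl (F p')) \<le> rk P (bl (F p))"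
          proof cases
            case 1
            then show ?thesis using lt by (simp add: rk_def)
          next
            case 2
            have less: "F p' < p'" "F p' < p" "F p < p" using pos_lt[of "F p'" p'] pos_lt[of "F p'" p] pos_lt[of "F p" p] 2 bnd F(1) by auto
            have "\<not> F p < F p'"
              using cross[of "F p" "F p'"] less F bnd pp(3) d by auto
            then have "bl (F p') \<le> bl (F p)" using bl_mono[of "F p'" "F p"] F(1)[OF bnd(1)] by simp
            then show ?thesis using 2 by (simp add: rk_def)
          next
            case 3
            have less: "F p' < p" "p' < F p" using pos_lt[of "F p'" p] pos_lt[of p' "F p"] 3 bnd F(1) by auto
            then have False using cross[of "F p'" p] F bnd pp(3) d by auto
            then show ?thesis ..
          next
            case 4
            have less: "p' < F p" using pos_lt[of p' "F p"] 4 bnd F(1) by auto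
            have "\<not> F p < F p'"
              using cross[of p p'] less F bnd pp(3) d by auto
            then have "bl (F p') \<le> bl (F p)" using bl_mono[of "F p'" "F p"] F(1)[OF bnd(1)] by simp
            then show ?thesis using 4 by (simp add: rk_def)
          qed
        qed
      qed
      finally show "filter (\<lambda>c. c = a \<or> c = b) (B P) = filter (\<lambda>c. c = a \<or> c = b) (concat (map (M P) (around m P)))"
        using L by simp
    qed
  next
    fix P Q assume PQ: "P < m" "Q < m" "P \<noteq> Q"
    show "M Q P \<simeq> winv (M P Q)"
    proof (rule teqI)
      fix a b assume ab: "\<not> ind a b"
      define qs where "qs = filter (\<lambda>q. (bl q = Q \<and> bl (F q) = P) \<and> (lab q = a \<or> lab q = b)) [0..<L]"
      define ps where "ps = filter (\<lambda>p. (bl p = P \<and> bl (F p) = Q) \<and> (lab p = iv a \<or> lab p = iv b)) [0..<L]"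
      have L: "filter (\<lambda>c. c = a \<or> c = b) (M Q P) = map lab qs"
        unfolding M_def qs_def filter_map filter_filter o_def
        by (rule arg_cong[where f="\<lambda>R. map lab (filter R [0..<L])"]) auto
      have iv_eq: "iv x = y \<longleftrightarrow> x = iv y" for x y by auto
      have "filter (\<lambda>c. c = a \<or> c = b) (winv (M P Q)) = rev (map (\<lambda>p. iv (lab p)) ps)"
        unfolding M_def ps_def winv_def rev_filter[symmetric] filter_map filter_filter o_def map_map iv_eq
        by (rule arg_cong[where f="\<lambda>R. rev (map (\<lambda>p. iv (lab p)) (filter R [0..<L]))"]) auto
      also have "map (\<lambda>p. iv (lab p)) ps = map (\<lambda>p. lab (F p)) ps"
        using F(4) by (auto simp: ps_def)
      also have "rev (map (\<lambda>p. lab (F p)) ps) = map lab (rev (map F ps))" by (simp add: rev_map)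
      also have "rev (map F ps) = qs"
      proof (rule strict_sorted_eqI)
        show "sorted_wrt (<) qs" unfolding qs_def by (rule upt_filter_sorted)
        have "sorted_wrt (<) ps" unfolding ps_def by (rule upt_filter_sorted)
        then show "sorted_wrt (<) (rev (map F ps))"
          unfolding sorted_wrt_rev sorted_wrt_map
        proof (rule sorted_wrt_mono_rel[rotated])
          fix p p' assume pp: "p \<in> set ps" "p' \<in> set ps" "p < p'"
          have d: "\<not> ind (lab p) (lab p')" "\<not> ind (lab p') (lab p)"
            using ab ind_sym pp unfolding ps_def by auto
          have bnd: "p < L" "p' < L" "bl p = P" "bl p' = P" "bl (F p) = Q" "bl (F p') = Q" using pp by (auto simp: ps_def)
          have FF: "F p \<noteq> F p'" using F(3) bnd pp(3) by (metis less_irrefl)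
          show "F p' < F p"
          proof (cases "P < Q")
            case True
            have less: "p' < F p" using pos_lt[of p' "F p"] True bnd F(1) by auto
            then have "\<not> F p < F p'"
              using cross[of p p'] less F bnd pp(3) d by auto
            then show ?thesis using FF by simp
          next
            case False
            then have "Q < P" using PQ by simp
            then have less: "F p' < p" using pos_lt[of "F p'" p] bnd F(1) by auto
            have "\<not> F p < F p'"
              using cross[of "F p" "F p'"] less F bnd pp(3) d by auto
            then show ?thesis using FF by simp
          qed
        qed
        show "set (rev (map F ps)) = set qs"
        proof (intro subset_antisym subsetI)
          fix q assume "q \<in> set (rev (map F ps))"
          then show "q \<in> set qs" using F by (auto simp: ps_def qs_def)
        next
          fix q assume q: "q \<in> set qs"
          then have "F q \<in> set ps" "F (F q) = q" using F by (auto simp: ps_def qs_def)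
          then show "q \<in> set (rev (map F ps))" by (metis image_eqI set_map set_rev)
        qed
      qed
      finally show "filter (\<lambda>c. c = a \<or> c = b) (M Q P) = filter (\<lambda>c. c = a \<or> c = b) (winv (M P Q))"
        using L by simp
    qed
  next
    fix P R Q S assume o: "P < R" "R < Q" "Q < S" "S < m"
    show "indw (M P Q) (M R S)"
      unfolding indw_def
    proof (intro ballI)
      fix a b assume "a \<in> set (M P Q)" "b \<in> set (M R S)"
      then obtain p r where pr: "p < L" "bl p = P" "bl (F p) = Q" "lab p = a" "r < L" "bl r = R" "bl (F r) = S" "lab r = b"
        by (auto simp: M_def)
      have "p < r" "r < F p" "F p < F r"
        using pos_lt[of p r] pos_lt[of r "F p"] pos_lt[of "F p" "F r"] o pr F(1) by auto
      then show "ind a b" using cross[of p r] pr by auto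
    qed
  qed
qed

lemma geq_concat_commute:
  assumes "\<And>w. w \<in> set ws \<Longrightarrow> w @ x \<doteq> x @ w"
  shows "concat ws @ x \<doteq> x @ concat ws"
  using assms
proof (induction ws)
  case (Cons w ws)
  have "(w @ concat ws) @ x \<doteq> w @ x @ concat ws" using Cons geq_append[OF geq_refl[of w]] by simp
  also have "w @ x @ concat ws \<doteq> x @ w @ concat ws"
    using geq_append[OF Cons.prems[of w] geq_refl[of "concat ws"]] by simp
  finally show ?case by simp
qed simp

lemma geq_zip_columns:
  assumes "\<And>i j. i < j \<Longrightarrow> j < length ts \<Longrightarrow> d (ts ! i) @ C (ts ! j) \<doteq> C (ts ! j) @ d (ts ! i)"
  shows "concat (map C ts) @ concat (map d ts) \<doteq> concat (map (\<lambda>t. C t @ d t) ts)"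
  using assms
proof (induction ts)
  case (Cons t ts)
  have IH: "concat (map C ts) @ concat (map d ts) \<doteq> concat (map (\<lambda>t. C t @ d t) ts)"
  proof (rule Cons.IH)
    fix i j assume ij: "i < j" "j < length ts"
    show "d (ts ! i) @ C (ts ! j) \<doteq> C (ts ! j) @ d (ts ! i)" using Cons.prems[of "Suc i" "Suc j"] ij by simp
  qed
  have "w @ d t \<doteq> d t @ w" if "w \<in> set (map C ts)" for w
  proof -
    obtain j where "j < length ts" "w = C (ts ! j)" using \<open>w \<in> set (map C ts)\<close>
      by (metis in_set_conv_nth length_map nth_map)
    then have "d t @ w \<doteq> w @ d t" using Cons.prems[of 0 "Suc j"] by simp
    then show ?thesis by (rule geq_sym)
  qed
  then have "concat (map C ts) @ d t \<doteq> d t @ concat (map C ts)" by (rule geq_concat_commute)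
  then have "C t @ (concat (map C ts) @ d t) @ concat (map d ts) \<doteq> C t @ (d t @ concat (map C ts)) @ concat (map d ts)"
    by (rule geq_append[OF geq_refl geq_append[OF _ geq_refl]])
  also have "\<dots> \<doteq> C t @ d t @ concat (map (\<lambda>t. C t @ d t) ts)"
    using geq_append[OF geq_refl[of "C t @ d t"] IH] by simp
  finally show ?case by simp
qed simp

lemma geq_telescope:
  assumes "\<And>i. i < j \<Longrightarrow> y i \<doteq> winv (x i)"
  shows "concat (map x [0..<j]) @ concat (map y (rev [0..<j])) \<doteq> []"
  using assms
proof (induction j)
  case (Suc j)
  have "y j \<doteq> winv (x j)" by (rule Suc.prems) simp
  then have "x j @ y j \<doteq> []"
    using geq_append[OF geq_refl[of "x j"]] geq_winv_right geq_trans by blast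
  then have "concat (map x [0..<j]) @ (x j @ y j) @ concat (map y (rev [0..<j]))
      \<doteq> concat (map x [0..<j]) @ [] @ concat (map y (rev [0..<j]))"
    by (intro geq_append geq_refl)
  also have "\<dots> \<doteq> []" using Suc by simp
  finally show ?case by simp
qed simp

text \<open>Conversely, such data forces the product to be trivial. After the first \<open>j\<close> blocks have been
  multiplied, what remains are the words \<open>M i t\<close> with \<open>i < j \<le> t\<close>, arranged in columns of fixed \<open>t\<close>
  with \<open>t\<close> decreasing. The next block first cancels the column of \<open>t = j\<close>; its remaining words move
  left to the ends of their columns past words whose chords cross theirs.\<close>

theorem matching_trivial_product:
  assumes inverse: "\<And>P Q. P < Q \<Longrightarrow> Q < m \<Longrightarrow> M Q P \<doteq> winv (M P Q)"
    and commute: "\<And>P R Q S. P < R \<Longrightarrow> R < Q \<Longrightarrow> Q < S \<Longrightarrow> S < m \<Longrightarrow> M P Q @ M R S \<doteq> M R S @ M P Q"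
  shows "concat (map (\<lambda>P. concat (map (M P) (around m P))) [0..<m]) \<doteq> []"
proof -
  define col where "col j t = concat (map (\<lambda>i. M i t) [0..<j])" for j t
  have "concat (map (\<lambda>P. concat (map (M P) (around m P))) [0..<j]) \<doteq> concat (map (col j) (rev [j..<m]))"
    if "j \<le> m" for j using that
  proof (induction j)
    case 0
    have e: "concat (map (col 0) (rev [0..<m])) = []" by (simp add: col_def)
    show ?case unfolding e by simp
  next
    case (Suc j)
    then have jm: "j < m" by simp
    define ts where "ts = rev [Suc j..<m]"
    have ts: "set ts = {Suc j..<m}" "length ts = m - Suc j" "\<And>i. i < m - Suc j \<Longrightarrow> ts ! i = m - Suc i"
      by (auto simp: ts_def rev_nth)
    have *: "rev [j..<m] = ts @ [j]" using jm by (simp add: ts_def upt_rec)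
    have "concat (map (\<lambda>P. concat (map (M P) (around m P))) [0..<Suc j])
        \<doteq> concat (map (col j) (rev [j..<m])) @ concat (map (M j) (around m j))"
      using geq_append[OF Suc.IH geq_refl[of "concat (map (M j) (around m j))"]] Suc.prems by simp
    also have "\<dots> = concat (map (col j) ts) @
        (concat (map (\<lambda>i. M i j) [0..<j]) @ concat (map (M j) (rev [0..<j]))) @ concat (map (M j) ts)"
      unfolding * around_def ts_def[symmetric] by (simp add: col_def)
    also have "\<dots> \<doteq> concat (map (col j) ts) @ [] @ concat (map (M j) ts)"
      using inverse jm by (intro geq_append geq_refl geq_telescope) simp
    also have "\<dots> = concat (map (col j) ts) @ concat (map (M j) ts)" by simp
    also have "\<dots> \<doteq> concat (map (\<lambda>t. col j t @ M j t) ts)"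
    proof (rule geq_zip_columns)
      fix i i' assume "i < i'" "i' < length ts"
      then have t: "j < ts ! i'" "ts ! i' < ts ! i" "ts ! i < m" using ts(2,3) by auto
      have "w @ M j (ts ! i) \<doteq> M j (ts ! i) @ w" if "w \<in> set (map (\<lambda>k. M k (ts ! i')) [0..<j])" for w
      proof -
        obtain k where k: "k < j" "w = M k (ts ! i')"
          using \<open>w \<in> set (map (\<lambda>k. M k (ts ! i')) [0..<j])\<close> by auto
        then show ?thesis using commute[of k j "ts ! i'" "ts ! i"] t by simp
      qed
      then show "M j (ts ! i) @ col j (ts ! i') \<doteq> col j (ts ! i') @ M j (ts ! i)"
        unfolding col_def by (intro geq_sym[OF geq_concat_commute])
    qed
    also have "(\<lambda>t. col j t @ M j t) = col (Suc j)" by (simp add: col_def fun_eq_iff)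
    finally show ?case by (simp add: ts_def)
  qed
  from this[of m] show ?thesis by simp
qed

end

section \<open>Trace factors of powers of connected words\<close>

definition wpow :: "nat \<Rightarrow> 'b list \<Rightarrow> 'b list" where
  "wpow k u = concat (replicate k u)"

lemma wpow_simps [simp]: "wpow 0 u = []" "wpow (Suc k) u = u @ wpow k u" "wpow k [] = []"
  by (auto simp: wpow_def)

lemma wpow_add: "wpow (j + k) u = wpow j u @ wpow k u"
  by (simp add: wpow_def replicate_add)

lemma wpow_le: "j \<le> k \<Longrightarrow> wpow k u = wpow j u @ wpow (k - j) u"
  by (metis le_add_diff_inverse wpow_add)

lemma wpow_mult: "wpow k (wpow j u) = wpow (k * j) u"
  by (induction k) (auto simp: wpow_add)

lemma length_wpow [simp]: "length (wpow k u) = k * length u"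
  by (induction k) auto

lemma set_wpow: "set (wpow k u) = (if k = 0 then {} else set u)"
  by (induction k) auto

lemma count_wpow [simp]: "count (mset (wpow k u)) a = k * count (mset u) a"
  by (induction k) auto

lemma filter_wpow: "filter P (wpow k u) = wpow k (filter P u)"
  by (induction k) auto

lemma wpow_Suc_right: "wpow (Suc k) u = wpow k u @ u"
  using wpow_add[of k 1 u] by simp

context trace_alphabet
begin

lemma winv_wpow: "winv (wpow k u) = wpow k (winv u)"
proof (induction k)
  case (Suc k)
  have "winv (wpow (Suc k) u) = winv (wpow k u) @ winv u" by simp
  then show ?case using Suc wpow_Suc_right by metis
qed simp

lemma geq_wpow: "x \<doteq> y \<Longrightarrow> wpow k x \<doteq> wpow k y"
  by (induction k) (auto intro: geq_append)

lemma geq_rep_conj: "wpow k (n @ x @ winv n) \<doteq> n @ wpow k x @ winv n"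
proof (induction k)
  case 0
  then show ?case using geq_winv_right geq_sym by simp
next
  case (Suc k)
  have "(n @ x @ winv n) @ wpow k (n @ x @ winv n) \<doteq> (n @ x @ winv n) @ (n @ wpow k x @ winv n)"
    using Suc by (rule geq_append[OF geq_refl])
  also have "\<dots> = (n @ x) @ (winv n @ n) @ (wpow k x @ winv n)" by simp
  also have "\<dots> \<doteq> (n @ x) @ [] @ (wpow k x @ winv n)"
    by (rule geq_append[OF geq_refl geq_append[OF geq_winv_left geq_refl]])
  finally show ?case by simp
qed

text \<open>Connectivity of the letters of the word in the dependence graph.\<close>

definition connectedw :: "'b list \<Rightarrow> bool" where
  "connectedw u \<longleftrightarrow> u \<noteq> [] \<and>
    (\<forall>X. X \<subseteq> set u \<longrightarrow> X \<noteq> {} \<longrightarrow> (\<forall>a\<in>X. \<forall>b\<in>set u. \<not> ind a b \<longrightarrow> b \<in> X) \<longrightarrow> X = set u)"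

definition extends :: "'b list \<Rightarrow> 'b list \<Rightarrow> bool" where
  "extends w p \<longleftrightarrow> (\<exists>s. w \<simeq> p @ s)"

text \<open>If the prefix \<open>r\<close> misses an \<open>a\<close> of the first \<open>j\<close> copies of \<open>u\<close>, then it contains no \<open>b\<close> of a
  later copy, as these come after the missing \<open>a\<close>. In terms of counts this is read off from the
  projection to the two letters.\<close>

lemma prefix_power_level:
  assumes "r @ s \<simeq> wpow y u" "\<not> ind a b" "count (mset r) a < j * count (mset u) a"
  shows "count (mset r) b \<le> j * count (mset u) b"
proof (cases "y \<le> j")
  case True
  have "count (mset r) b \<le> count (mset (r @ s)) b" by simp
  also have "\<dots> = y * count (mset u) b" using teq_mset[OF assms(1)] by simp
  also have "\<dots> \<le> j * count (mset u) b" using True by simp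
  finally show ?thesis .
next
  case False
  define f where "f = filter (\<lambda>c. c = a \<or> c = b)"
  have cf: "count (mset (f x)) a = count (mset x) a" "count (mset (f x)) b = count (mset x) b" for x
    by (auto simp: f_def)
  have "f r @ f s = wpow y (f u)"
    using teqD[OF assms(1,2)] by (simp add: f_def filter_wpow)
  also have "\<dots> = wpow j (f u) @ wpow (y - j) (f u)" using False by (intro wpow_le) simp
  finally obtain us where "f r = wpow j (f u) @ us \<or> wpow j (f u) = f r @ us"
    unfolding append_eq_append_conv2 by metis
  then consider "f r = wpow j (f u) @ us" | "wpow j (f u) = f r @ us" by blast
  then show ?thesis
  proof cases
    case 1
    then have "count (mset (f r)) a \<ge> j * count (mset (f u)) a" by simp
    then show ?thesis using assms(3) cf by simp
  next
    case 2
    then have "j * count (mset (f u)) b = count (mset (f r)) b + count (mset us) b"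
      by (metis count_wpow count_union mset_append)
    then show ?thesis using cf by simp
  qed
qed

text \<open>A prefix \<open>r\<close> of a power of \<open>u\<close> that does not begin with \<open>u\<close> misses a letter of the first copy.
  By \<open>prefix_power_level\<close> it misses in the first \<open>j + 1\<close> copies all dependence neighbours of
  letters missed in the first \<open>j\<close> copies. As \<open>u\<close> is connected, every letter is missed after as many
  steps as \<open>u\<close> has letters, so \<open>r\<close> is a prefix of a power of bounded exponent.\<close>

lemma remainder_bounded:
  assumes conn: "connectedw u" and c: "card (set u) \<le> c"
    and eq: "r @ s \<simeq> wpow y u" and rem: "\<not> extends r u"
  shows "extends (wpow c u) r"
proof (cases "y \<le> c")
  case True
  have "wpow c u = wpow y u @ wpow (c - y) u" using True by (rule wpow_le)
  moreover have "wpow y u @ wpow (c - y) u \<simeq> r @ s @ wpow (c - y) u"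
    using teq_append[OF teq_sym[OF eq] teq_refl[of "wpow (c - y) u"]] by simp
  ultimately show ?thesis unfolding extends_def by auto
next
  case False
  \<comment> \<open>letters of which an occurrence in the first \<open>j\<close> copies is missing\<close>
  define X where "X j = {b \<in> set u. count (mset r) b < j * count (mset u) b}" for j
  have pos: "count (mset u) b > 0" if "b \<in> set u" for b using that by simp
  have X1: "X 1 \<noteq> {}"
  proof
    assume e: "X 1 = {}"
    have "count (mset u) b \<le> count (mset r) b" for b
    proof (cases "b \<in> set u")
      case True
      then show ?thesis using e by (auto simp: X_def not_less)
    next
      case False
      then have "count (mset u) b = 0" by (simp add: count_eq_zero_iff)
      then show ?thesis by linarith
    qed
    then have "mset u \<subseteq># mset r" by (simp add: subseteq_mset_def)
    moreover have "u @ wpow (y - 1) u \<simeq> r @ s"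
      using teq_sym[OF eq] False wpow_le[of 1 y u] by simp
    ultimately show False using teq_prefix rem by (auto simp: extends_def)
  qed
  have mono: "X j \<subseteq> X (Suc j)" for j using pos by (fastforce simp: X_def)
  have nb: "b \<in> X (Suc j)" if "a \<in> X j" "b \<in> set u" "\<not> ind a b" for a b j
  proof -
    have "count (mset r) b \<le> j * count (mset u) b"
      using prefix_power_level[OF eq that(3)] that(1) by (simp add: X_def)
    then have "count (mset r) b < Suc j * count (mset u) b"
      using pos[OF that(2)] unfolding mult_Suc by linarith
    then show ?thesis using that(2) by (simp add: X_def)
  qed
  have fin: "finite (X j)" for j by (simp add: X_def)
  have ne: "X (Suc j) \<noteq> {}" for j
    by (induction j) (use X1 mono in \<open>auto simp: subset_empty\<close>)
  have grow: "X (Suc j) = set u \<or> Suc j \<le> card (X (Suc j))" for j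
  proof (induction j)
    case 0
    then show ?case using X1 fin[of 1] by (simp add: card_gt_0_iff Suc_le_eq)
  next
    case (Suc j)
    show ?case
    proof (cases "X (Suc (Suc j)) = set u")
      case False
      then have not_all: "X (Suc j) \<noteq> set u" using mono[of "Suc j"] unfolding X_def by auto
      have "X (Suc (Suc j)) \<noteq> X (Suc j)"
      proof
        assume same: "X (Suc (Suc j)) = X (Suc j)"
        have "X (Suc j) = set u"
          using conn[unfolded connectedw_def, THEN conjunct2, rule_format, of "X (Suc j)"] ne[of j] nb[of _ "Suc j"] same
          by (auto simp: X_def)
        then show False using not_all by simp
      qed
      then have "card (X (Suc j)) < card (X (Suc (Suc j)))"
        using mono[of "Suc j"] fin by (intro psubset_card_mono) auto
      then show ?thesis using Suc not_all by auto
    qed simp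
  qed
  have "c \<noteq> 0" using c conn by (auto simp: connectedw_def)
  then obtain c' where c': "c = Suc c'" by (cases c) auto
  have all: "X c = set u"
  proof -
    have "X c \<subseteq> set u" by (auto simp: X_def)
    then show ?thesis using grow[of c'] c c' card_seteq[of "set u" "X c"] by auto
  qed
  have "set r \<subseteq> set u" using teq_set[OF eq] by (auto simp: set_wpow split: if_splits)
  have "count (mset r) b \<le> count (mset (wpow c u)) b" for b
  proof (cases "b \<in> set u")
    case True
    then have "b \<in> X c" using all by simp
    then show ?thesis by (simp add: X_def)
  next
    case False
    then have "count (mset r) b = 0" using \<open>set r \<subseteq> set u\<close> by (auto simp: count_eq_zero_iff)
    then show ?thesis by linarith
  qed
  then have "mset r \<subseteq># mset (wpow c u)" by (simp add: subseteq_mset_def)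
  moreover have "r @ s \<simeq> wpow c u @ wpow (y - c) u" using eq False wpow_le[of c y u] by simp
  ultimately show ?thesis using teq_prefix by (auto simp: extends_def)
qed

lemma max_power:
  assumes "u \<noteq> []"
  shows "\<exists>d r. w \<simeq> wpow d u @ r \<and> \<not> extends r u"
proof (induction "length w" arbitrary: w rule: less_induct)
  case less
  show ?case
  proof (cases "extends w u")
    case False
    then show ?thesis by (intro exI[of _ 0] exI[of _ w]) simp
  next
    case True
    then obtain w' where w': "w \<simeq> u @ w'" by (auto simp: extends_def)
    then have "length w' < length w" using teq_length[OF w'] assms by simp
    then obtain d r where dr: "w' \<simeq> wpow d u @ r" "\<not> extends r u" using less by blast
    then have "w \<simeq> wpow (Suc d) u @ r" using w' teq_trans by auto
    then show ?thesis using dr(2) by blast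
  qed
qed

lemma extends_set: "extends (wpow c u) r \<Longrightarrow> set r \<subseteq> set u"
  using teq_set by (fastforce simp: extends_def set_wpow split: if_splits)

lemma extends_length: "extends w r \<Longrightarrow> length r \<le> length w"
  using teq_length by (fastforce simp: extends_def)

text \<open>Cutting a power of \<open>u\<close> into trace factors. Removing the largest power of \<open>u\<close> after each cut
  leaves a short remainder, so the factor between two cuts is \<open>winv r @ wpow d u @ r'\<close> in the group,
  with remainders \<open>r\<close> and \<open>r'\<close> at its two ends. Since consecutive factors share a remainder, the
  product telescopes for all exponents \<open>d'\<close> and not only for those of the given factorisation.\<close>

lemma cuts_of_power:
  assumes conn: "connectedw u" and c: "card (set u) \<le> c"
    and "distinct qs" "r0 @ concat (map M qs) \<simeq> wpow y u" "\<not> extends r0 u"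
  shows "\<exists>d r r'. (\<forall>q\<in>set qs. r q @ M q \<simeq> wpow (d q) u @ r' q \<and> extends (wpow c u) (r q) \<and> extends (wpow c u) (r' q)) \<and>
     sum d (set qs) = y \<and>
     (\<forall>d'. concat (map (\<lambda>q. winv (r q) @ wpow (d' q) u @ r' q) qs) \<doteq> winv r0 @ wpow (sum d' (set qs)) u)"
  using assms(3-5)
proof (induction qs arbitrary: r0 y)
  case Nil
  have y: "y = 0"
  proof (cases y)
    case (Suc k)
    then show ?thesis using Nil by (auto simp: extends_def)
  qed simp
  then have "r0 = []" using Nil by simp
  then show ?case using y by simp
next
  case (Cons q qs)
  have u: "u \<noteq> []" using conn by (simp add: connectedw_def)
  obtain d1 r1 where 1: "r0 @ M q \<simeq> wpow d1 u @ r1" "\<not> extends r1 u" using max_power[OF u] by blast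
  have eq: "wpow d1 u @ r1 @ concat (map M qs) \<simeq> wpow y u"
    using teq_trans[OF teq_append[OF teq_sym[OF 1(1)] teq_refl[of "concat (map M qs)"]]] Cons.prems(2) by simp
  then have "d1 * length u + (length r1 + length (concat (map M qs))) = y * length u"
    using teq_length[OF eq] by simp
  then have "d1 * length u \<le> y * length u" by linarith
  then have d1: "d1 \<le> y" using u by simp
  have r1: "r1 @ concat (map M qs) \<simeq> wpow (y - d1) u"
    using eq wpow_le[OF d1, of u] by simp
  obtain d r r' where IH: "\<forall>q\<in>set qs. r q @ M q \<simeq> wpow (d q) u @ r' q \<and> extends (wpow c u) (r q) \<and> extends (wpow c u) (r' q)"
     "sum d (set qs) = y - d1"
     "\<forall>d'. concat (map (\<lambda>q. winv (r q) @ wpow (d' q) u @ r' q) qs) \<doteq> winv r1 @ wpow (sum d' (set qs)) u"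
    using Cons.IH[OF _ r1 1(2)] Cons.prems(1) by auto
  have q: "q \<notin> set qs" using Cons.prems(1) by simp
  have p0: "extends (wpow c u) r0"
    using remainder_bounded[OF conn c Cons.prems(2,3)] .
  have p1: "extends (wpow c u) r1"
    using remainder_bounded[OF conn c r1 1(2)] .
  show ?case
  proof (rule exI[of _ "d(q := d1)"], rule exI[of _ "r(q := r0)"], rule exI[of _ "r'(q := r1)"],
      intro conjI allI)
    show "\<forall>qa\<in>set (q # qs). (r(q := r0)) qa @ M qa \<simeq> wpow ((d(q := d1)) qa) u @ (r'(q := r1)) qa \<and>
       extends (wpow c u) ((r(q := r0)) qa) \<and> extends (wpow c u) ((r'(q := r1)) qa)"
      using IH(1) 1(1) p0 p1 by auto
    have "sum (d(q := d1)) (set qs) = sum d (set qs)" using q by (intro sum.cong) auto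
    then show "sum (d(q := d1)) (set (q # qs)) = y" using q IH(2) d1 by simp
  next
    fix d'
    have m: "map (\<lambda>qa. winv ((r(q := r0)) qa) @ wpow (d' qa) u @ (r'(q := r1)) qa) qs
      = map (\<lambda>q. winv (r q) @ wpow (d' q) u @ r' q) qs"
      using q by auto
    have "concat (map (\<lambda>qa. winv ((r(q := r0)) qa) @ wpow (d' qa) u @ (r'(q := r1)) qa) (q # qs))
      = (winv r0 @ wpow (d' q) u @ r1) @ concat (map (\<lambda>q. winv (r q) @ wpow (d' q) u @ r' q) qs)"
      unfolding list.map m concat.simps by simp
    also have "\<dots> \<doteq> (winv r0 @ wpow (d' q) u @ r1) @ (winv r1 @ wpow (sum d' (set qs)) u)"
      by (rule geq_append[OF geq_refl IH(3)[rule_format]])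
    also have "\<dots> = (winv r0 @ wpow (d' q) u) @ (r1 @ winv r1) @ wpow (sum d' (set qs)) u" by simp
    also have "\<dots> \<doteq> (winv r0 @ wpow (d' q) u) @ [] @ wpow (sum d' (set qs)) u"
      by (rule geq_append[OF geq_refl geq_append[OF geq_winv_right geq_refl]])
    also have "\<dots> = winv r0 @ wpow (sum d' (set (q # qs))) u" using q by (simp add: wpow_add)
    finally show "concat (map (\<lambda>qa. winv ((r(q := r0)) qa) @ wpow (d' qa) u @ (r'(q := r1)) qa) (q # qs))
      \<doteq> winv r0 @ wpow (sum d' (set (q # qs))) u" .
  qed
qed

section \<open>Pumping a pair of matched powers\<close>

text \<open>Two letters are counted in \<open>n @ u\<^sup>d @ r = q @ w\<^sup>e @ t\<close>. The short words contribute at most \<open>2 * h\<close>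
  on each side, so for large \<open>d\<close> the counts in \<open>u\<close> and in \<open>w\<close> have to be proportional.\<close>

lemma parallel_counts:
  fixes ux uy wx wy d e h l nx ny qx qy rx ry tx ty :: nat
  assumes x: "nx + d * ux + rx = qx + e * wx + tx" and y: "ny + d * uy + ry = qy + e * wy + ty"
    and "nx + rx \<le> 2 * h" "ny + ry \<le> 2 * h" "qx + tx \<le> 2 * h" "qy + ty \<le> 2 * h"
    and "ux \<le> l" "uy \<le> l" "wx \<le> l" "wy \<le> l" "4 * h * l < d"
  shows "ux * wy \<le> uy * wx"
proof (rule ccontr)
  assume "\<not> ux * wy \<le> uy * wx"
  then have "d * (uy * wx + 1) \<le> d * (ux * wy)" by (intro mult_le_mono2) simp
  also have "\<dots> = (d * ux) * wy" by simp
  also have "\<dots> \<le> (e * wx + 2 * h) * wy" using x assms(5) by (intro mult_le_mono1) linarith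
  also have "\<dots> = (e * wy) * wx + 2 * h * wy" by (simp add: algebra_simps)
  also have "\<dots> \<le> (d * uy + 2 * h) * wx + 2 * h * l"
    using y assms(4,10) by (intro add_mono mult_le_mono1 mult_le_mono2) linarith+
  also have "\<dots> \<le> d * (uy * wx) + 2 * h * l + 2 * h * l"
    using mult_le_mono2[OF assms(9), of "2 * h"] by (simp add: algebra_simps)
  finally have "d \<le> 4 * h * l" by simp
  then show False using assms(11) by simp
qed

lemma size_eq_sum_count: "set u \<subseteq> Y \<Longrightarrow> finite Y \<Longrightarrow> length u = (\<Sum>y\<in>Y. count (mset u) y)"
  unfolding size_mset[symmetric] size_multiset_overloaded_eq
  by (rule sum.mono_neutral_left) (auto simp: count_eq_zero_iff)

text \<open>A weak form of the theorem of Fine and Wilf for traces. When the common trace is long, the letter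
  counts of \<open>u\<close> and \<open>w\<close> are proportional, hence \<open>u\<close> taken \<open>length w\<close> times has the same counts as
  \<open>w\<close> taken \<open>length u\<close> times. Prefixes are determined by their counts, so advancing by
  these two powers leads from equal prefixes to equal prefixes, and the two conjugates agree in the
  group.\<close>

lemma parallel_powers:
  assumes eq: "n @ wpow d u @ r \<simeq> q @ wpow e w @ t"
    and ne: "u \<noteq> []" "w \<noteq> []"
    and sets: "set n \<subseteq> set u" "set r \<subseteq> set u" "set q \<subseteq> set w" "set t \<subseteq> set w"
    and len: "length n \<le> h" "length r \<le> h" "length q \<le> h" "length t \<le> h"
    and l: "length u \<le> l" "length w \<le> l"
    and large: "4 * h * l + h + l < d" "4 * h * l + h + l < e"
  shows "n @ wpow (length w) u @ winv n \<doteq> q @ wpow (length u) w @ winv q"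
proof -
  define cu where "cu x = count (mset u) x" for x
  define cw where "cw x = count (mset w) x" for x
  have clen: "count (mset z) x \<le> length z" for z :: "'b list" and x
    by (metis count_le_size size_mset)
  have counts: "count (mset n) x + d * cu x + count (mset r) x = count (mset q) x + e * cw x + count (mset t) x" for x
    using arg_cong[OF teq_mset[OF eq], of "\<lambda>M. count M x"] by (simp add: cu_def cw_def)
  have bnd: "count (mset n) x \<le> h" "count (mset r) x \<le> h" "count (mset q) x \<le> h" "count (mset t) x \<le> h"
     "cu x \<le> l" "cw x \<le> l" for x
    using clen[of n x] clen[of r x] clen[of q x] clen[of t x] clen[of u x] clen[of w x] len l
    unfolding cu_def cw_def by linarith+
  have par0: "cu x * cw y \<le> cu y * cw x" for x y
    by (rule parallel_counts[OF counts[of x] counts[of y], of h l])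
      (use bnd[of x] bnd[of y] large in linarith)+
  have par: "cu x * cw y = cu y * cw x" for x y using par0[of x y] par0[of y x] by simp
  define Y where "Y = set u \<union> set w"
  have lu: "length u = sum cu Y" and lw: "length w = sum cw Y"
    unfolding cu_def cw_def using size_eq_sum_count[of u Y] size_eq_sum_count[of w Y] by (auto simp: Y_def)
  have propor: "length w * cu x = length u * cw x" for x
    unfolding lu lw sum_distrib_right using par by (intro sum.cong) (simp_all add: mult.commute)
  have supp: "cu x = 0 \<longleftrightarrow> cw x = 0" for x
    using propor[of x] ne by (metis length_0_conv mult_eq_0_iff)
  have zero: "count (mset n) x = 0 \<and> count (mset r) x = 0 \<and> count (mset q) x = 0 \<and> count (mset t) x = 0"
    if "cu x = 0" for x
  proof -
    have "x \<notin> set u" "x \<notin> set w" using that supp[of x] by (auto simp: cu_def cw_def)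
    then show ?thesis using sets by (auto simp: count_eq_zero_iff)
  qed
  define a where "a = length w"
  define b where "b = length u"
  \<comment> \<open>\<open>u\<^sup>j\<close> is long enough to cover \<open>q\<close>, and \<open>w\<^sup>k\<close> to cover \<open>n @ u\<^sup>j\<close>, with room for one more period\<close>
  define j where "j = h"
  define k where "k = h + h * l"
  have hl: "h * l \<le> 4 * h * l" by simp
  have jd: "j + a \<le> d" and ke: "k + b \<le> e" using large l hl unfolding j_def k_def a_def b_def by linarith+
  have m1: "mset q \<subseteq># mset (n @ wpow j u)"
  proof (rule mset_subset_eqI)
    fix x show "count (mset q) x \<le> count (mset (n @ wpow j u)) x"
    proof (cases "cu x = 0")
      case True then show ?thesis using zero[of x] by linarith
    next
      case False
      then have "j \<le> j * cu x" by simp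
      then have "count (mset q) x \<le> count (mset n) x + j * cu x"
        using bnd(3)[of x] unfolding j_def by linarith
      then show ?thesis by (simp add: cu_def)
    qed
  qed
  have m2: "mset (n @ wpow j u) \<subseteq># mset (q @ wpow k w)"
  proof (rule mset_subset_eqI)
    fix x show "count (mset (n @ wpow j u)) x \<le> count (mset (q @ wpow k w)) x"
    proof (cases "cu x = 0")
      case True
      then have "count (mset (n @ wpow j u)) x = 0" using zero[of x] by (simp add: cu_def)
      then show ?thesis by linarith
    next
      case False
      then have "cw x \<noteq> 0" using supp by simp
      then have "k \<le> k * cw x" by simp
      moreover have "j * cu x \<le> h * l" using bnd(5) unfolding j_def by (intro mult_le_mono2)
      ultimately have "count (mset n) x + j * cu x \<le> k * cw x" using bnd(1)[of x] unfolding k_def by linarith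
      then show ?thesis by (simp add: cu_def cw_def)
    qed
  qed
  have e1: "(n @ wpow j u) @ (wpow (d - j) u @ r) = n @ wpow d u @ r" "(n @ wpow (j + a) u) @ (wpow (d - (j + a)) u @ r) = n @ wpow d u @ r"
    using wpow_le[of j d u] wpow_le[of "j + a" d u] jd by simp_all
  have e2: "(q @ wpow k w) @ (wpow (e - k) w @ t) = q @ wpow e w @ t" "(q @ wpow (k + b) w) @ (wpow (e - (k + b)) w @ t) = q @ wpow e w @ t"
    using wpow_le[of k e w] wpow_le[of "k + b" e w] ke by simp_all
  have "q @ (wpow e w @ t) \<simeq> (n @ wpow j u) @ (wpow (d - j) u @ r)"
    unfolding e1 using eq by (rule teq_sym)
  from teq_prefix[OF this m1] obtain \<sigma> where s: "n @ wpow j u \<simeq> q @ \<sigma>" by blast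
  have "(n @ wpow j u) @ (wpow (d - j) u @ r) \<simeq> (q @ wpow k w) @ (wpow (e - k) w @ t)"
    unfolding e1 e2 using eq .
  from teq_prefix[OF this m2] obtain \<theta> where th: "q @ wpow k w \<simeq> (n @ wpow j u) @ \<theta>" by blast
  have "q @ wpow k w \<simeq> q @ \<sigma> @ \<theta>"
    using teq_trans[OF th teq_append[OF s teq_refl[of \<theta>]]] by simp
  then have st: "wpow k w \<simeq> \<sigma> @ \<theta>" by simp
  have "q @ wpow b w @ \<sigma> @ \<theta> \<simeq> q @ wpow (k + b) w"
    using st wpow_add[of b k w] by (simp add: add.commute teq_sym)
  then have A: "(q @ wpow b w @ \<sigma>) @ (\<theta> @ wpow (e - (k + b)) w @ t) \<simeq> (q @ wpow (k + b) w) @ (wpow (e - (k + b)) w @ t)"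
    using teq_append[OF _ teq_refl] by fastforce
  have B: "(q @ wpow b w @ \<sigma>) @ (\<theta> @ wpow (e - (k + b)) w @ t) \<simeq> (n @ wpow (j + a) u) @ (wpow (d - (j + a)) u @ r)"
    using teq_trans[OF A[unfolded e2] teq_sym[OF eq]] unfolding e1 .
  have "mset (q @ wpow b w @ \<sigma>) = mset (n @ wpow (j + a) u)"
  proof (rule multiset_eqI)
    fix x
    have "count (mset n) x + j * cu x = count (mset q) x + count (mset \<sigma>) x"
      using arg_cong[OF teq_mset[OF s], of "\<lambda>M. count M x"] by (simp add: cu_def)
    then show "count (mset (q @ wpow b w @ \<sigma>)) x = count (mset (n @ wpow (j + a) u)) x"
      using propor[of x] by (simp add: a_def b_def cu_def[symmetric] cw_def[symmetric] algebra_simps)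
  qed
  then have pe: "q @ wpow b w @ \<sigma> \<simeq> n @ wpow (j + a) u" by (rule teq_prefix_eq[OF B])
  have "(n @ wpow a u @ winv n) @ (n @ wpow j u) = (n @ wpow a u) @ (winv n @ n) @ wpow j u" by simp
  also have "\<dots> \<doteq> (n @ wpow a u) @ [] @ wpow j u"
    by (rule geq_append[OF geq_refl geq_append[OF geq_winv_left geq_refl]])
  also have "\<dots> = n @ wpow (j + a) u" by (simp add: add.commute wpow_add)
  also have "\<dots> \<doteq> q @ wpow b w @ \<sigma>" using pe teq_geq teq_sym by blast
  also have "\<dots> = (q @ wpow b w) @ [] @ \<sigma>" by simp
  also have "\<dots> \<doteq> (q @ wpow b w) @ (winv q @ q) @ \<sigma>"
    by (rule geq_append[OF geq_refl geq_append[OF geq_sym[OF geq_winv_left] geq_refl]])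
  also have "\<dots> = (q @ wpow b w @ winv q) @ (q @ \<sigma>)" by simp
  also have "\<dots> \<doteq> (q @ wpow b w @ winv q) @ (n @ wpow j u)"
    by (rule geq_append[OF geq_refl teq_geq[OF teq_sym[OF s]]])
  finally show ?thesis unfolding geq_cancel_right a_def b_def .
qed

lemma extends_left_complement:
  assumes "r @ m \<simeq> wpow d u @ r1" "r @ n \<simeq> wpow c u" "c \<le> d"
  shows "m \<simeq> n @ wpow (d - c) u @ r1"
proof -
  have "r @ m \<simeq> wpow c u @ wpow (d - c) u @ r1" using assms(1) wpow_le[OF assms(3), of u] by simp
  also have "\<dots> \<simeq> (r @ n) @ wpow (d - c) u @ r1" by (rule teq_append[OF teq_sym[OF assms(2)] teq_refl])
  finally show ?thesis by simp
qed

lemma complement_geq: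
  assumes "r @ n \<simeq> wpow c u" "c \<le> d"
  shows "winv r @ wpow d u @ r1 \<doteq> n @ wpow (d - c) u @ r1"
proof -
  have "winv r @ wpow d u @ r1 = winv r @ wpow c u @ (wpow (d - c) u @ r1)"
    using wpow_le[OF assms(2), of u] by simp
  also have "\<dots> \<doteq> winv r @ (r @ n) @ (wpow (d - c) u @ r1)"
    by (rule geq_append[OF geq_refl geq_append[OF teq_geq[OF teq_sym[OF assms(1)]] geq_refl]])
  also have "\<dots> = (winv r @ r) @ (n @ wpow (d - c) u @ r1)" by simp
  also have "\<dots> \<doteq> [] @ (n @ wpow (d - c) u @ r1)" by (rule geq_append[OF geq_winv_left geq_refl])
  finally show ?thesis by simp
qed

lemma conj_power_shift:
  assumes "k0 = k1 + z * a"
  shows "n @ wpow k0 u @ r \<doteq> wpow z (n @ wpow a u @ winv n) @ (n @ wpow k1 u @ r)"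
proof -
  have "n @ wpow k0 u @ r = (n @ wpow z (wpow a u)) @ [] @ (wpow k1 u @ r)"
    using assms by (simp add: wpow_mult wpow_add[symmetric] add.commute)
  also have "\<dots> \<doteq> (n @ wpow z (wpow a u)) @ (winv n @ n) @ (wpow k1 u @ r)"
    by (rule geq_append[OF geq_refl geq_append[OF geq_sym[OF geq_winv_left] geq_refl]])
  also have "\<dots> = (n @ wpow z (wpow a u) @ winv n) @ (n @ wpow k1 u @ r)" by simp
  also have "\<dots> \<doteq> wpow z (n @ wpow a u @ winv n) @ (n @ wpow k1 u @ r)"
    by (rule geq_append[OF geq_sym[OF geq_rep_conj] geq_refl])
  finally show ?thesis .
qed

text \<open>The common multiple is subtracted as often as both numbers stay above \<open>D\<close>; then one of them is
  close to \<open>D\<close>.\<close>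

lemma reduce_pair:
  fixes a b d e D :: nat
  assumes "0 < a" "0 < b" "D \<le> d" "D \<le> e"
  shows "\<exists>z d0 e0. d = d0 + z * a \<and> e = e0 + z * b \<and> D \<le> d0 \<and> D \<le> e0 \<and> (d0 < D + a \<or> e0 < D + b)"
proof -
  define z where "z = min ((d - D) div a) ((e - D) div b)"
  have za: "z * a \<le> d - D" and zb: "z * b \<le> e - D"
    by (metis div_times_less_eq_dividend dual_order.trans min.cobounded1 mult_le_mono1 z_def)
       (metis div_times_less_eq_dividend dual_order.trans min.cobounded2 mult_le_mono1 z_def)
  have "d - D < z * a + a \<or> e - D < z * b + b"
  proof (cases "z = (d - D) div a")
    case True
    then show ?thesis using dividend_less_div_times[OF assms(1), of "d - D"] by simp
  next
    case False
    then have "z = (e - D) div b" unfolding z_def by linarith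
    then show ?thesis using dividend_less_div_times[OF assms(2), of "e - D"] by simp
  qed
  then show ?thesis using za zb assms
    by (intro exI[of _ z] exI[of _ "d - z * a"] exI[of _ "e - z * b"]) linarith
qed

end

text \<open>Bounds the exponents that remain after all possible periods have been removed from a pair of factors
  (\<open>pump_pair\<close>), where \<open>c\<close> bounds the number of letters and \<open>l\<close> the length of the bases.\<close>

definition pump_const :: "nat \<Rightarrow> nat \<Rightarrow> nat" where
  "pump_const c l = (4 * (c * l) * l + c * l + l + c + 1 + l) * l + 2 * (c * l)"

context trace_alphabet
begin

text \<open>The factor \<open>m\<close> of a power of \<open>u\<close> is matched with the factor \<open>m'\<close> of a power of \<open>v\<close>. If one of
  the exponents is small, so is the other, since the two factors have the same length. Otherwise
  \<open>parallel_powers\<close> allows to insert or delete \<open>length v\<close> periods of \<open>u\<close> together with \<open>length u\<close>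
  periods of \<open>v\<close>, and the factors stay inverse to each other. The letters of the new factor are letters
  of \<open>m\<close>, so that it commutes with all words that are independent of \<open>m\<close>. The clauses for exponents
  at most 1 ensure that a block that stands for a constant is never pumped.\<close>

lemma pump_pair:
  assumes ne: "u \<noteq> []" "v \<noteq> []" and l: "length u \<le> l" "length v \<le> l"
    and eu: "r @ m \<simeq> wpow d u @ r1" and eqv: "s @ m' \<simeq> wpow e v @ s1" and inv: "m' \<simeq> winv m"
    and ext: "extends (wpow c u) r" "extends (wpow c u) r1" "extends (wpow c v) s" "extends (wpow c v) s1"
  shows "\<exists>d0 e0 a b z. d = d0 + z * a \<and> e = e0 + z * b \<and> a \<le> l \<and> b \<le> l \<and>
    (d \<le> 1 \<longrightarrow> a = 0) \<and> (e \<le> 1 \<longrightarrow> b = 0) \<and> d0 \<le> pump_const c l \<and> e0 \<le> pump_const c l \<and>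
    (\<forall>z'. \<exists>k. set k \<subseteq> set m \<and> winv r @ wpow (d0 + z' * a) u @ r1 \<doteq> k \<and> winv s @ wpow (e0 + z' * b) v @ s1 \<doteq> winv k)"
proof -
  define h where "h = c * l"
  define D where "D = 4 * h * l + h + l + c + 1"
  have const: "pump_const c l = (D + l) * l + 2 * h" by (simp add: pump_const_def D_def h_def)
  have h: "length x \<le> h" if "extends (wpow c y) x" "length y \<le> l" for x y
    using extends_length[OF that(1)] mult_le_mono2[OF that(2), of c] unfolding h_def length_wpow by linarith
  have lens: "length r \<le> h" "length r1 \<le> h" "length s \<le> h" "length s1 \<le> h"
    using h ext l by blast+
  have lm: "length m' = length m" using teq_length[OF inv] by simp
  have Lu: "length r + length m = d * length u + length r1" using teq_length[OF eu] by simp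
  have Lv: "length s + length m = e * length v + length s1" using teq_length[OF eqv] lm by simp
  have l1: "1 \<le> length u" "1 \<le> length v" using ne by (auto simp: Suc_le_eq)
  then have l1: "1 \<le> length u" "1 \<le> length v" "1 \<le> l" using l by linarith+
  show ?thesis
  proof (cases "D < d \<and> D < e")
    case False
    have k: "winv r @ wpow d u @ r1 \<doteq> m"
    proof -
      have "winv r @ wpow d u @ r1 \<doteq> winv r @ r @ m"
        by (rule geq_append[OF geq_refl teq_geq[OF teq_sym[OF eu]]])
      also have "\<dots> \<doteq> m" using geq_append[OF geq_winv_left[of r] geq_refl[of m]] by simp
      finally show ?thesis .
    qed
    have k': "winv s @ wpow e v @ s1 \<doteq> winv m"
    proof -
      have "winv s @ wpow e v @ s1 \<doteq> winv s @ s @ m'"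
        by (rule geq_append[OF geq_refl teq_geq[OF teq_sym[OF eqv]]])
      also have "\<dots> \<doteq> m'" using geq_append[OF geq_winv_left[of s] geq_refl[of m']] by simp
      also have "m' \<doteq> winv m" using inv by (rule teq_geq)
      finally show ?thesis .
    qed
    have du: "d \<le> d * length u" "e \<le> e * length v" using l1 by simp_all
    have dl: "d * length u \<le> d * l" "e * length v \<le> e * l" using l by simp_all
    have "d \<le> (D + l) * l + 2 * h \<and> e \<le> (D + l) * l + 2 * h"
    proof (cases "d \<le> D")
      case True
      have "d * l \<le> (D + l) * l" "d \<le> d * l" using True l1 by simp_all
      then show ?thesis using Lu Lv du dl lens by linarith
    next
      case F: False
      then have "e \<le> D" using False by simp
      then have "e * l \<le> (D + l) * l" "e \<le> e * l" using l1 by simp_all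
      then show ?thesis using Lu Lv du dl lens by linarith
    qed
    then show ?thesis unfolding const using k k'
      by (intro exI[of _ d] exI[of _ e] exI[of _ 0] exI[of _ 0] exI[of _ 0]) auto
  next
    case True
    define w where "w = winv v"
    obtain n where n: "wpow c u \<simeq> r @ n" using ext(1) by (auto simp: extends_def)
    obtain n' where n': "wpow c v \<simeq> s @ n'" using ext(3) by (auto simp: extends_def)
    have cD: "c \<le> D" by (simp add: D_def)
    have m: "m \<simeq> n @ wpow (d - c) u @ r1" using extends_left_complement[OF eu teq_sym[OF n]] True cD by simp
    have m': "m' \<simeq> n' @ wpow (e - c) v @ s1" using extends_left_complement[OF eqv teq_sym[OF n']] True cD by simp
    define q where "q = winv s1"
    define t where "t = winv n'"
    have m2: "m \<simeq> q @ wpow (e - c) w @ t"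
    proof -
      have "m \<simeq> winv m'" using teq_winv[OF inv] teq_sym by simp
      also have "\<dots> \<simeq> winv (n' @ wpow (e - c) v @ s1)" using m' by (rule teq_winv)
      finally show ?thesis by (simp add: q_def t_def w_def winv_wpow)
    qed
    have sn: "set n \<subseteq> set u" "set n' \<subseteq> set v" using teq_set[OF n] teq_set[OF n'] by (auto simp: set_wpow split: if_splits)
    have sr: "set r1 \<subseteq> set u" "set s1 \<subseteq> set v" using extends_set ext by blast+
    have ln: "length n \<le> h" "length n' \<le> h"
      using teq_length[OF n] teq_length[OF n'] mult_le_mono2[OF l(1), of c] mult_le_mono2[OF l(2), of c] unfolding h_def by simp_all
    define a where "a = length v"
    define b where "b = length u"
    have H: "n @ wpow a u @ winv n \<doteq> q @ wpow b w @ winv q"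
    proof -
      have "n @ wpow (length w) u @ winv n \<doteq> q @ wpow (length u) w @ winv q"
      proof (rule parallel_powers[where h=h and l=l])
        show "n @ wpow (d - c) u @ r1 \<simeq> q @ wpow (e - c) w @ t" using m m2 teq_sym teq_trans by blast
        show "4 * h * l + h + l < d - c" "4 * h * l + h + l < e - c" using True unfolding D_def by linarith+
      qed (use ne sn sr ln lens l in \<open>auto simp: w_def q_def t_def\<close>, (auto simp: winv_def)?)
      then show ?thesis by (simp add: a_def b_def w_def)
    qed
    have "0 < a" "0 < b" using ne by (auto simp: a_def b_def)
    then obtain z d0 e0 where z: "d = d0 + z * a" "e = e0 + z * b" "D \<le> d0" "D \<le> e0" "d0 < D + a \<or> e0 < D + b"
      using reduce_pair[of a b D d e] True by auto
    have L0: "d0 * length u + length r1 + length s = e0 * length v + length s1 + length r"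
      using Lu Lv unfolding z(1,2) a_def b_def by (simp add: algebra_simps)
    have du: "d0 \<le> d0 * length u" "e0 \<le> e0 * length v" using l1 by simp_all
    have dl: "d0 * length u \<le> d0 * l" "e0 * length v \<le> e0 * l" using l by simp_all
    have bound: "d0 \<le> (D + l) * l + 2 * h \<and> e0 \<le> (D + l) * l + 2 * h"
    proof (cases "d0 < D + a")
      case True
      then have "d0 \<le> D + l" using l unfolding a_def by linarith
      then have "d0 * l \<le> (D + l) * l" "d0 \<le> d0 * l" using l1 by simp_all
      then show ?thesis using L0 du dl lens by linarith
    next
      case False
      then have "e0 \<le> D + l" using z(5) l unfolding b_def by linarith
      then have "e0 * l \<le> (D + l) * l" "e0 \<le> e0 * l" using l1 by simp_all
      then show ?thesis using L0 du dl lens by linarith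
    qed
    define k where "k z' = n @ wpow (d0 - c + z' * a) u @ r1" for z'
    define k' where "k' z' = q @ wpow (e0 - c + z' * b) w @ t" for z'
    have kz: "k z \<doteq> k' z"
    proof -
      have "d - c = d0 - c + z * a" "e - c = e0 - c + z * b" using z cD by linarith+
      then have "m \<simeq> k z" "m \<simeq> k' z" using m m2 unfolding k_def k'_def by simp_all
      then show ?thesis using teq_geq teq_sym teq_trans by blast
    qed
    have shift: "k z' \<doteq> wpow z' (n @ wpow a u @ winv n) @ k 0" for z'
      unfolding k_def by (rule conj_power_shift) simp
    have shift': "k' z' \<doteq> wpow z' (n @ wpow a u @ winv n) @ k' 0" for z'
    proof -
      have "k' z' \<doteq> wpow z' (q @ wpow b w @ winv q) @ k' 0"
        unfolding k'_def by (rule conj_power_shift) simp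
      also have "\<dots> \<doteq> wpow z' (n @ wpow a u @ winv n) @ k' 0"
        by (rule geq_append[OF geq_wpow[OF geq_sym[OF H]] geq_refl])
      finally show ?thesis .
    qed
    have "wpow z (n @ wpow a u @ winv n) @ k 0 \<doteq> wpow z (n @ wpow a u @ winv n) @ k' 0"
      using shift[of z] shift'[of z] kz by (meson geq_sym geq_trans)
    then have k0: "k 0 \<doteq> k' 0" by simp
    have kk: "k z' \<doteq> k' z'" for z'
    proof -
      have "k z' \<doteq> wpow z' (n @ wpow a u @ winv n) @ k 0" by (rule shift)
      also have "\<dots> \<doteq> wpow z' (n @ wpow a u @ winv n) @ k' 0" using k0 by simp
      also have "\<dots> \<doteq> k' z'" by (rule geq_sym[OF shift'])
      finally show ?thesis .
    qed
    have sm: "set (k z') \<subseteq> set m" for z'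
    proof -
      have "d - c \<noteq> 0" using True cD by simp
      then have "set m = set n \<union> set u \<union> set r1" using teq_set[OF m] by (auto simp: set_wpow)
      then show ?thesis unfolding k_def by (auto simp: set_wpow split: if_splits)
    qed
    have g1: "winv r @ wpow (d0 + z' * a) u @ r1 \<doteq> k z'" for z'
    proof -
      have "d0 + z' * a - c = d0 - c + z' * a" using z cD by linarith
      then show ?thesis using complement_geq[OF teq_sym[OF n], of "d0 + z' * a" r1] z cD unfolding k_def by simp
    qed
    have g2: "winv s @ wpow (e0 + z' * b) v @ s1 \<doteq> winv (k z')" for z'
    proof -
      have "e0 + z' * b - c = e0 - c + z' * b" using z cD by linarith
      then have "winv s @ wpow (e0 + z' * b) v @ s1 \<doteq> winv (k' z')"
        using complement_geq[OF teq_sym[OF n'], of "e0 + z' * b" s1] z cD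
        unfolding k'_def q_def t_def w_def by (simp add: winv_wpow)
      also have "\<dots> \<doteq> winv (k z')" by (rule geq_winv[OF geq_sym[OF kk]])
      finally show ?thesis .
    qed
    have d1: "1 < d" "1 < e" using True by (auto simp: D_def)
    show ?thesis unfolding const
    proof (intro exI conjI allI)
      show "d = d0 + z * a" "e = e0 + z * b" using z by auto
      show "a \<le> l" "b \<le> l" using l by (auto simp: a_def b_def)
      show "d \<le> 1 \<longrightarrow> a = 0" "e \<le> 1 \<longrightarrow> b = 0" using d1 by auto
      show "d0 \<le> (D + l) * l + 2 * h" "e0 \<le> (D + l) * l + 2 * h" using bound by auto
    next
      fix z'
      show "set (k z') \<subseteq> set m" "winv r @ wpow (d0 + z' * a) u @ r1 \<doteq> k z'"
        "winv s @ wpow (e0 + z' * b) v @ s1 \<doteq> winv (k z')"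
        using sm g1 g2 by auto
    qed
  qed
qed

section \<open>Pumping a trivial product of powers\<close>

lemma geq_concat_map:
  "(\<And>x. x \<in> set xs \<Longrightarrow> f x \<doteq> g x) \<Longrightarrow> concat (map f xs) \<doteq> concat (map g xs)"
  by (induction xs) (auto intro: geq_append)

lemma indw_geq_commute:
  assumes "indw x y" "set x' \<subseteq> set x" "set y' \<subseteq> set y" "p \<doteq> x'" "q \<doteq> y'"
  shows "p @ q \<doteq> q @ p"
proof -
  have "indw x' y'" using assms(1-3) unfolding indw_def by blast
  then have c: "x' @ y' \<doteq> y' @ x'" by (intro teq_geq teq_commute)
  have "p @ q \<doteq> x' @ y'" using assms by (intro geq_append)
  also note c
  also have "y' @ x' \<doteq> q @ p" using assms by (intro geq_append geq_sym[OF assms(5)] geq_sym[OF assms(4)])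
  finally show ?thesis .
qed

text \<open>All pairs of matched factors can be pumped simultaneously, because the conditions in
  \<open>matching_trivial_product\<close> concern each pair separately, apart from independence of letters, which
  pumping preserves. The exponent of a block is the sum over its factors, so every tuple of exponents
  lies on a family of tuples that is parametrised linearly by one multiplicity \<open>z\<close> for each
  unordered pair of blocks, here indexed by its minimum and maximum.\<close>

theorem pumpable_product:
  fixes U :: "nat \<Rightarrow> 'b list" and y :: "nat \<Rightarrow> nat" and c l :: nat
  assumes conn: "\<And>P. P < m \<Longrightarrow> connectedw (U P)" and card: "\<And>P. P < m \<Longrightarrow> card (set (U P)) \<le> c"
    and len: "\<And>P. P < m \<Longrightarrow> length (U P) \<le> l" and redU: "\<And>P k. P < m \<Longrightarrow> reduced (wpow k (U P))"
    and triv: "concat (map (\<lambda>P. wpow (y P) (U P)) [0..<m]) \<doteq> []"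
  obtains b :: "nat \<Rightarrow> nat" and f :: "nat \<Rightarrow> nat \<Rightarrow> nat" and z :: "nat \<Rightarrow> nat \<Rightarrow> nat" where
    "\<And>P. P < m \<Longrightarrow> y P = b P + (\<Sum>Q\<in>{..<m} - {P}. z (min P Q) (max P Q) * f P Q)"
    "\<And>P. P < m \<Longrightarrow> b P \<le> m * pump_const c l"
    "\<And>P Q. P < m \<Longrightarrow> Q < m \<Longrightarrow> P \<noteq> Q \<Longrightarrow> f P Q \<le> l"
    "\<And>P Q. P < m \<Longrightarrow> Q < m \<Longrightarrow> P \<noteq> Q \<Longrightarrow> y P \<le> 1 \<Longrightarrow> f P Q = 0"
    "\<And>z'. concat (map (\<lambda>P. wpow (b P + (\<Sum>Q\<in>{..<m} - {P}. z' (min P Q) (max P Q) * f P Q)) (U P)) [0..<m]) \<doteq> []"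
proof -
  have ne: "U P \<noteq> []" if "P < m" for P using conn[OF that] by (simp add: connectedw_def)
  obtain M where M: "\<And>P. P < m \<Longrightarrow> wpow (y P) (U P) \<simeq> concat (map (M P) (around m P))"
    "\<And>P Q. P < m \<Longrightarrow> Q < m \<Longrightarrow> P \<noteq> Q \<Longrightarrow> M Q P \<simeq> winv (M P Q)"
    "\<And>P R Q S. P < R \<Longrightarrow> R < Q \<Longrightarrow> Q < S \<Longrightarrow> S < m \<Longrightarrow> indw (M P Q) (M R S)"
    using trivial_product_matching[OF triv] redU by metis
  have set_a: "set (around m P) = {..<m} - {P}" if "P < m" for P using set_around that .
  have dist: "distinct (around m P)" for P by (auto simp: around_def)
  let ?cut = "\<lambda>P d r r'. (\<forall>q\<in>set (around m P). r q @ M P q \<simeq> wpow (d q) (U P) @ r' q \<and>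
        extends (wpow c (U P)) (r q) \<and> extends (wpow c (U P)) (r' q)) \<and>
     sum d (set (around m P)) = y P \<and>
     (\<forall>d'. concat (map (\<lambda>q. winv (r q) @ wpow (d' q) (U P) @ r' q) (around m P))
        \<doteq> winv [] @ wpow (sum d' (set (around m P))) (U P))"
  have "\<forall>P. \<exists>d r r'. P < m \<longrightarrow> ?cut P d r r'"
  proof
    fix P
    show "\<exists>d r r'. P < m \<longrightarrow> ?cut P d r r'"
    proof (cases "P < m")
      case True
      have 1: "[] @ concat (map (M P) (around m P)) \<simeq> wpow (y P) (U P)" using M(1)[OF True] teq_sym by simp
      have 2: "\<not> extends [] (U P)" using ne[OF True] by (auto simp: extends_def)
      show ?thesis using cuts_of_power[OF conn[OF True] card[OF True] dist 1 2] by blast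
    qed simp
  qed
  then obtain d r r' where R: "\<forall>P. P < m \<longrightarrow> ?cut P (d P) (r P) (r' P)"
    unfolding choice_iff by blast
  have cut: "r P q @ M P q \<simeq> wpow (d P q) (U P) @ r' P q \<and> extends (wpow c (U P)) (r P q) \<and> extends (wpow c (U P)) (r' P q)"
    if "P < m" "q \<in> {..<m} - {P}" for P q
    using R that set_a by blast
  have dsum: "sum (d P) ({..<m} - {P}) = y P" if "P < m" for P
    using R that set_a by force
  have cat: "concat (map (\<lambda>q. winv (r P q) @ wpow (d' q) (U P) @ r' P q) (around m P)) \<doteq> wpow (sum d' ({..<m} - {P})) (U P)"
    if "P < m" for P d'
    using R[rule_format, OF that, THEN conjunct2, THEN conjunct2, rule_format, of d'] set_a[OF that] by simp
  let ?pump = "\<lambda>P Q d0 e0 a b z K. d P Q = d0 + z * a \<and> d Q P = e0 + z * b \<and> a \<le> l \<and> b \<le> l \<and>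
    (d P Q \<le> 1 \<longrightarrow> a = 0) \<and> (d Q P \<le> 1 \<longrightarrow> b = 0) \<and> d0 \<le> pump_const c l \<and> e0 \<le> pump_const c l \<and>
    (\<forall>z'. set (K z') \<subseteq> set (M P Q) \<and> winv (r P Q) @ wpow (d0 + z' * a) (U P) @ r' P Q \<doteq> K z' \<and>
        winv (r Q P) @ wpow (e0 + z' * b) (U Q) @ r' Q P \<doteq> winv (K z'))"
  have "\<forall>P. \<forall>Q. \<exists>d0 e0 a b z K. P < Q \<and> Q < m \<longrightarrow> ?pump P Q d0 e0 a b z K"
  proof (intro allI)
    fix P Q
    show "\<exists>d0 e0 a b z K. P < Q \<and> Q < m \<longrightarrow> ?pump P Q d0 e0 a b z K"
    proof (cases "P < Q \<and> Q < m")
      case True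
      then have PQ: "P < m" "Q < m" "Q \<in> {..<m} - {P}" "P \<in> {..<m} - {Q}" "P \<noteq> Q" by auto
      note c1 = cut[OF PQ(1,3)] and c2 = cut[OF PQ(2,4)]
      show ?thesis
        using pump_pair[OF ne[OF PQ(1)] ne[OF PQ(2)] len[OF PQ(1)] len[OF PQ(2)] c1[THEN conjunct1] c2[THEN conjunct1]
           M(2)[OF PQ(1,2,5)] c1[THEN conjunct2, THEN conjunct1] c1[THEN conjunct2, THEN conjunct2]
           c2[THEN conjunct2, THEN conjunct1] c2[THEN conjunct2, THEN conjunct2]]
        unfolding choice_iff by metis
    qed blast
  qed
  then obtain d0 e0 a b z K where R2: "\<forall>P Q. P < Q \<and> Q < m \<longrightarrow>
      ?pump P Q (d0 P Q) (e0 P Q) (a P Q) (b P Q) (z P Q) (K P Q)"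
    unfolding choice_iff by (elim exE)
  note R2 = R2[THEN spec, THEN spec, THEN mp, OF conjI]
  have pump: "d P Q = d0 P Q + z P Q * a P Q" "d Q P = e0 P Q + z P Q * b P Q" "a P Q \<le> l" "b P Q \<le> l"
    "d P Q \<le> 1 \<longrightarrow> a P Q = 0" "d Q P \<le> 1 \<longrightarrow> b P Q = 0" "d0 P Q \<le> pump_const c l" "e0 P Q \<le> pump_const c l"
    if "P < Q" "Q < m" for P Q
    using R2[OF that] by (-) (elim conjE, assumption)+
  have K: "set (K P Q z') \<subseteq> set (M P Q) \<and>
        winv (r P Q) @ wpow (d0 P Q + z' * a P Q) (U P) @ r' P Q \<doteq> K P Q z' \<and>
        winv (r Q P) @ wpow (e0 P Q + z' * b P Q) (U Q) @ r' Q P \<doteq> winv (K P Q z')"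
    if "P < Q" "Q < m" for P Q z'
    by (rule R2[OF that, THEN conjunct2, THEN conjunct2, THEN conjunct2,
        THEN conjunct2, THEN conjunct2, THEN conjunct2, THEN conjunct2, THEN conjunct2, THEN spec])
  define g where "g P Q = (if P < Q then d0 P Q else e0 Q P)" for P Q
  define f where "f P Q = (if P < Q then a P Q else b Q P)" for P Q
  have dec: "d P Q = g P Q + z (min P Q) (max P Q) * f P Q" "g P Q \<le> pump_const c l" "f P Q \<le> l" "d P Q \<le> 1 \<Longrightarrow> f P Q = 0"
    if lt: "P < m" "Q < m" "P \<noteq> Q" for P Q
  proof -
    consider "P < Q" | "Q < P" "\<not> P < Q" using lt by linarith
    then have "d P Q = g P Q + z (min P Q) (max P Q) * f P Q \<and> g P Q \<le> pump_const c l \<and> f P Q \<le> l \<and> (d P Q \<le> 1 \<longrightarrow> f P Q = 0)"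
    proof cases
      case 1
      then show ?thesis using pump[OF 1 lt(2)] by (simp add: g_def f_def)
    next
      case 2
      then show ?thesis using pump[OF 2(1) lt(1)] by (simp add: g_def f_def)
    qed
    then show "d P Q = g P Q + z (min P Q) (max P Q) * f P Q" "g P Q \<le> pump_const c l" "f P Q \<le> l" "d P Q \<le> 1 \<Longrightarrow> f P Q = 0"
      by blast+
  qed
  show ?thesis
  proof (rule that[of "\<lambda>P. \<Sum>Q\<in>{..<m} - {P}. g P Q" z f])
    fix P assume P: "P < m"
    have "y P = (\<Sum>Q\<in>{..<m} - {P}. d P Q)" using dsum[OF P] by simp
    also have "\<dots> = (\<Sum>Q\<in>{..<m} - {P}. g P Q + z (min P Q) (max P Q) * f P Q)"
      using dec(1) P by (intro sum.cong) auto
    finally show "y P = (\<Sum>Q\<in>{..<m} - {P}. g P Q) + (\<Sum>Q\<in>{..<m} - {P}. z (min P Q) (max P Q) * f P Q)"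
      by (simp add: sum.distrib)
    have "(\<Sum>Q\<in>{..<m} - {P}. g P Q) \<le> (\<Sum>Q\<in>{..<m} - {P}. pump_const c l)" using dec(2) P by (intro sum_mono) auto
    also have "\<dots> \<le> m * pump_const c l" using card_mono[of "{..<m}" "{..<m} - {P}"] by simp
    finally show "(\<Sum>Q\<in>{..<m} - {P}. g P Q) \<le> m * pump_const c l" .
  next
    fix P Q assume PQ: "P < m" "Q < m" "P \<noteq> Q"
    then show "f P Q \<le> l" using dec by blast
    assume "y P \<le> 1"
    have "d P Q \<le> sum (d P) ({..<m} - {P})" using PQ by (intro member_le_sum) auto
    then have "d P Q \<le> 1" using dsum[OF PQ(1)] \<open>y P \<le> 1\<close> by simp
    then show "f P Q = 0" using dec PQ by blast
  next
    fix z' :: "nat \<Rightarrow> nat \<Rightarrow> nat"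
    define d' where "d' P Q = g P Q + z' (min P Q) (max P Q) * f P Q" for P Q
    define M' where "M' P Q = winv (r P Q) @ wpow (d' P Q) (U P) @ r' P Q" for P Q
    have M'K: "M' P Q \<doteq> K P Q (z' P Q)" "M' Q P \<doteq> winv (K P Q (z' P Q))" if "P < Q" "Q < m" for P Q
      using K[OF that, of "z' P Q"] that unfolding M'_def d'_def g_def f_def by auto
    have triv': "concat (map (\<lambda>P. concat (map (M' P) (around m P))) [0..<m]) \<doteq> []"
    proof (rule matching_trivial_product)
      fix P Q assume PQ: "P < Q" "Q < m"
      have "winv (K P Q (z' P Q)) \<doteq> winv (M' P Q)" by (rule geq_winv[OF geq_sym[OF M'K(1)[OF PQ]]])
      then show "M' Q P \<doteq> winv (M' P Q)" using M'K(2)[OF PQ] geq_trans by blast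
    next
      fix P R Q S assume o: "P < R" "R < Q" "Q < S" "S < m"
      have "P < Q" "Q < m" "R < S" using o by auto
      then show "M' P Q @ M' R S \<doteq> M' R S @ M' P Q"
        using indw_geq_commute[OF M(3)[OF o], of "K P Q (z' P Q)" "K R S (z' R S)"] K M'K o by blast
    qed
    have "concat (map (\<lambda>P. wpow ((\<Sum>Q\<in>{..<m} - {P}. g P Q) + (\<Sum>Q\<in>{..<m} - {P}. z' (min P Q) (max P Q) * f P Q)) (U P)) [0..<m])
        \<doteq> concat (map (\<lambda>P. concat (map (M' P) (around m P))) [0..<m])"
    proof (rule geq_concat_map)
      fix P assume "P \<in> set [0..<m]"
      then have P: "P < m" by simp
      have "concat (map (M' P) (around m P)) \<doteq> wpow (sum (d' P) ({..<m} - {P})) (U P)"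
        unfolding M'_def using cat[OF P, of "d' P"] .
      then show "wpow ((\<Sum>Q\<in>{..<m} - {P}. g P Q) + (\<Sum>Q\<in>{..<m} - {P}. z' (min P Q) (max P Q) * f P Q)) (U P)
         \<doteq> concat (map (M' P) (around m P))"
        unfolding d'_def sum.distrib by (rule geq_sym)
    qed
    then show "concat (map (\<lambda>P. wpow ((\<Sum>Q\<in>{..<m} - {P}. g P Q) + (\<Sum>Q\<in>{..<m} - {P}. z' (min P Q) (max P Q) * f P Q)) (U P)) [0..<m]) \<doteq> []"
      using triv' geq_trans by blast
  qed
qed

end

section \<open>Linear systems over the natural numbers and cones\<close>

text \<open>On the way from \<open>0\<close> to a solution \<open>x\<close> with largest entry \<open>X\<close>, the points \<open>\<lfloor>t * x / X\<rfloor>\<close> for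
  \<open>t \<le> T\<close> are mapped by the matrix into a box with \<open>T\<close> points: the rows of the exact points are at
  most \<open>\<beta>\<close> and rounding changes them by at most \<open>\<rho>\<close>. Two of these points have the same
  image and their difference is a kernel vector, which is non-negative, not zero, and below \<open>x\<close>. In contrast to Cramer's rule this needs no determinants, and
  only the number of rows enters the exponent of the bound.\<close>

lemma small_kernel_vector:
  fixes R :: "'r set" and B :: "'r \<Rightarrow> 'j \<Rightarrow> int" and x :: "'j \<Rightarrow> nat" and \<beta> \<rho> :: nat
  defines "T \<equiv> (2 * (\<beta> + \<rho>) + 1) ^ card R"
  assumes fin: "finite J" "finite R"
    and row: "\<And>r. r \<in> R \<Longrightarrow> (\<Sum>j\<in>J. \<bar>B r j\<bar>) \<le> int \<rho>"
    and rhs: "\<And>r. r \<in> R \<Longrightarrow> \<bar>\<Sum>j\<in>J. B r j * int (x j)\<bar> \<le> int \<beta>"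
    and large: "j0 \<in> J" "T < x j0"
  obtains h where "\<And>j. j \<in> J \<Longrightarrow> h j \<le> x j" "\<And>j. j \<in> J \<Longrightarrow> h j \<le> T" "\<exists>j\<in>J. 0 < h j"
    "\<And>r. r \<in> R \<Longrightarrow> (\<Sum>j\<in>J. B r j * int (h j)) = 0"
proof -
  define X where "X = Max (x ` J)"
  have xX: "x j \<le> X" if "j \<in> J" for j using fin that by (simp add: X_def)
  have "X \<in> x ` J" unfolding X_def using fin large by (intro Max_in) auto
  then obtain j1 where j1: "j1 \<in> J" "x j1 = X" by auto
  have TX: "T < X" using large xX[of j0] by simp
  then have X0: "0 < X" by simp
  define q where "q t j = (t * x j) div X" for t j
  define v where "v t r = (\<Sum>j\<in>J. B r j * int (q t j))" for t r
  have vb: "\<bar>v t r\<bar> \<le> int (\<beta> + \<rho>)" if "t \<le> T" "r \<in> R" for t r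
  proof -
    have e: "int X * int (q t j) = int t * int (x j) - int ((t * x j) mod X)" for j
      unfolding q_def by (metis add_diff_cancel_right' mult_div_mod_eq of_nat_add of_nat_mult)
    have "int X * v t r = (\<Sum>j\<in>J. B r j * (int X * int (q t j)))"
      unfolding v_def sum_distrib_left by (intro sum.cong) (simp_all add: algebra_simps)
    also have "\<dots> = int t * (\<Sum>j\<in>J. B r j * int (x j)) - (\<Sum>j\<in>J. B r j * int ((t * x j) mod X))"
      unfolding e sum_distrib_left sum_subtractf[symmetric] by (intro sum.cong) (simp_all add: algebra_simps)
    finally have eq: "int X * v t r = int t * (\<Sum>j\<in>J. B r j * int (x j)) - (\<Sum>j\<in>J. B r j * int ((t * x j) mod X))" .
    have 1: "\<bar>int t * (\<Sum>j\<in>J. B r j * int (x j))\<bar> \<le> int X * int \<beta>"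
      unfolding abs_mult using rhs[OF that(2)] that(1) TX by (intro mult_mono) auto
    have "\<bar>\<Sum>j\<in>J. B r j * int ((t * x j) mod X)\<bar> \<le> (\<Sum>j\<in>J. \<bar>B r j * int ((t * x j) mod X)\<bar>)"
      by (rule sum_abs)
    also have "\<dots> \<le> (\<Sum>j\<in>J. \<bar>B r j\<bar> * int X)"
      unfolding abs_mult using X0 by (intro sum_mono mult_left_mono) (auto simp: less_imp_le)
    also have "\<dots> = (\<Sum>j\<in>J. \<bar>B r j\<bar>) * int X" by (simp add: sum_distrib_right)
    also have "\<dots> \<le> int \<rho> * int X" using row[OF that(2)] by (intro mult_right_mono) auto
    finally have 2: "\<bar>\<Sum>j\<in>J. B r j * int ((t * x j) mod X)\<bar> \<le> int X * int \<rho>" by (simp add: mult.commute)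
    have "\<bar>int X * v t r\<bar> \<le> int X * int \<beta> + int X * int \<rho>" unfolding eq using 1 2 by linarith
    then have "int X * \<bar>v t r\<bar> \<le> int X * int (\<beta> + \<rho>)" by (simp add: abs_mult algebra_simps)
    then show ?thesis using X0 by simp
  qed
  define V where "V t = restrict (v t) R" for t
  have "V ` {..T} \<subseteq> (\<Pi>\<^sub>E r\<in>R. {- int (\<beta> + \<rho>)..int (\<beta> + \<rho>)})"
  proof
    fix g assume "g \<in> V ` {..T}"
    then obtain t where t: "t \<le> T" "g = V t" by auto
    have "- int (\<beta> + \<rho>) \<le> v t r \<and> v t r \<le> int (\<beta> + \<rho>)" if "r \<in> R" for r
      using vb[OF t(1) that] by linarith
    then show "g \<in> (\<Pi>\<^sub>E r\<in>R. {- int (\<beta> + \<rho>)..int (\<beta> + \<rho>)})"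
      unfolding t(2) V_def by (intro restrict_PiE_iff[THEN iffD2]) auto
  qed
  then have "card (V ` {..T}) \<le> card (\<Pi>\<^sub>E r\<in>R. {- int (\<beta> + \<rho>)..int (\<beta> + \<rho>)})"
    using fin by (intro card_mono finite_PiE) auto
  also have "\<dots> = T"
  proof -
    have "card {- int (\<beta> + \<rho>)..int (\<beta> + \<rho>)} = nat (int (\<beta> + \<rho>) + 1 - (- int (\<beta> + \<rho>)))"
      by (simp only: card_atLeastAtMost_int)
    also have "int (\<beta> + \<rho>) + 1 - (- int (\<beta> + \<rho>)) = int (2 * (\<beta> + \<rho>) + 1)" by simp
    also have "nat \<dots> = 2 * (\<beta> + \<rho>) + 1" by (rule nat_int)
    finally show ?thesis using fin by (simp only: card_PiE T_def prod_constant)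
  qed
  finally have "card (V ` {..T}) < card {..T}" by simp
  then have "\<not> inj_on V {..T}" by (rule pigeonhole)
  then obtain t t' where t: "t < t'" "t' \<le> T" "V t = V t'"
    unfolding inj_on_def by (metis atMost_iff linorder_neqE_nat)
  have mono: "q t j \<le> q t' j" for j unfolding q_def using t by (intro div_le_mono mult_le_mono1) simp
  have qle: "q t' j \<le> t'" "q t' j \<le> x j" if "j \<in> J" for j
  proof -
    have "q t' j \<le> (t' * X) div X" unfolding q_def using xX[OF that] by (intro div_le_mono mult_le_mono2)
    then show "q t' j \<le> t'" using X0 by simp
    have "q t' j \<le> (X * x j) div X" unfolding q_def using t TX by (intro div_le_mono mult_le_mono1) simp
    then show "q t' j \<le> x j" using X0 by simp
  qed
  show ?thesis
  proof (rule that[of "\<lambda>j. q t' j - q t j"])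
    show "q t' j - q t j \<le> x j" if "j \<in> J" for j using qle(2)[OF that] by simp
    show "q t' j - q t j \<le> T" if "j \<in> J" for j using qle(1)[OF that] t by simp
    have "q t' j1 - q t j1 = t' - t" using X0 by (simp add: q_def j1)
    then show "\<exists>j\<in>J. 0 < q t' j - q t j" using j1 t by (intro bexI[of _ j1]) auto
    fix r assume r: "r \<in> R"
    have "(\<Sum>j\<in>J. B r j * int (q t' j - q t j)) = v t' r - v t r"
      unfolding v_def sum_subtractf[symmetric] using mono by (intro sum.cong) (simp_all add: of_nat_diff algebra_simps)
    also have "v t' r = v t r" using arg_cong[OF t(3), of "\<lambda>g. g r"] r by (simp add: V_def)
    finally show "(\<Sum>j\<in>J. B r j * int (q t' j - q t j)) = 0" by simp
  qed
qed

lemma solution_decomposition: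
  fixes R :: "'r set" and B :: "'r \<Rightarrow> 'j \<Rightarrow> int" and x :: "'j \<Rightarrow> nat" and \<beta> \<rho> :: nat
  defines "T \<equiv> (2 * (\<beta> + \<rho>) + 1) ^ card R"
  assumes fin: "finite J" "finite R"
    and row: "\<And>r. r \<in> R \<Longrightarrow> (\<Sum>j\<in>J. \<bar>B r j\<bar>) \<le> int \<rho>"
    and rhs: "\<And>r. r \<in> R \<Longrightarrow> \<bar>\<Sum>j\<in>J. B r j * int (x j)\<bar> \<le> int \<beta>"
  shows "\<exists>x0 hs. (\<forall>j\<in>J. x0 j \<le> T) \<and> (\<forall>h\<in>set hs. (\<forall>j\<in>J. h j \<le> T) \<and> (\<forall>r\<in>R. (\<Sum>j\<in>J. B r j * int (h j)) = 0)) \<and>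
     (\<forall>j\<in>J. x j = x0 j + (\<Sum>h\<leftarrow>hs. h j)) \<and>
     (\<forall>r\<in>R. (\<Sum>j\<in>J. B r j * int (x0 j)) = (\<Sum>j\<in>J. B r j * int (x j)))"
  using rhs
proof (induction "sum x J" arbitrary: x rule: less_induct)
  case less
  show ?case
  proof (cases "\<forall>j\<in>J. x j \<le> T")
    case True
    then show ?thesis by (intro exI[of _ x] exI[of _ "[]"]) auto
  next
    case False
    then obtain j0 where j0: "j0 \<in> J" "T < x j0" by auto
    obtain h where h: "\<And>j. j \<in> J \<Longrightarrow> h j \<le> x j" "\<And>j. j \<in> J \<Longrightarrow> h j \<le> T" "\<exists>j\<in>J. 0 < h j"
      "\<And>r. r \<in> R \<Longrightarrow> (\<Sum>j\<in>J. B r j * int (h j)) = 0"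
      by (rule small_kernel_vector[where B=B and R=R and x=x and \<beta>=\<beta> and \<rho>=\<rho>,
            OF fin row less.prems j0(1) j0(2)[unfolded T_def]], assumption+)
        (rule that; simp add: T_def)
    define x' where "x' j = x j - h j" for j
    obtain j2 where j2: "j2 \<in> J" "0 < h j2" using h(3) by blast
    have lt: "sum x' J < sum x J"
    proof (rule sum_strict_mono_ex1)
      show "\<exists>a\<in>J. x' a < x a" using j2 h(1)[OF j2(1)] unfolding x'_def by (intro bexI[of _ j2]) auto
    qed (use fin in \<open>auto simp: x'_def\<close>)
    have same: "(\<Sum>j\<in>J. B r j * int (x' j)) = (\<Sum>j\<in>J. B r j * int (x j))" if "r \<in> R" for r
    proof -
      have "(\<Sum>j\<in>J. B r j * int (x' j)) = (\<Sum>j\<in>J. B r j * int (x j)) - (\<Sum>j\<in>J. B r j * int (h j))"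
        unfolding sum_subtractf[symmetric] x'_def using h(1) by (intro sum.cong) (simp_all add: of_nat_diff algebra_simps)
      then show ?thesis using h(4)[OF that] by simp
    qed
    obtain x0 hs where IH: "\<forall>j\<in>J. x0 j \<le> T"
      "\<forall>h\<in>set hs. (\<forall>j\<in>J. h j \<le> T) \<and> (\<forall>r\<in>R. (\<Sum>j\<in>J. B r j * int (h j)) = 0)"
      "\<forall>j\<in>J. x' j = x0 j + (\<Sum>h\<leftarrow>hs. h j)"
      "\<forall>r\<in>R. (\<Sum>j\<in>J. B r j * int (x0 j)) = (\<Sum>j\<in>J. B r j * int (x' j))"
      using less.hyps[OF lt] less.prems same by auto
    show ?thesis
    proof (intro exI[of _ x0] exI[of _ "h # hs"] conjI)
      show "\<forall>j\<in>J. x j = x0 j + (\<Sum>h\<leftarrow>h # hs. h j)"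
      proof
        fix j assume j: "j \<in> J"
        have "x j = x' j + h j" using h(1)[OF j] by (simp add: x'_def)
        then show "x j = x0 j + (\<Sum>h\<leftarrow>h # hs. h j)" using IH(3) j by simp
      qed
    qed (use IH h same in auto)
  qed
qed

text \<open>The linear set with apex \<open>a\<close> and generators \<open>F\<close>; multiplicities are represented by lists, because
  lists are compatible with projections that identify generators.\<close>

definition cone :: "(nat \<Rightarrow> nat) \<Rightarrow> (nat \<Rightarrow> nat) set \<Rightarrow> (nat \<Rightarrow> nat) set" where
  "cone a F = {\<lambda>i. a i + (\<Sum>h\<leftarrow>hs. h i) | hs. set hs \<subseteq> F}"

lemma linear_cone:
  assumes "finite F" "a \<in> nat_vectors k" "F \<subseteq> nat_vectors k"
  shows "linear_set k (cone a F)"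
proof -
  obtain b where b: "bij_betw b {..<card F} F" 
    using assms(1) ex_bij_betw_nat_finite[of F] by (auto simp: atLeast0LessThan)
  have bF: "b j \<in> F" if "j < card F" for j using b that by (auto simp: bij_betw_def)
  have sums: "(\<Sum>j<card F. c (b j) * b j i) = (\<Sum>h\<in>F. c h * h i)" for c :: "(nat \<Rightarrow> nat) \<Rightarrow> nat" and i
    by (rule sum.reindex_bij_betw[OF b, of "\<lambda>h. c h * h i"])
  show ?thesis
    unfolding linear_set_def
  proof (intro exI[of _ a] exI[of _ "card F"] exI[of _ b] conjI)
    show "a \<in> nat_vectors k" by fact
    show "\<forall>j<card F. b j \<in> nat_vectors k" using bF assms(3) by blast
    show "cone a F = {\<lambda>i. a i + (\<Sum>j<card F. c j * b j i) |c. True}"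
    proof (intro subset_antisym subsetI)
      fix s assume "s \<in> cone a F"
      then obtain hs where hs: "set hs \<subseteq> F" "s = (\<lambda>i. a i + (\<Sum>h\<leftarrow>hs. h i))" by (auto simp: cone_def)
      have "(\<Sum>h\<leftarrow>hs. h i) = (\<Sum>h\<in>F. count_list hs h * h i)" for i
        using sum_list_map_eq_sum_count2[OF hs(1) assms(1), of "\<lambda>h. h i"] by simp
      then have "s = (\<lambda>i. a i + (\<Sum>j<card F. count_list hs (b j) * b j i))"
        unfolding hs(2) sums[of "count_list hs"] by simp
      then show "s \<in> {\<lambda>i. a i + (\<Sum>j<card F. c j * b j i) |c. True}" by auto
    next
      fix s assume "s \<in> {\<lambda>i. a i + (\<Sum>j<card F. c j * b j i) |c. True}"
      then obtain c where s: "s = (\<lambda>i. a i + (\<Sum>j<card F. c j * b j i))" by auto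
      define hs where "hs = concat (map (\<lambda>j. replicate (c j) (b j)) [0..<card F])"
      have "set hs \<subseteq> F" using bF by (auto simp: hs_def)
      moreover have "(\<Sum>h\<leftarrow>concat (map (\<lambda>j. replicate (c j) (b j)) [0..<n]). h i) = (\<Sum>j<n. c j * b j i)" for i n
        by (induction n) (auto simp: sum_list_replicate)
      ultimately have "s = (\<lambda>i. a i + (\<Sum>h\<leftarrow>hs. h i)) \<and> set hs \<subseteq> F" unfolding s hs_def by simp
      then show "s \<in> cone a F" unfolding cone_def by blast
    qed
  qed
qed

lemma finite_box: "finite {f \<in> nat_vectors k. \<forall>i. f i \<le> T}"
proof -
  have "{f \<in> nat_vectors k. \<forall>i. f i \<le> T} \<subseteq> {f. \<forall>i. (i \<in> {..<k} \<longrightarrow> f i \<in> {..T}) \<and> (i \<notin> {..<k} \<longrightarrow> f i = 0)}"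
    by (auto simp: nat_vectors_def)
  then show ?thesis by (rule finite_subset) (rule finite_set_of_finite_funs; simp)
qed

text \<open>There are only finitely many cones with apex and generators in a box, so a set is semilinear as
  soon as each of its points lies in such a cone inside the set.\<close>

theorem semilinear_by_bounded_cones:
  assumes "\<And>s. s \<in> S \<Longrightarrow> \<exists>a F. a \<in> {f \<in> nat_vectors k. \<forall>i. f i \<le> T} \<and>
      F \<subseteq> {f \<in> nat_vectors k. \<forall>i. f i \<le> T} \<and> s \<in> cone a F \<and> cone a F \<subseteq> S"
  shows "semilinear_set k S"
proof -
  define Box where "Box = {f \<in> nat_vectors k. \<forall>i. f i \<le> T}"
  have fB: "finite Box" unfolding Box_def by (rule finite_box)
  define \<F> where "\<F> = {L \<in> (\<lambda>(a, F). cone a F) ` (Box \<times> Pow Box). L \<subseteq> S}"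
  have "finite \<F>" unfolding \<F>_def using fB by (intro finite_Collect_conjI disjI1) simp
  moreover have "\<forall>L\<in>\<F>. linear_set k L"
    unfolding \<F>_def using fB by (auto intro!: linear_cone intro: finite_subset simp: Box_def)
  moreover have "S = \<Union>\<F>"
    using assms unfolding \<F>_def Box_def[symmetric] by fastforce
  ultimately show ?thesis unfolding semilinear_set_def by blast
qed

section \<open>Cyclic reduction and connected components\<close>

context trace_alphabet
begin

text \<open>A cancelling pair in a product of two reduced words consists of a last letter of the first and a first
  letter of the second.\<close>

lemma reduced_append_failure:
  assumes "reduced x" "reduced y" "\<not> reduced (x @ y)"
  shows "\<exists>a x' y'. x \<simeq> x' @ [a] \<and> y \<simeq> iv a # y'"
  using assms
proof (induction x)
  case (Cons c x)
  show ?case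
  proof (cases "reduced (x @ y)")
    case False
    then obtain a x' y' where "x \<simeq> x' @ [a]" "y \<simeq> iv a # y'" using Cons by auto
    then have "c # x \<simeq> (c # x') @ [a]" by simp
    then show ?thesis using \<open>y \<simeq> iv a # y'\<close> by blast
  next
    case True
    then obtain w where "x @ y \<simeq> iv c # w" using Cons.prems(3) by (auto simp: strip_None_iff)
    then obtain w1 w2 where w: "x @ y = w1 @ iv c # w2" "\<forall>b\<in>set w1. ind (iv c) b"
      using teq_Cons_split[OF teq_sym] by metis
    from w(1) consider us where "x = w1 @ iv c # us" | us where "w1 = x @ us" "y = us @ iv c # w2"
      by (auto simp: append_eq_append_conv2 append_eq_Cons_conv Cons_eq_append_conv)
    then show ?thesis
    proof cases
      case 1
      then have "strip (iv c) x \<noteq> None" using strip_split w(2) by simp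
      then show ?thesis using Cons.prems(1) by simp
    next
      case 2
      have "c # x \<simeq> x @ [c]" using teq_move_front[of x c "[]"] 2 w(2) teq_sym by simp
      moreover have "y \<simeq> iv c # us @ w2" using teq_move_front[of us "iv c" w2] 2 w(2) by simp
      ultimately show ?thesis by blast
    qed
  qed
qed simp

text \<open>If a power of \<open>w\<close> were not reduced, some \<open>a\<close> would be a last letter of \<open>w\<close> and \<open>iv a\<close> a first
  letter of a power of \<open>w\<close>, hence of \<open>w\<close> itself, and \<open>w\<close> would not be cyclically reduced.\<close>

lemma cyclically_reduced_powers:
  assumes "reduced w" and cyc: "\<nexists>a v. w \<simeq> a # v @ [iv a]"
  shows "reduced (wpow k w)"
proof (induction k)
  case (Suc k)
  show ?case
  proof (rule ccontr)
    assume "\<not> reduced (wpow (Suc k) w)"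
    then obtain a x' y' where a: "w \<simeq> x' @ [a]" "wpow k w \<simeq> iv a # y'"
      using reduced_append_failure[OF assms(1) Suc] by auto
    then obtain y1 y2 where y: "wpow k w = y1 @ iv a # y2" "\<forall>b\<in>set y1. ind (iv a) b"
      using teq_Cons_split[OF teq_sym] by metis
    then obtain k' where k: "wpow k w = w @ wpow k' w" by (cases k) auto
    have "iv a \<in> set w" using y(1) by (metis in_set_conv_decomp set_wpow empty_iff)
    then obtain w1 w2 where w: "w = w1 @ iv a # w2" "iv a \<notin> set w1" by (meson split_list_first)
    have "iv a \<notin> set y1" using y(2) by (meson ind_irrefl)
    then have "takeWhile (\<lambda>c. c \<noteq> iv a) (wpow k w) = y1" unfolding y(1) by (auto simp: takeWhile_tail)
    moreover have "takeWhile (\<lambda>c. c \<noteq> iv a) (wpow k w) = w1"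
      unfolding k using w by (auto simp: takeWhile_tail takeWhile_append)
    ultimately have "\<forall>b\<in>set w1. ind (iv a) b" using y(2) by simp
    then have "iv a # w1 @ w2 \<simeq> x' @ [a]" using teq_move_front[of w1 "iv a" w2] a(1) w(1) teq_sym teq_trans by blast
    then obtain z1 z2 where z: "x' @ [a] = z1 @ iv a # z2" "\<forall>b\<in>set z1. ind (iv a) b"
      using teq_Cons_split by metis
    have "z2 \<noteq> []"
    proof
      assume "z2 = []"
      then have "iv a = a" using z(1) by simp
      then show False by simp
    qed
    then obtain z2' where "z2 = z2' @ [a]"
      using z(1) by (cases z2 rule: rev_cases) auto
    then have "x' @ [a] \<simeq> iv a # (z1 @ z2') @ [iv (iv a)]"
      using z teq_move_front[of z1 "iv a" "z2' @ [a]"] by simp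
    then show False using cyc a(1) teq_trans by blast
  qed
qed simp

lemma cyclic_reduction:
  "reduced x \<Longrightarrow> \<exists>p w. x \<simeq> p @ w @ winv p \<and> (\<forall>k. reduced (wpow k w))"
proof (induction "length x" arbitrary: x rule: less_induct)
  case less
  show ?case
  proof (cases "\<exists>a v. x \<simeq> a # v @ [iv a]")
    case False
    then show ?thesis using cyclically_reduced_powers[OF less.prems]
      by (intro exI[of _ "[]"] exI[of _ x]) simp
  next
    case True
    then obtain a v where v: "x \<simeq> a # v @ [iv a]" by blast
    then have "reduced ([a] @ v @ [iv a])" using less.prems reduced_teq by simp
    then have "reduced v" by (rule reduced_factor)
    moreover have "length v < length x" using teq_length[OF v] by simp
    ultimately obtain p w where p: "v \<simeq> p @ w @ winv p" "\<forall>k. reduced (wpow k w)" using less.hyps by blast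
    have "[a] @ v @ [iv a] \<simeq> [a] @ (p @ w @ winv p) @ [iv a]" using p(1) by (intro teq_append teq_refl)
    then have "x \<simeq> (a # p) @ w @ winv (a # p)" using teq_trans[OF v] by (simp add: winv_Cons)
    then show ?thesis using p(2) by blast
  qed
qed

lemma teq_partition:
  "(\<And>b d. b \<in> set v \<Longrightarrow> d \<in> set v \<Longrightarrow> b \<in> D \<Longrightarrow> d \<notin> D \<Longrightarrow> ind b d) \<Longrightarrow>
    v \<simeq> filter (\<lambda>b. b \<in> D) v @ filter (\<lambda>b. b \<notin> D) v"
proof (induction v)
  case (Cons x v)
  then have IH: "v \<simeq> filter (\<lambda>b. b \<in> D) v @ filter (\<lambda>b. b \<notin> D) v" by auto
  show ?case
  proof (cases "x \<in> D")
    case True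
    then show ?thesis using IH by simp
  next
    case False
    then have "\<forall>b\<in>set (filter (\<lambda>b. b \<in> D) v). ind x b" using Cons.prems ind_sym by auto
    from teq_move_front[OF this, of "filter (\<lambda>b. b \<notin> D) v"]
    have "x # filter (\<lambda>b. b \<in> D) v @ filter (\<lambda>b. b \<notin> D) v \<simeq> filter (\<lambda>b. b \<in> D) v @ x # filter (\<lambda>b. b \<notin> D) v"
      by (rule teq_sym)
    then show ?thesis using teq_trans[OF teq_Cons[OF IH, of x]] False by simp
  qed
qed simp

text \<open>Distinct components of the dependence graph on the letters of \<open>w\<close> are independent, so \<open>w\<close> is the
  product of its restrictions to them, and so are its powers. Induction splits off the component of
  the first letter.\<close>

lemma connected_components:
  "\<exists>ws. length ws \<le> card (set w) \<and>
     (\<forall>x\<in>set ws. connectedw x \<and> set x \<subseteq> set w \<and> length x \<le> length w \<and> (\<forall>k. reduced (wpow k w) \<longrightarrow> reduced (wpow k x))) \<and>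
     (\<forall>k. wpow k w \<simeq> concat (map (wpow k) ws))"
proof (induction "length w" arbitrary: w rule: less_induct)
  case less
  show ?case
  proof (cases w)
    case Nil
    then show ?thesis by (intro exI[of _ "[]"]) simp
  next
    case (Cons a w')
    define r where "r = {(b, d). b \<in> set w \<and> d \<in> set w \<and> \<not> ind b d}"
    define D where "D = {b. (a, b) \<in> r\<^sup>*}"
    have symr: "sym r" unfolding r_def sym_def using ind_sym by blast
    have aD: "a \<in> D" by (simp add: D_def)
    define w1 where "w1 = filter (\<lambda>b. b \<in> D) w"
    define w2 where "w2 = filter (\<lambda>b. b \<notin> D) w"
    have step: "d \<in> D" if "b \<in> D" "b \<in> set w" "d \<in> set w" "\<not> ind b d" for b d
      using that unfolding D_def r_def by (auto intro: rtrancl_into_rtrancl)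
    have part: "wpow k w \<simeq> wpow k w1 @ wpow k w2" for k
    proof -
      have "wpow k w \<simeq> filter (\<lambda>b. b \<in> D) (wpow k w) @ filter (\<lambda>b. b \<notin> D) (wpow k w)"
        using step by (intro teq_partition) (auto simp: set_wpow split: if_splits)
      then show ?thesis by (simp add: filter_wpow w1_def w2_def)
    qed
    have a1: "a \<in> set w1" using aD Cons by (simp add: w1_def)
    have conn: "connectedw w1"
      unfolding connectedw_def
    proof (intro conjI allI impI)
      show "w1 \<noteq> []" using a1 by auto
      fix Y assume Y: "Y \<subseteq> set w1" "Y \<noteq> {}" "\<forall>a\<in>Y. \<forall>b\<in>set w1. \<not> ind a b \<longrightarrow> b \<in> Y"
      have cl: "d \<in> Y" if "b \<in> Y" "(b, d) \<in> r" for b d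
        using that Y(1,3) step[of b d] unfolding r_def w1_def by auto
      have cl': "d \<in> Y" if "(b, d) \<in> r\<^sup>*" "b \<in> Y" for b d
        using that by (induction rule: rtrancl_induct) (auto intro: cl)
      obtain y where y: "y \<in> Y" using Y(2) by blast
      then have "(a, y) \<in> r\<^sup>*" using Y(1) by (auto simp: w1_def D_def)
      then have "(y, a) \<in> r\<^sup>*" using symr sym_rtrancl symD by metis
      then have "a \<in> Y" using cl' y by blast
      then have "set w1 \<subseteq> Y" using cl' by (auto simp: w1_def D_def)
      then show "Y = set w1" using Y(1) by blast
    qed
    have "length w2 < length w"
      unfolding w2_def by (rule length_filter_less[of a]) (use aD Cons in auto)
    then obtain ws where ws: "length ws \<le> card (set w2)"
      "\<forall>x\<in>set ws. connectedw x \<and> set x \<subseteq> set w2 \<and> length x \<le> length w2 \<and> (\<forall>k. reduced (wpow k w2) \<longrightarrow> reduced (wpow k x))"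
      "\<forall>k. wpow k w2 \<simeq> concat (map (wpow k) ws)"
      using less.hyps by metis
    have red1: "reduced (wpow k w1)" "reduced (wpow k w2)" if "reduced (wpow k w)" for k
    proof -
      have "reduced (wpow k w1 @ wpow k w2)" using part that reduced_teq by blast
      then show "reduced (wpow k w1)" "reduced (wpow k w2)"
        using reduced_factor[of "[]" "wpow k w1" "wpow k w2"] reduced_factor[of "wpow k w1" "wpow k w2" "[]"] by simp_all
    qed
    have "set w2 \<subset> set w" using aD Cons by (auto simp: w2_def)
    then have card: "card (set w2) < card (set w)" by (intro psubset_card_mono) auto
    show ?thesis
    proof (intro exI[of _ "w1 # ws"] conjI ballI allI)
      show "length (w1 # ws) \<le> card (set w)" using ws(1) card by simp
      fix k
      show "wpow k w \<simeq> concat (map (wpow k) (w1 # ws))"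
        using teq_trans[OF part teq_append[OF teq_refl ws(3)[rule_format]]] by simp
    next
      fix x assume x: "x \<in> set (w1 # ws)"
      have s: "set w1 \<subseteq> set w" "set w2 \<subseteq> set w" "length w1 \<le> length w" "length w2 \<le> length w"
        by (auto simp: w1_def w2_def)
      show "connectedw x" "set x \<subseteq> set w" "length x \<le> length w"
        using x ws(2) conn s by fastforce+
      show "reduced (wpow k w) \<longrightarrow> reduced (wpow k x)" for k
        using x ws(2) red1 by auto
    qed
  qed
qed

lemma reduced_replicate: "reduced (wpow k [a])"
proof (rule cyclically_reduced_powers)
  show "\<nexists>b v. [a] \<simeq> b # v @ [iv b]" using teq_length by fastforce
qed simp

lemma connectedw_single: "connectedw [a]"
  by (auto simp: connectedw_def)

end

section \<open>Graph groups and trace monoids in terms of words\<close>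

abbreviation graph_group_relations :: "'a set \<Rightarrow> ('a \<times> 'a) set \<Rightarrow> ('a signed list \<times> 'a signed list) set" where
  "graph_group_relations A I \<equiv> {([p, inv_letter p], []) | p. p \<in> signed_letters A} \<union>
      {([(a, True), (b, True)], [(b, True), (a, True)]) | a b. (a, b) \<in> I}"

abbreviation trace_relations :: "('a \<times> 'a) set \<Rightarrow> ('a signed list \<times> 'a signed list) set" where
  "trace_relations I \<equiv> {([p, q], [q, p]) | p q. (p, q) \<in> signed_independence I}"

locale graph_group_alphabet =
  fixes A :: "'a set" and I :: "('a \<times> 'a) set"
  assumes indep: "independence_alphabet A I"

sublocale graph_group_alphabet \<subseteq> trace_alphabet "\<lambda>p q. (p, q) \<in> signed_independence I" inv_letter
  using indep
  by unfold_locales (auto simp: independence_alphabet_def signed_independence_def inv_letter_def irrefl_def prod_eq_iff dest: symD)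

context graph_group_alphabet
begin

notation teq (infix "\<simeq>" 50) and geq (infix "\<doteq>" 50)

abbreviation "X \<equiv> signed_letters A"

text \<open>The following lemmas identify equality of the elements represented by words
  with \<open>geq\<close>, and the trace monoid of the presentation with words up to \<open>teq\<close>.\<close>

definition val :: "'a signed list \<Rightarrow> 'a signed list set" where
  "val w = presentation_cong X (graph_group_relations A I) `` {w}"

abbreviation "G \<equiv> graph_group A I"

lemma G_eq: "G = presented_monoid X (graph_group_relations A I)"
  by (simp add: graph_group_def)

sublocale G: group G by (rule group_graph_group)

lemma carrier_G: "g \<in> carrier G \<longleftrightarrow> (\<exists>w\<in>lists X. g = val w)"
  unfolding G_eq carrier_presented_monoid val_def ..

lemma val_carrier: "w \<in> lists X \<Longrightarrow> val w \<in> carrier G"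
  using carrier_G by blast

lemma val_Nil: "val [] = \<one>\<^bsub>G\<^esub>"
  unfolding G_eq one_presented_monoid val_def ..

lemma val_append: "x \<in> lists X \<Longrightarrow> y \<in> lists X \<Longrightarrow> val (x @ y) = val x \<otimes>\<^bsub>G\<^esub> val y"
  unfolding G_eq val_def by (rule mult_presented_monoid[symmetric])

lemma val_eq_iff: "x \<in> lists X \<Longrightarrow> y \<in> lists X \<Longrightarrow> val x = val y \<longleftrightarrow> (x, y) \<in> presentation_cong X (graph_group_relations A I)"
  unfolding val_def using eq_equiv_class_iff[OF equiv_presentation_cong] .

lemma val_Cons: "a \<in> X \<Longrightarrow> y \<in> lists X \<Longrightarrow> val (a # y) = val [a] \<otimes>\<^bsub>G\<^esub> val y"
  using val_append[of "[a]" y] by simp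

lemma val_cancel: "p \<in> X \<Longrightarrow> val [p] \<otimes>\<^bsub>G\<^esub> val [inv_letter p] = \<one>\<^bsub>G\<^esub>"
proof -
  assume p: "p \<in> X"
  then have "([p, inv_letter p], []) \<in> graph_group_relations A I" by blast
  then have "([p, inv_letter p], []) \<in> presentation_cong X (graph_group_relations A I)"
    using p by (intro presentation_cong.base) simp_all
  then have "val [p, inv_letter p] = val []" using p val_eq_iff[of "[p, inv_letter p]" "[]"] by simp
  then show ?thesis using val_append[of "[p]" "[inv_letter p]"] p val_Nil by simp
qed

lemma val_inv_letter: "p \<in> X \<Longrightarrow> val [inv_letter p] = inv\<^bsub>G\<^esub> val [p]"
proof -
  assume p: "p \<in> X"
  have "val [inv_letter p] \<otimes>\<^bsub>G\<^esub> val [p] = \<one>\<^bsub>G\<^esub>"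
    using val_cancel[of "inv_letter p"] p by simp
  then show ?thesis using p by (intro G.inv_equality[symmetric] val_carrier) auto
qed

text \<open>The presentation only makes the positive generators commute; for inverses this follows in the group.\<close>

lemma val_letters_commute:
  assumes "p \<in> X" "q \<in> X" "(p, q) \<in> signed_independence I"
  shows "val [p] \<otimes>\<^bsub>G\<^esub> val [q] = val [q] \<otimes>\<^bsub>G\<^esub> val [p]"
proof -
  obtain a s b t where pq: "p = (a, s)" "q = (b, t)" by fastforce
  have ab: "a \<in> A" "b \<in> A" "(a, b) \<in> I" using assms pq by (auto simp: signed_letters_def signed_independence_def)
  define x where "x = val [(a, True)]"
  define y where "y = val [(b, True)]"
  have in_X: "(a, u) \<in> X" "(b, u) \<in> X" for u using ab by (auto simp: signed_letters_def)
  have car: "x \<in> carrier G" "y \<in> carrier G" unfolding x_def y_def using in_X by (auto intro: val_carrier)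
  have "([(a, True), (b, True)], [(b, True), (a, True)]) \<in> presentation_cong X (graph_group_relations A I)"
    using ab in_X by (intro presentation_cong.base) auto
  then have "val ([(a, True)] @ [(b, True)]) = val ([(b, True)] @ [(a, True)])"
    using val_eq_iff[of "[(a, True), (b, True)]" "[(b, True), (a, True)]"] in_X by simp
  then have xy: "x \<otimes>\<^bsub>G\<^esub> y = y \<otimes>\<^bsub>G\<^esub> x"
    unfolding x_def y_def using val_append[of "[(a, True)]" "[(b, True)]"] val_append[of "[(b, True)]" "[(a, True)]"] in_X by simp
  have neg: "g \<otimes>\<^bsub>G\<^esub> inv\<^bsub>G\<^esub> h = inv\<^bsub>G\<^esub> h \<otimes>\<^bsub>G\<^esub> g"
    if "g \<in> carrier G" "h \<in> carrier G" "g \<otimes>\<^bsub>G\<^esub> h = h \<otimes>\<^bsub>G\<^esub> g" for g h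
    using that by (metis G.inv_closed G.inv_solve_left G.inv_solve_right G.m_assoc G.m_closed)
  have p': "val [p] = x \<or> val [p] = inv\<^bsub>G\<^esub> x"
    using val_inv_letter[of "(a, True)"] in_X pq by (cases s) (auto simp: x_def inv_letter_def)
  have q': "val [q] = y \<or> val [q] = inv\<^bsub>G\<^esub> y"
    using val_inv_letter[of "(b, True)"] in_X pq by (cases t) (auto simp: y_def inv_letter_def)
  have 1: "x \<otimes>\<^bsub>G\<^esub> inv\<^bsub>G\<^esub> y = inv\<^bsub>G\<^esub> y \<otimes>\<^bsub>G\<^esub> x" using neg car xy by blast
  have 2: "y \<otimes>\<^bsub>G\<^esub> inv\<^bsub>G\<^esub> x = inv\<^bsub>G\<^esub> x \<otimes>\<^bsub>G\<^esub> y" using neg car xy by simp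
  have 3: "inv\<^bsub>G\<^esub> y \<otimes>\<^bsub>G\<^esub> inv\<^bsub>G\<^esub> x = inv\<^bsub>G\<^esub> x \<otimes>\<^bsub>G\<^esub> inv\<^bsub>G\<^esub> y" using neg[of "inv\<^bsub>G\<^esub> y" x] car 1 by simp
  show ?thesis using p' q' xy 1 2 3 by metis
qed

lemma val_move_front:
  assumes "a \<in> X" "y1 \<in> lists X" "y2 \<in> lists X" "\<forall>b\<in>set y1. (a, b) \<in> signed_independence I"
  shows "val (y1 @ a # y2) = val (a # y1 @ y2)"
  using assms(2,4)
proof (induction y1)
  case (Cons b y1)
  then have bX: "b \<in> X" "y1 \<in> lists X" by auto
  have "val ((b # y1) @ a # y2) = val [b] \<otimes>\<^bsub>G\<^esub> val (a # y1 @ y2)"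
    using Cons bX assms val_Cons[of b "y1 @ a # y2"] by simp
  also have "\<dots> = val [b] \<otimes>\<^bsub>G\<^esub> (val [a] \<otimes>\<^bsub>G\<^esub> val (y1 @ y2))"
    using bX assms val_Cons[of a "y1 @ y2"] by simp
  also have "\<dots> = val [a] \<otimes>\<^bsub>G\<^esub> (val [b] \<otimes>\<^bsub>G\<^esub> val (y1 @ y2))"
    using val_letters_commute[of a b] val_carrier[of "[a]"] val_carrier[of "[b]"] val_carrier[of "y1 @ y2"] bX assms Cons.prems
    by (simp add: G.m_assoc[symmetric])
  also have "\<dots> = val (a # (b # y1) @ y2)"
    using bX assms val_Cons[of b "y1 @ y2"] val_Cons[of a "b # y1 @ y2"] by simp
  finally show ?case .
qed simp

lemma val_teq: "x \<simeq> y \<Longrightarrow> x \<in> lists X \<Longrightarrow> val x = val y"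
proof (induction x arbitrary: y)
  case (Cons a x)
  obtain y1 y2 where y: "y = y1 @ a # y2" "\<forall>b\<in>set y1. (a, b) \<in> signed_independence I" "x \<simeq> y1 @ y2"
    using teq_Cons_split[OF Cons.prems(1)] by metis
  have yX: "y1 \<in> lists X" "y2 \<in> lists X" "a \<in> X" "x \<in> lists X" using Cons.prems teq_set[OF y(3)] by auto
  have "val (a # x) = val (a # y1 @ y2)"
    using Cons.IH[OF y(3)] yX val_Cons[of a x] val_Cons[of a "y1 @ y2"] by simp
  also have "\<dots> = val y" unfolding y(1) using val_move_front yX y(2) by simp
  finally show ?case .
qed simp

lemma act_lists: "a \<in> X \<Longrightarrow> w \<in> lists X \<Longrightarrow> act a w \<in> lists X"
  using set_act[of a w] by auto

lemma val_act: "a \<in> X \<Longrightarrow> w \<in> lists X \<Longrightarrow> val (act a w) = val (a # w)"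
proof (cases "\<exists>v. w \<simeq> inv_letter a # v")
  case True
  assume a: "a \<in> X" "w \<in> lists X"
  obtain v where v: "w \<simeq> inv_letter a # v" using True by blast
  then have vX: "v \<in> lists X" using a teq_set[OF v] by auto
  have "val (a # w) = val [a] \<otimes>\<^bsub>G\<^esub> (val [inv_letter a] \<otimes>\<^bsub>G\<^esub> val v)"
    using val_Cons[of a w] val_teq[OF v] val_Cons[of "inv_letter a" v] a vX by simp
  also have "\<dots> = val v"
    using val_cancel[of a] val_carrier[of "[a]"] val_carrier[of "[inv_letter a]"] val_carrier[of v] a vX
    by (simp add: G.m_assoc[symmetric])
  also have "\<dots> = val (act a w)" using val_teq[OF act_cancel[OF v]] act_lists a by simp
  finally show ?thesis by simp
qed (simp add: act_add)

lemma normal_form_lists: "w \<in> lists X \<Longrightarrow> normal_form w \<in> lists X"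
  using set_normal_form[of w] by auto

lemma val_normal_form: "w \<in> lists X \<Longrightarrow> val (normal_form w) = val w"
proof (induction w)
  case (Cons a w)
  then show ?case using val_act[of a "normal_form w"] normal_form_lists[of w] val_Cons[of a w] val_Cons[of a "normal_form w"] by (simp add: normal_form_Cons)
qed (simp add: normal_form_def)

lemma cong_geq: "(x, y) \<in> presentation_cong X (graph_group_relations A I) \<Longrightarrow> x \<doteq> y"
proof (induction rule: presentation_cong.induct)
  case (base l r)
  then show ?case
  proof (elim UnE CollectE exE conjE)
    fix p assume "(l, r) = ([p, inv_letter p], [])"
    then show ?thesis using geq_cancel_letter by simp
  next
    fix a b assume "(l, r) = ([(a, True), (b, True)], [(b, True), (a, True)])" "(a, b) \<in> I"
    then show ?thesis using teq_geq[OF swap2[of "(a, True)" "(b, True)" "[]"]] by (simp add: signed_independence_def)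
  qed
qed (auto intro: geq_sym geq_trans geq_append)

lemma val_eq_geq: 
  assumes "x \<in> lists X" "y \<in> lists X"
  shows "val x = val y \<longleftrightarrow> x \<doteq> y"
proof
  assume "val x = val y"
  then show "x \<doteq> y" using val_eq_iff[OF assms] cong_geq by blast
next
  assume "x \<doteq> y"
  then have "normal_form x \<simeq> normal_form y" by (simp add: geq_def normal_form_def)
  then have "val (normal_form x) = val (normal_form y)" using val_teq normal_form_lists assms by blast
  then show "val x = val y" using val_normal_form assms by simp
qed

definition tval :: "'a signed list \<Rightarrow> 'a signed list set" where
  "tval w = presentation_cong X (trace_relations I) `` {w}"

abbreviation "TM \<equiv> trace_monoid A I"

lemma TM_eq: "TM = presented_monoid X (trace_relations I)"
  by (simp add: trace_monoid_def)

lemma tcong_teq: "(x, y) \<in> presentation_cong X (trace_relations I) \<Longrightarrow> x \<simeq> y"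
proof (induction rule: presentation_cong.induct)
  case (base l r)
  then obtain p q where "l = [p, q]" "r = [q, p]" "(p, q) \<in> signed_independence I" by blast
  then show ?case using swap2[of p q "[]"] by simp
qed (auto intro: teq_sym teq_trans teq_append)

lemma tcong_move_front:
  assumes "a \<in> X" "y1 \<in> lists X" "y2 \<in> lists X" "\<forall>b\<in>set y1. (a, b) \<in> signed_independence I"
  shows "(y1 @ a # y2, a # y1 @ y2) \<in> presentation_cong X (trace_relations I)"
  using assms(2,4)
proof (induction y1)
  case Nil
  then show ?case using assms by (auto intro!: presentation_cong.refl)
next
  case (Cons b y1)
  then have bX: "b \<in> X" "y1 \<in> lists X" by auto
  have "([b] @ (y1 @ a # y2), [b] @ (a # y1 @ y2)) \<in> presentation_cong X (trace_relations I)"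
    using Cons bX by (intro presentation_cong.append presentation_cong.refl) auto
  moreover have "([b, a] @ (y1 @ y2), [a, b] @ (y1 @ y2)) \<in> presentation_cong X (trace_relations I)"
  proof (rule presentation_cong.append)
    have "(b, a) \<in> signed_independence I" using Cons.prems ind_sym by auto
    then have "([b, a], [a, b]) \<in> trace_relations I" by blast
    then show "([b, a], [a, b]) \<in> presentation_cong X (trace_relations I)"
      using bX assms by (intro presentation_cong.base) simp_all
    show "(y1 @ y2, y1 @ y2) \<in> presentation_cong X (trace_relations I)"
      using bX assms by (intro presentation_cong.refl) auto
  qed
  ultimately show ?case by (auto intro: presentation_cong.trans)
qed

lemma teq_tcong: "x \<simeq> y \<Longrightarrow> x \<in> lists X \<Longrightarrow> (x, y) \<in> presentation_cong X (trace_relations I)"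
proof (induction x arbitrary: y)
  case Nil
  then show ?case by (auto intro: presentation_cong.refl)
next
  case (Cons a x)
  obtain y1 y2 where y: "y = y1 @ a # y2" "\<forall>b\<in>set y1. (a, b) \<in> signed_independence I" "x \<simeq> y1 @ y2"
    using teq_Cons_split[OF Cons.prems(1)] by metis
  have yX: "y1 \<in> lists X" "y2 \<in> lists X" "a \<in> X" "x \<in> lists X" using Cons.prems teq_set[OF y(3)] by auto
  have "([a] @ x, [a] @ y1 @ y2) \<in> presentation_cong X (trace_relations I)"
    using Cons.IH[OF y(3)] yX by (intro presentation_cong.append presentation_cong.refl) auto
  then show ?case
    using presentation_cong.sym[OF tcong_move_front[OF yX(3,1,2) y(2)]] y(1) by (auto intro: presentation_cong.trans)
qed

lemma tval_iff: "x \<in> lists X \<Longrightarrow> y \<in> tval x \<longleftrightarrow> x \<simeq> y"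
  unfolding tval_def using tcong_teq teq_tcong by auto

lemma carrier_TM: "t \<in> carrier TM \<longleftrightarrow> (\<exists>w\<in>lists X. t = tval w)"
  unfolding TM_eq carrier_presented_monoid tval_def ..

lemma tval_append: "x \<in> lists X \<Longrightarrow> y \<in> lists X \<Longrightarrow> tval x \<otimes>\<^bsub>TM\<^esub> tval y = tval (x @ y)"
  unfolding TM_eq tval_def by (rule mult_presented_monoid)

lemma tval_eq: "x \<in> lists X \<Longrightarrow> y \<in> lists X \<Longrightarrow> tval x = tval y \<longleftrightarrow> x \<simeq> y"
  using tval_iff by (metis subset_antisym subsetI teq_refl teq_sym teq_trans)

lemma trace_of_eq: "w \<in> lists X \<Longrightarrow> trace_of A I w = tval w"
  unfolding trace_of_def
proof (rule the_equality)
  assume w: "w \<in> lists X"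
  then show "tval w \<in> carrier TM \<and> w \<in> tval w" using carrier_TM tval_iff by auto
  fix t assume "t \<in> carrier TM \<and> w \<in> t"
  then obtain v where v: "v \<in> lists X" "t = tval v" "w \<in> tval v" using carrier_TM by blast
  then have "v \<simeq> w" using tval_iff by blast
  then show "t = tval w" using tval_eq[OF v(1) w] v(2) by simp
qed

lemma irreducible_tval:
  assumes w: "w \<in> lists X"
  shows "irreducible_trace A I (tval w) \<longleftrightarrow> reduced w"
proof -
  have "(\<exists>u\<in>carrier TM. \<exists>v\<in>carrier TM. \<exists>p\<in>X. tval w = u \<otimes>\<^bsub>TM\<^esub> trace_of A I [p, inv_letter p] \<otimes>\<^bsub>TM\<^esub> v)
     \<longleftrightarrow> (\<exists>x a z. w \<simeq> x @ [a, inv_letter a] @ z)" (is "?L = ?R")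
  proof
    assume ?L
    then obtain u v p where u: "u \<in> carrier TM" "v \<in> carrier TM" "p \<in> X"
      "tval w = u \<otimes>\<^bsub>TM\<^esub> trace_of A I [p, inv_letter p] \<otimes>\<^bsub>TM\<^esub> v"
      by blast
    then obtain x z where xz: "x \<in> lists X" "z \<in> lists X" "u = tval x" "v = tval z"
      unfolding carrier_TM by blast
    note x = xz(1,2) u(3) u(4)[unfolded xz(3,4)]
    have "tval w = tval (x @ [p, inv_letter p] @ z)"
      using x trace_of_eq[of "[p, inv_letter p]"] tval_append[of x "[p, inv_letter p]"]
        tval_append[of "x @ [p, inv_letter p]" z] by simp
    then have "w \<simeq> x @ [p, inv_letter p] @ z"
      using tval_eq[OF w, of "x @ [p, inv_letter p] @ z"] x by simp
    then show ?R by blast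
  next
    assume ?R
    then obtain x p z where e: "w \<simeq> x @ [p, inv_letter p] @ z" by blast
    then have s: "x \<in> lists X" "z \<in> lists X" "p \<in> X" using teq_set[OF e] w by auto
    then have "tval w = tval x \<otimes>\<^bsub>TM\<^esub> trace_of A I [p, inv_letter p] \<otimes>\<^bsub>TM\<^esub> tval z"
      using trace_of_eq[of "[p, inv_letter p]"] tval_append[of x "[p, inv_letter p]"]
        tval_append[of "x @ [p, inv_letter p]" z] tval_eq[OF w, of "x @ [p, inv_letter p] @ z"] e by simp
    then show ?L using s carrier_TM by blast
  qed
  then show ?thesis
    using w carrier_TM unfolding irreducible_trace_def reduced_iff by blast
qed

text \<open>Reducedness of words corresponds to irreducibility of traces, and reduced words are unique up to trace
  equality. So the norm is the length of any reduced representative.\<close>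

lemma group_norm_word:
  assumes "g \<in> carrier G"
  obtains w where "w \<in> lists X" "g = val w" "reduced w" "length w = group_norm A I g"
proof -
  obtain w0 where w0: "w0 \<in> lists X" "g = val w0" using assms carrier_G by blast
  define w where "w = normal_form w0"
  have w: "w \<in> lists X" "g = val w" "reduced w" using w0 normal_form_lists val_normal_form reduced_normal_form by (auto simp: w_def simp del: in_lists_conv_set)
  have mem: "v \<in> g \<longleftrightarrow> v \<in> lists X \<and> w \<doteq> v" for v
  proof -
    have "v \<in> g \<longleftrightarrow> (w, v) \<in> presentation_cong X (graph_group_relations A I)" unfolding w(2) val_def by simp
    then show ?thesis using val_eq_iff[OF w(1), of v] val_eq_geq[OF w(1), of v] presentation_cong_lists by blast
  qed
  have "(THE t. irreducible_trace A I t \<and> t \<subseteq> g) = tval w"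
  proof (rule the_equality)
    have "v \<in> g" if "v \<in> tval w" for v
    proof -
      have "w \<simeq> v" using that tval_iff[OF w(1)] by simp
      then show ?thesis using mem teq_geq teq_set[of w v] w(1) by auto
    qed
    then show "irreducible_trace A I (tval w) \<and> tval w \<subseteq> g" using irreducible_tval w by blast
    fix t assume t: "irreducible_trace A I t \<and> t \<subseteq> g"
    then obtain w' where w': "w' \<in> lists X" "t = tval w'" unfolding irreducible_trace_def carrier_TM by blast
    then have "reduced w'" using irreducible_tval t by blast
    moreover have "w' \<in> g" using t w' tval_iff[OF w'(1), of w'] by auto
    ultimately have "w \<simeq> w'" using reduced_geq_teq[OF w(3)] mem by blast
    then show "t = tval w" using tval_eq[OF w(1) w'(1)] w'(2) by simp
  qed
  moreover have "trace_length (tval w) = length w"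
    unfolding trace_length_def
  proof (rule the_equality)
    show "\<exists>v\<in>tval w. length v = length w" using tval_iff[OF w(1)] by blast
    show "m = length w" if "\<exists>v\<in>tval w. length v = m" for m
      using that tval_iff[OF w(1)] teq_length by metis
  qed
  ultimately have "group_norm A I g = length w" by (simp add: group_norm_def)
  then show ?thesis using that w by simp
qed

lemma wpow_lists: "w \<in> lists X \<Longrightarrow> wpow k w \<in> lists X"
  by (auto simp: set_wpow split: if_splits)

lemma val_wpow: "w \<in> lists X \<Longrightarrow> val (wpow k w) = val w [^]\<^bsub>G\<^esub> k"
proof (induction k)
  case 0
  then show ?case by (simp add: val_Nil)
next
  case (Suc k)
  then show ?case using val_append[of "wpow k w" w] wpow_lists[of w k] by (simp add: wpow_Suc_right del: wpow_simps(2))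
qed

end

section \<open>Exponent equations as products of blocks\<close>

text \<open>A block is a word together with an optional index: it stands for the power of the word with the
  exponent of that index, and for the word itself if there is none.\<close>

definition block_exponent :: "(nat \<Rightarrow> nat) \<Rightarrow> nat option \<Rightarrow> nat" where
  "block_exponent y b = (case b of None \<Rightarrow> 1 | Some i \<Rightarrow> y i)"

lemma block_exponent_simps [simp]: "block_exponent y None = 1" "block_exponent y (Some i) = y i"
  by (simp_all add: block_exponent_def)

definition block_word :: "(nat \<Rightarrow> nat) \<Rightarrow> ('b list \<times> nat option) list \<Rightarrow> 'b list" where
  "block_word y bs = concat (map (\<lambda>b. wpow (block_exponent y (snd b)) (fst b)) bs)"

lemma block_word_append: "block_word y (as @ bs) = block_word y as @ block_word y bs"
  by (simp add: block_word_def)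

lemma block_word_letters: "block_word y (map (\<lambda>a. ([a], None)) w) = w"
  by (induction w) (simp_all add: block_word_def)

lemma block_word_powers: "block_word y (map (\<lambda>w. (w, Some i)) ws) = concat (map (wpow (y i)) ws)"
  by (simp add: block_word_def o_def)

definition count_powers :: "('b list \<times> nat option) list \<Rightarrow> nat" where
  "count_powers bs = length (filter (\<lambda>b. snd b \<noteq> None) bs)"

lemma count_powers_append: "count_powers (as @ bs) = count_powers as + count_powers bs"
  by (simp add: count_powers_def)

lemma count_powers_letters: "count_powers (map (\<lambda>a. ([a], None)) w) = 0"
  by (simp add: count_powers_def)

context graph_group_alphabet
begin

text \<open>What \<open>pumpable_product\<close> needs of the base of a block. Single letters qualify, so constants are cut
  into letters.\<close>

definition admissible_block :: "nat \<Rightarrow> 'a signed list \<Rightarrow> bool" where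
  "admissible_block l w \<longleftrightarrow> w \<in> lists X \<and> connectedw w \<and> length w \<le> l \<and> (\<forall>k. reduced (wpow k w))"

lemma admissible_block_single: "a \<in> X \<Longrightarrow> 1 \<le> l \<Longrightarrow> admissible_block l [a]"
  by (simp add: admissible_block_def connectedw_single reduced_replicate)

lemma finite_A: "finite A"
  using indep by (simp add: independence_alphabet_def)

lemma card_letters: "set w \<subseteq> X \<Longrightarrow> card (set w) \<le> 2 * card A"
proof -
  assume "set w \<subseteq> X"
  then have "card (set w) \<le> card (A \<times> (UNIV :: bool set))"
    using finite_A by (intro card_mono) (auto simp: signed_letters_def)
  then show ?thesis by (simp add: card_cartesian_product)
qed

lemma block_word_lists: "(\<And>b. b \<in> set bs \<Longrightarrow> fst b \<in> lists X) \<Longrightarrow> block_word y bs \<in> lists X"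
proof (induction bs)
  case (Cons b bs)
  have "fst b \<in> lists X" "block_word y bs \<in> lists X" using Cons by auto
  moreover have "block_word y (b # bs) = wpow (block_exponent y (snd b)) (fst b) @ block_word y bs" by (simp add: block_word_def)
  ultimately show ?case using wpow_lists by (simp only: append_in_lists_conv)
qed (simp add: block_word_def)

text \<open>A power of \<open>g\<close> is written as \<open>p @ w\<^sup>x @ winv p\<close> with \<open>w\<close> cyclically reduced, and \<open>w\<close> is split into its
  connected components. Components have disjoint sets of letters, so their number is bounded by the number of signed letters,
  independently of the length of \<open>g\<close>.\<close>

lemma power_blocks:
  assumes g: "g \<in> carrier G" "group_norm A I g \<le> l" and l: "1 \<le> l"
  shows "\<exists>bs. (\<forall>b\<in>set bs. admissible_block l (fst b) \<and> (snd b = None \<or> snd b = Some i)) \<and>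
    count_powers bs \<le> 2 * card A \<and> length bs \<le> 2 * card A + l \<and> (\<forall>y. val (block_word y bs) = g [^]\<^bsub>G\<^esub> y i)"
proof -
  obtain w where w: "w \<in> lists X" "g = val w" "reduced w" "length w \<le> l"
    using group_norm_word[OF g(1)] g(2) by metis
  obtain p w' where p: "w \<simeq> p @ w' @ winv p" "\<forall>k. reduced (wpow k w')"
    using cyclic_reduction[OF w(3)] by blast
  have sX: "p \<in> lists X" "w' \<in> lists X" using teq_set[OF p(1)] w(1) by auto
  have len: "2 * length p + length w' \<le> l" using teq_length[OF p(1)] w(4) by simp
  obtain ws where ws: "length ws \<le> card (set w')"
    "\<forall>x\<in>set ws. connectedw x \<and> set x \<subseteq> set w' \<and> length x \<le> length w' \<and> (\<forall>k. reduced (wpow k w') \<longrightarrow> reduced (wpow k x))"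
    "\<forall>k. wpow k w' \<simeq> concat (map (wpow k) ws)"
    using connected_components by blast
  define bs where "bs = map (\<lambda>a. ([a], None)) p @ map (\<lambda>w. (w, Some i)) ws @ map (\<lambda>a. ([a], None)) (winv p)"
  have lw: "length ws \<le> 2 * card A" 
  proof -
    have "set w' \<subseteq> X" using sX(2) by auto
    then show ?thesis using ws(1) card_letters[of w'] by linarith
  qed
  have blk: "\<forall>b\<in>set bs. admissible_block l (fst b) \<and> (snd b = None \<or> snd b = Some i)"
  proof
    fix b assume "b \<in> set bs"
    then consider a where "a \<in> set p \<or> a \<in> set (winv p)" "b = ([a], None)" | x where "x \<in> set ws" "b = (x, Some i)"
      by (auto simp: bs_def)
    then show "admissible_block l (fst b) \<and> (snd b = None \<or> snd b = Some i)"
    proof cases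
      case 1
      then have "a \<in> X" using sX(1) by auto
      then show ?thesis using 1(2) admissible_block_single[OF _ l] by simp
    next
      case 2
      have "set x \<subseteq> X" using ws(2) 2(1) sX(2) by auto
      then show ?thesis using 2 ws(2) p(2) len by (fastforce simp: admissible_block_def)
    qed
  qed
  have "count_powers bs = length ws" by (simp add: bs_def count_powers_append count_powers_letters) (simp add: count_powers_def)
  then have pw: "count_powers bs \<le> 2 * card A" using lw by simp
  have lb: "length bs \<le> 2 * card A + l" using lw len by (simp add: bs_def)
  have "val (block_word y bs) = g [^]\<^bsub>G\<^esub> y i" for y
  proof -
    have "block_word y bs = p @ concat (map (wpow (y i)) ws) @ winv p"
      by (simp add: bs_def block_word_append block_word_letters block_word_powers)
    also have "\<dots> \<doteq> p @ wpow (y i) w' @ winv p"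
      by (rule geq_append[OF geq_refl geq_append[OF teq_geq[OF teq_sym[OF ws(3)[rule_format]]] geq_refl]])
    also have "\<dots> \<doteq> wpow (y i) (p @ w' @ winv p)" by (rule geq_sym[OF geq_rep_conj])
    also have "\<dots> \<doteq> wpow (y i) w" by (rule geq_wpow[OF teq_geq[OF teq_sym[OF p(1)]]])
    finally have "block_word y bs \<doteq> wpow (y i) w" .
    moreover have "block_word y bs \<in> lists X" using blk by (intro block_word_lists) (auto simp: admissible_block_def)
    ultimately have "val (block_word y bs) = val (wpow (y i) w)" 
      using val_eq_geq[OF _ wpow_lists[OF w(1)]] by (simp del: in_lists_conv_set)
    then show ?thesis using val_wpow[OF w(1)] w(2) by simp
  qed
  then show ?thesis using blk pw lb by blast
qed

lemma constant_blocks: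
  assumes g: "g \<in> carrier G" "group_norm A I g \<le> l" and l: "1 \<le> l"
  shows "\<exists>bs. (\<forall>b\<in>set bs. admissible_block l (fst b) \<and> snd b = None) \<and>
    count_powers bs = 0 \<and> length bs \<le> l \<and> (\<forall>y. val (block_word y bs) = g)"
proof -
  obtain w where w: "w \<in> lists X" "g = val w" "length w \<le> l"
    using group_norm_word[OF g(1)] g(2) by metis
  show ?thesis
  proof (intro exI[of _ "map (\<lambda>a. ([a], None)) w"] conjI)
    show "\<forall>b\<in>set (map (\<lambda>a. ([a], None)) w). admissible_block l (fst b) \<and> snd b = None"
      using w(1) admissible_block_single[OF _ l] by auto
  qed (use w in \<open>simp_all add: count_powers_letters block_word_letters\<close>)
qed

lemma equation_blocks:
  assumes "\<And>i. i \<in> {1..n} \<Longrightarrow> u i \<in> carrier G \<and> group_norm A I (u i) \<le> l"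
    and "\<And>i. i \<in> {0..n} \<Longrightarrow> v i \<in> carrier G \<and> group_norm A I (v i) \<le> l"
    and l: "1 \<le> l"
  shows "\<exists>bs. (\<forall>b\<in>set bs. admissible_block l (fst b) \<and> (\<forall>i. snd b = Some i \<longrightarrow> i \<in> {1..n})) \<and>
    count_powers bs \<le> 2 * card A * n \<and> length bs \<le> 2 * card A * n + l * (2 * n + 1) \<and>
    (\<forall>y. val (block_word y bs) = exponent_product G u v y n)"
  using assms(1,2)
proof (induction n)
  case 0
  then obtain bs where "\<forall>b\<in>set bs. admissible_block l (fst b) \<and> snd b = None"
    "count_powers bs = 0" "length bs \<le> l" "\<forall>y. val (block_word y bs) = v 0"
    using constant_blocks[of "v 0" l] l by auto
  then show ?case by (intro exI[of _ bs]) auto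
next
  case (Suc n)
  obtain as where as: "\<forall>b\<in>set as. admissible_block l (fst b) \<and> (\<forall>i. snd b = Some i \<longrightarrow> i \<in> {1..n})"
    "count_powers as \<le> 2 * card A * n" "length as \<le> 2 * card A * n + l * (2 * n + 1)"
    "\<forall>y. val (block_word y as) = exponent_product G u v y n"
    using Suc.IH Suc.prems by auto
  obtain bs where bs: "\<forall>b\<in>set bs. admissible_block l (fst b) \<and> (snd b = None \<or> snd b = Some (Suc n))"
    "count_powers bs \<le> 2 * card A" "length bs \<le> 2 * card A + l" "\<forall>y. val (block_word y bs) = u (Suc n) [^]\<^bsub>G\<^esub> y (Suc n)"
    using power_blocks[of "u (Suc n)" l "Suc n"] Suc.prems(1)[of "Suc n"] l by auto
  obtain cs where cs: "\<forall>b\<in>set cs. admissible_block l (fst b) \<and> snd b = None"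
    "count_powers cs = 0" "length cs \<le> l" "\<forall>y. val (block_word y cs) = v (Suc n)"
    using constant_blocks[of "v (Suc n)" l] Suc.prems(2)[of "Suc n"] l by auto
  have evl: "block_word y as \<in> lists X" "block_word y bs \<in> lists X" "block_word y cs \<in> lists X" for y
    using as(1) bs(1) cs(1) by (auto intro!: block_word_lists simp: admissible_block_def simp del: in_lists_conv_set)
  show ?case
  proof (intro exI[of _ "as @ bs @ cs"] conjI ballI allI)
    fix b assume b: "b \<in> set (as @ bs @ cs)"
    then show "admissible_block l (fst b)" using as bs cs by auto
    show "snd b = Some i \<longrightarrow> i \<in> {1..Suc n}" for i using b as bs cs by fastforce
  next
    show "count_powers (as @ bs @ cs) \<le> 2 * card A * Suc n" using as bs cs by (simp add: count_powers_append)
    show "length (as @ bs @ cs) \<le> 2 * card A * Suc n + l * (2 * Suc n + 1)" using as bs cs by simp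
    fix y
    have "val (block_word y (as @ bs @ cs)) = val (block_word y as) \<otimes>\<^bsub>G\<^esub> (val (block_word y bs) \<otimes>\<^bsub>G\<^esub> val (block_word y cs))"
      using evl[of y] val_append[of "block_word y as" "block_word y bs @ block_word y cs"] val_append[of "block_word y bs" "block_word y cs"]
      by (simp add: block_word_append)
    also have "\<dots> = val (block_word y as) \<otimes>\<^bsub>G\<^esub> val (block_word y bs) \<otimes>\<^bsub>G\<^esub> val (block_word y cs)"
      using evl[of y] by (simp add: G.m_assoc val_carrier)
    finally show "val (block_word y (as @ bs @ cs)) = exponent_product G u v y (Suc n)"
      using as(4) bs(4) cs(4) by simp
  qed
qed

end

section \<open>Bounded cones of solutions\<close>

text \<open>Here \<open>m\<close> bounds the number of blocks. Only the at most \<open>c * n\<close> blocks with a variable exponent give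
  a row of the linear system, and the base is the bound of \<open>small_kernel_vector\<close> for its entries.\<close>

definition solution_bound :: "nat \<Rightarrow> nat \<Rightarrow> nat \<Rightarrow> nat" where
  "solution_bound c n l = (let m = c * n + l * (2 * n + 1) in
     (2 * (m * pump_const c l + 1 + (1 + m * l)) + 1) ^ (c * n))"

context graph_group_alphabet
begin

text \<open>The tuple of block exponents is pumped by \<open>pumpable_product\<close>. Within the resulting family, the tuples
  that come from an assignment to the variables are the solutions of a linear system whose unknowns are
  the values of the variables (\<open>Inl\<close>) and the multiplicities of the pumps (\<open>Inr\<close>), with one row for each
  power block. A decomposition of the given solution of this system projects to a cone.\<close>

theorem solutions_bounded_cones:
  assumes eqn: "exponent_equation G n k x u v" and norm: "max_norm A I n u v \<le> l" and l: "1 \<le> l"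
    and s: "s \<in> solutions G n k x u v"
  defines "T \<equiv> solution_bound (2 * card A) n l"
  shows "\<exists>a F. a \<in> {f \<in> nat_vectors k. \<forall>i. f i \<le> T} \<and> F \<subseteq> {f \<in> nat_vectors k. \<forall>i. f i \<le> T} \<and>
     s \<in> cone a F \<and> cone a F \<subseteq> solutions G n k x u v"
proof -
  define c where "c = 2 * card A"
  have nu: "group_norm A I (u i) \<le> l" if "i \<in> {1..n}" for i
    using norm that unfolding max_norm_def by (subst (asm) Max_le_iff) auto
  have nv: "group_norm A I (v i) \<le> l" if "i \<in> {0..n}" for i
    using norm that unfolding max_norm_def by (subst (asm) Max_le_iff) auto
  have car: "u i \<in> carrier G" if "i \<in> {1..n}" for i using eqn that by (auto simp: exponent_equation_def)
  have carv: "v i \<in> carrier G" if "i \<in> {0..n}" for i using eqn that by (auto simp: exponent_equation_def)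
  have xk: "x i < k" if "i \<in> {1..n}" for i using eqn that by (auto simp: exponent_equation_def)
  obtain bs where bs: "\<forall>b\<in>set bs. admissible_block l (fst b) \<and> (\<forall>i. snd b = Some i \<longrightarrow> i \<in> {1..n})"
    "count_powers bs \<le> 2 * card A * n" "length bs \<le> 2 * card A * n + l * (2 * n + 1)"
    "\<forall>y. val (block_word y bs) = exponent_product G u v y n"
    using equation_blocks[of n u l v] nu nv car carv l by blast
  define m where "m = length bs"
  define U where "U P = fst (bs ! P)" for P
  define var where "var P = snd (bs ! P)" for P
  have blk: "admissible_block l (U P)" if "P < m" for P
    using bs(1) nth_mem[of P bs] that unfolding U_def m_def by blast
  have var: "i \<in> {1..n}" if "P < m" "var P = Some i" for P i
    using bs(1) nth_mem[of P bs] that unfolding var_def m_def by blast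
  have block_word_eq: "block_word y bs = concat (map (\<lambda>P. wpow (block_exponent y (var P)) (U P)) [0..<m])" for y
  proof -
    have "block_word y bs = concat (map (\<lambda>b. wpow (block_exponent y (snd b)) (fst b)) (map ((!) bs) [0..<length bs]))"
      by (simp add: block_word_def map_nth)
    then show ?thesis by (simp add: U_def var_def m_def o_def)
  qed
  have evl: "block_word y bs \<in> lists X" for y using bs(1) by (intro block_word_lists) (auto simp: admissible_block_def)
  have sol_iff: "t \<in> solutions G n k x u v \<longleftrightarrow> t \<in> nat_vectors k \<and>
      concat (map (\<lambda>P. wpow (block_exponent (\<lambda>i. t (x i)) (var P)) (U P)) [0..<m]) \<doteq> []" for t
  proof -
    have "exponent_product G u v (\<lambda>i. t (x i)) n = \<one>\<^bsub>G\<^esub> \<longleftrightarrow> val (block_word (\<lambda>i. t (x i)) bs) = val []"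
      using bs(4) val_Nil by simp
    also have "\<dots> \<longleftrightarrow> block_word (\<lambda>i. t (x i)) bs \<doteq> []" using val_eq_geq[OF evl] by simp
    finally show ?thesis unfolding solutions_def block_word_eq by simp
  qed
  define y where "y P = block_exponent (\<lambda>i. s (x i)) (var P)" for P
  have sv: "s \<in> nat_vectors k" and triv: "concat (map (\<lambda>P. wpow (y P) (U P)) [0..<m]) \<doteq> []"
    using s sol_iff[of s] unfolding y_def by auto
  obtain b f z where pump:
    "\<And>P. P < m \<Longrightarrow> y P = b P + (\<Sum>Q\<in>{..<m} - {P}. z (min P Q) (max P Q) * f P Q)"
    "\<And>P. P < m \<Longrightarrow> b P \<le> m * pump_const c l"
    "\<And>P Q. P < m \<Longrightarrow> Q < m \<Longrightarrow> P \<noteq> Q \<Longrightarrow> f P Q \<le> l"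
    "\<And>P Q. P < m \<Longrightarrow> Q < m \<Longrightarrow> P \<noteq> Q \<Longrightarrow> y P \<le> 1 \<Longrightarrow> f P Q = 0"
    "\<And>z'. concat (map (\<lambda>P. wpow (b P + (\<Sum>Q\<in>{..<m} - {P}. z' (min P Q) (max P Q) * f P Q)) (U P)) [0..<m]) \<doteq> []"
  proof -
    have blkD: "connectedw (U P)" "card (set (U P)) \<le> c" "length (U P) \<le> l" "reduced (wpow k' (U P))" if "P < m" for P k'
      using blk[OF that] card_letters[of "U P"] by (auto simp: admissible_block_def c_def)
    show ?thesis
      by (rule pumpable_product[OF blkD triv]) (assumption | rule that)+
  qed
  define R where "R = {P. P < m \<and> var P \<noteq> None}"
  define J where "J = {..<k} <+> ({..<m} \<times> {..<m})"
  \<comment> \<open>the row of \<open>P\<close> says: value of the variable of \<open>P\<close> minus the contributions of the pumps equals \<open>b P\<close>\<close>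
  define B :: "nat \<Rightarrow> nat + nat \<times> nat \<Rightarrow> int" where
    "B P j = (case j of Inl i \<Rightarrow> if x (the (var P)) = i then 1 else 0
       | Inr e \<Rightarrow> - (\<Sum>Q\<in>{..<m} - {P}. if e = (min P Q, max P Q) then int (f P Q) else 0))" for P j
  \<comment> \<open>the given solution together with the multiplicities of its pumps\<close>
  define w :: "nat + nat \<times> nat \<Rightarrow> nat" where
    "w j = (case j of Inl i \<Rightarrow> s i | Inr e \<Rightarrow> z (fst e) (snd e))" for j
  have finJ: "finite J" and finR: "finite R" by (auto simp: J_def R_def)
  have cardR: "card R \<le> c * n"
  proof -
    have "count_powers bs = card R"
      unfolding count_powers_def length_filter_conv_card R_def var_def m_def ..
    then show ?thesis using bs(2) by (simp add: c_def)
  qed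
  have Brow: "(\<Sum>j\<in>J. B P j * int (t j)) = int (t (Inl (x i))) - (\<Sum>Q\<in>{..<m} - {P}. int (t (Inr (min P Q, max P Q)) * f P Q))"
    if P: "P < m" "var P = Some i" for P i t
  proof -
    have "(\<Sum>j\<in>J. B P j * int (t j)) = (\<Sum>i'<k. B P (Inl i') * int (t (Inl i'))) + (\<Sum>e\<in>{..<m} \<times> {..<m}. B P (Inr e) * int (t (Inr e)))"
      unfolding J_def by (subst sum.Plus) auto
    also have "(\<Sum>i'<k. B P (Inl i') * int (t (Inl i'))) = (\<Sum>i'<k. if x i = i' then int (t (Inl i')) else 0)"
      using P(2) by (intro sum.cong) (auto simp: B_def)
    also have "\<dots> = int (t (Inl (x i)))" using xk[OF var[OF P]] by simp
    also have "(\<Sum>e\<in>{..<m} \<times> {..<m}. B P (Inr e) * int (t (Inr e)))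
       = - (\<Sum>e\<in>{..<m} \<times> {..<m}. \<Sum>Q\<in>{..<m} - {P}. if e = (min P Q, max P Q) then int (t (Inr e) * f P Q) else 0)"
      unfolding B_def sum_negf[symmetric] sum.case sum_distrib_right
      by (intro sum.cong[OF HOL.refl]) (auto simp: mult.commute)
    also have "\<dots> = - (\<Sum>Q\<in>{..<m} - {P}. \<Sum>e\<in>{..<m} \<times> {..<m}. if e = (min P Q, max P Q) then int (t (Inr e) * f P Q) else 0)"
      by (subst sum.swap) simp
    also have "\<dots> = - (\<Sum>Q\<in>{..<m} - {P}. int (t (Inr (min P Q, max P Q)) * f P Q))"
      using P(1) by (intro arg_cong[where f=uminus] sum.cong[OF HOL.refl]) (subst sum.delta, auto)
    finally show ?thesis by simp
  qed
  have Babs: "(\<Sum>j\<in>J. \<bar>B P j\<bar>) \<le> int (1 + m * l)" if PR: "P \<in> R" for P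
  proof -
    obtain i where P: "P < m" "var P = Some i" using PR by (auto simp: R_def)
    have "(\<Sum>j\<in>J. \<bar>B P j\<bar>) = (\<Sum>i'<k. \<bar>B P (Inl i')\<bar>) + (\<Sum>e\<in>{..<m} \<times> {..<m}. \<bar>B P (Inr e)\<bar>)"
      unfolding J_def by (subst sum.Plus) auto
    also have "(\<Sum>i'<k. \<bar>B P (Inl i')\<bar>) = (\<Sum>i'<k. if x i = i' then 1 else 0)"
      using P(2) by (intro sum.cong) (auto simp: B_def)
    also have "\<dots> = 1" using xk[OF var[OF P]] by simp
    also have "(\<Sum>e\<in>{..<m} \<times> {..<m}. \<bar>B P (Inr e)\<bar>)
       \<le> (\<Sum>e\<in>{..<m} \<times> {..<m}. \<Sum>Q\<in>{..<m} - {P}. if e = (min P Q, max P Q) then int (f P Q) else 0)"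
      unfolding B_def by (intro sum_mono) (simp add: sum_nonneg)
    also have "\<dots> = (\<Sum>Q\<in>{..<m} - {P}. \<Sum>e\<in>{..<m} \<times> {..<m}. if e = (min P Q, max P Q) then int (f P Q) else 0)"
      by (rule sum.swap)
    also have "\<dots> = (\<Sum>Q\<in>{..<m} - {P}. int (f P Q))"
      using P(1) by (intro sum.cong[OF HOL.refl]) (subst sum.delta, auto)
    also have "\<dots> \<le> (\<Sum>Q\<in>{..<m} - {P}. int l)" using pump(3) P(1) by (intro sum_mono) auto
    also have "\<dots> \<le> int (m * l)" using card_mono[of "{..<m}" "{..<m} - {P}"] by (simp add: mult_right_mono)
    finally show ?thesis by simp
  qed
  have Bw: "(\<Sum>j\<in>J. B P j * int (w j)) = int (b P)" if PR: "P \<in> R" for P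
  proof -
    obtain i where P: "P < m" "var P = Some i" using PR by (auto simp: R_def)
    have "int (s (x i)) = int (b P) + (\<Sum>Q\<in>{..<m} - {P}. int (z (min P Q) (max P Q) * f P Q))"
      using arg_cong[OF pump(1)[OF P(1)], of int] P(2) by (simp add: y_def)
    then show ?thesis unfolding Brow[OF P] by (simp add: w_def)
  qed
  define \<beta> where "\<beta> = m * pump_const c l + 1"
  define \<rho> where "\<rho> = 1 + m * l"
  have rhs: "\<bar>\<Sum>j\<in>J. B P j * int (w j)\<bar> \<le> int \<beta>" if "P \<in> R" for P
  proof -
    have "b P \<le> \<beta>" using pump(2)[of P] that unfolding \<beta>_def R_def by fastforce
    then show ?thesis using Bw[OF that] by simp
  qed
  have bound: "(2 * (\<beta> + \<rho>) + 1) ^ card R \<le> T"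
  proof -
    define m' where "m' = c * n + l * (2 * n + 1)"
    have mm: "m \<le> m'" using bs(3) unfolding m'_def m_def c_def by simp
    have "(2 * (\<beta> + \<rho>) + 1) ^ card R \<le> (2 * (\<beta> + \<rho>) + 1) ^ (c * n)"
      using cardR by (intro power_increasing) auto
    also have "\<dots> \<le> (2 * (m' * pump_const c l + 1 + (1 + m' * l)) + 1) ^ (c * n)"
      unfolding \<beta>_def \<rho>_def using mm by (intro power_mono add_mono mult_le_mono order_refl) auto
    also have "\<dots> = T" unfolding T_def solution_bound_def c_def m'_def Let_def ..
    finally show ?thesis .
  qed
  obtain w0 hs where dec: "\<forall>j\<in>J. w0 j \<le> (2 * (\<beta> + \<rho>) + 1) ^ card R"
    "\<forall>h\<in>set hs. (\<forall>j\<in>J. h j \<le> (2 * (\<beta> + \<rho>) + 1) ^ card R) \<and> (\<forall>r\<in>R. (\<Sum>j\<in>J. B r j * int (h j)) = 0)"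
    "\<forall>j\<in>J. w j = w0 j + (\<Sum>h\<leftarrow>hs. h j)"
    "\<forall>r\<in>R. (\<Sum>j\<in>J. B r j * int (w0 j)) = (\<Sum>j\<in>J. B r j * int (w j))"
    using solution_decomposition[where B=B and R=R and x=w, OF finJ finR Babs[folded \<rho>_def] rhs] by blast
  define \<pi> :: "(nat + nat \<times> nat \<Rightarrow> nat) \<Rightarrow> nat \<Rightarrow> nat" where "\<pi> h j = (if j < k then h (Inl j) else 0)" for h j
  have InlJ: "Inl j \<in> J" if "j < k" for j using that unfolding J_def by (intro InlI) simp
  have \<pi>box: "\<pi> h \<in> {f \<in> nat_vectors k. \<forall>i. f i \<le> T}" if "\<forall>j\<in>J. h j \<le> (2 * (\<beta> + \<rho>) + 1) ^ card R" for h
    using that InlJ bound by (fastforce simp: \<pi>_def nat_vectors_def intro: order_trans)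
  show ?thesis
  proof (intro exI[of _ "\<pi> w0"] exI[of _ "\<pi> ` set hs"] conjI)
    show "\<pi> w0 \<in> {f \<in> nat_vectors k. \<forall>i. f i \<le> T}" using dec(1) by (rule \<pi>box)
    show "\<pi> ` set hs \<subseteq> {f \<in> nat_vectors k. \<forall>i. f i \<le> T}" using dec(2) \<pi>box by blast
    have "s i = \<pi> w0 i + (\<Sum>h\<leftarrow>map \<pi> hs. h i)" for i
    proof (cases "i < k")
      case True
      then have "w (Inl i) = w0 (Inl i) + (\<Sum>h\<leftarrow>hs. h (Inl i))" using dec(3) InlJ by blast
      then show ?thesis using True by (simp add: \<pi>_def w_def o_def)
    next
      case False
      then show ?thesis using sv by (simp add: \<pi>_def nat_vectors_def o_def)
    qed
    then show "s \<in> cone (\<pi> w0) (\<pi> ` set hs)"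
      unfolding cone_def by (intro CollectI exI[of _ "map \<pi> hs"]) auto
    show "cone (\<pi> w0) (\<pi> ` set hs) \<subseteq> solutions G n k x u v"
    proof
      fix t assume "t \<in> cone (\<pi> w0) (\<pi> ` set hs)"
      then obtain ts where ts: "set ts \<subseteq> \<pi> ` set hs" "t = (\<lambda>i. \<pi> w0 i + (\<Sum>h\<leftarrow>ts. h i))"
        unfolding cone_def by blast
      then have "ts \<in> map \<pi> ` lists (set hs)"
        unfolding lists_image[symmetric] by auto
      then obtain hs' where hs': "set hs' \<subseteq> set hs" "ts = map \<pi> hs'" by auto
      define w' where "w' j = w0 j + (\<Sum>h\<leftarrow>hs'. h j)" for j
      have t: "t i = w' (Inl i)" if "i < k" for i
        using that unfolding ts(2) hs'(2) w'_def by (simp add: \<pi>_def o_def)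
      have tv: "t \<in> nat_vectors k"
        unfolding ts(2) hs'(2) by (simp add: \<pi>_def nat_vectors_def o_def)
      have ker: "(\<Sum>j\<in>J. B P j * int (\<Sum>h\<leftarrow>hs'. h j)) = 0" if "P \<in> R" for P
        using hs'(1)
      proof (induction hs')
        case (Cons h hs')
        have "(\<Sum>j\<in>J. B P j * int (h j)) = 0" using Cons.prems dec(2) that by simp
        then show ?case using Cons by (simp add: algebra_simps sum.distrib)
      qed simp
      have Bw': "(\<Sum>j\<in>J. B P j * int (w' j)) = int (b P)" if "P \<in> R" for P
      proof -
        have "(\<Sum>j\<in>J. B P j * int (w' j)) = (\<Sum>j\<in>J. B P j * int (w0 j)) + (\<Sum>j\<in>J. B P j * int (\<Sum>h\<leftarrow>hs'. h j))"
          unfolding w'_def of_nat_add distrib_left sum.distrib ..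
        then show ?thesis using ker[OF that] dec(4) Bw[OF that] that by simp
      qed
      define z' where "z' P Q = w' (Inr (P, Q))" for P Q
      have exponents: "block_exponent (\<lambda>i. t (x i)) (var P) = b P + (\<Sum>Q\<in>{..<m} - {P}. z' (min P Q) (max P Q) * f P Q)" if P: "P < m" for P
      proof (cases "var P")
        case None
        then have y1: "y P = 1" by (simp add: y_def)
        then have "f P Q = 0" if "Q \<in> {..<m} - {P}" for Q using pump(4)[OF P, of Q] that by auto
        then have zero: "(\<Sum>Q\<in>{..<m} - {P}. h (min P Q) (max P Q) * f P Q) = 0" for h :: "nat \<Rightarrow> nat \<Rightarrow> nat"
          by (intro sum.neutral) auto
        show ?thesis using pump(1)[OF P] y1 unfolding None block_exponent_simps zero by simp
      next
        case (Some i)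
        then have "P \<in> R" using P by (simp add: R_def)
        then have "int (w' (Inl (x i))) - (\<Sum>Q\<in>{..<m} - {P}. int (w' (Inr (min P Q, max P Q)) * f P Q)) = int (b P)"
          using Bw' Brow[OF P Some, of w'] by simp
        then have "int (w' (Inl (x i))) = int (b P + (\<Sum>Q\<in>{..<m} - {P}. z' (min P Q) (max P Q) * f P Q))"
          by (simp add: z'_def)
        then have "w' (Inl (x i)) = b P + (\<Sum>Q\<in>{..<m} - {P}. z' (min P Q) (max P Q) * f P Q)"
          by (simp only: of_nat_eq_iff)
        then show ?thesis using Some t[OF xk[OF var[OF P Some]]] by simp
      qed
      have same: "map (\<lambda>P. wpow (block_exponent (\<lambda>i. t (x i)) (var P)) (U P)) [0..<m]
         = map (\<lambda>P. wpow (b P + (\<Sum>Q\<in>{..<m} - {P}. z' (min P Q) (max P Q) * f P Q)) (U P)) [0..<m]"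
        using exponents by (intro map_cong) auto
      have "concat (map (\<lambda>P. wpow (block_exponent (\<lambda>i. t (x i)) (var P)) (U P)) [0..<m]) \<doteq> []"
        unfolding same by (rule pump(5))
      then show "t \<in> solutions G n k x u v" using sol_iff tv by blast
    qed
  qed
qed

end

section \<open>Comparison of the bounds\<close>

text \<open>Makes room for polynomial factors in \<open>n\<close>: they are absorbed by \<open>2 ^ (n * n)\<close> and a constant to
  the power \<open>n\<close>.\<close>

lemma power_le_two_power:
  assumes "1 \<le> (d::nat)"
  shows "n ^ d \<le> d ^ d * 2 ^ n"
proof -
  have "n div d + 1 \<le> 2 ^ (n div d)" by (metis Suc_eq_plus1 Suc_leI less_exp)
  moreover have "n \<le> d * (n div d + 1)"
    using dividend_less_times_div[of d n] assms by simp
  ultimately have "n \<le> d * 2 ^ (n div d)" by (meson le_trans mult_le_mono2)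
  then have "n ^ d \<le> (d * 2 ^ (n div d)) ^ d" by (rule power_mono) simp
  also have "\<dots> = d ^ d * 2 ^ ((n div d) * d)" by (simp add: power_mult_distrib power_mult)
  also have "\<dots> \<le> d ^ d * 2 ^ n" by (intro mult_le_mono2 power_increasing) simp_all
  finally show ?thesis .
qed

text \<open>The base of the bound is at most a constant times \<open>n * l ^ 4\<close>. The factor \<open>n\<close> is removed by
  \<open>power_le_two_power\<close>.\<close>

lemma solution_bound_le:
  assumes c: "1 \<le> c" and n: "1 \<le> n" and l: "1 \<le> l"
  shows "solution_bound c n l \<le> ((2 * (c + 3) * (8 * c + 3) + 2 * (c + 3) + 5) ^ c * c ^ c) ^ n * 2 ^ (n * n) * l ^ (4 * c * n)"
proof -
  define m where "m = c * n + l * (2 * n + 1)"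
  define K where "K = 2 * (c + 3) * (8 * c + 3) + 2 * (c + 3) + 5"
  have lp: "1 \<le> l ^ j" for j using l by simp
  have "n \<le> n * l" "l \<le> n * l" using n l by simp_all
  moreover from this have "c * n \<le> c * (n * l)" by (intro mult_le_mono2)
  moreover have "m = c * n + 2 * (n * l) + l" unfolding m_def by (simp add: algebra_simps)
  moreover have "(c + 3) * (n * l) = c * (n * l) + 3 * (n * l)" by (simp add: algebra_simps)
  ultimately have m: "m \<le> (c + 3) * (n * l)" by linarith
  have l3: "l ^ 3 = l * l * l" by (simp add: power3_eq_cube)
  have sq: "l \<le> l * l" "l * l \<le> l * l * l" "l \<le> l * l * l" using l by simp_all
  have "pump_const c l = 4 * (c * (l * l * l)) + c * (l * l) + 3 * (c * l) + 2 * (l * l) + l"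
    unfolding pump_const_def by (simp add: algebra_simps)
  moreover have "(8 * c + 3) * l ^ 3 = 8 * (c * (l * l * l)) + 3 * (l * l * l)"
    unfolding l3 by (simp add: algebra_simps)
  ultimately have C: "pump_const c l \<le> (8 * c + 3) * l ^ 3"
    using sq mult_le_mono2[OF sq(2), of c] mult_le_mono2[OF sq(3), of c] by linarith
  have "m * pump_const c l \<le> ((c + 3) * (n * l)) * ((8 * c + 3) * l ^ 3)" using m C by (rule mult_le_mono)
  also have "\<dots> = ((c + 3) * (8 * c + 3)) * (n * l ^ 4)" by (simp add: algebra_simps power_numeral_reduce)
  finally have 1: "m * pump_const c l \<le> ((c + 3) * (8 * c + 3)) * (n * l ^ 4)" .
  have "l * l \<le> l ^ 4" using power_increasing[of 2 4 l] l by (simp add: power2_eq_square)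
  then have "n * (l * l) \<le> n * l ^ 4" by (rule mult_le_mono2)
  then have "(c + 3) * (n * (l * l)) \<le> (c + 3) * (n * l ^ 4)" by (rule mult_le_mono2)
  moreover have "m * l \<le> (c + 3) * (n * l) * l" using m by (rule mult_le_mono1)
  moreover have "(c + 3) * (n * l) * l = (c + 3) * (n * (l * l))" by (simp only: mult.assoc)
  ultimately have 2: "m * l \<le> (c + 3) * (n * l ^ 4)" by linarith
  have "1 * 1 \<le> n * l ^ 4" using n lp by (rule mult_le_mono)
  then have 3: "1 \<le> n * l ^ 4" by simp
  have sums: "2 * (p + 1 + (1 + q)) + 1 \<le> 2 * P + 2 * Q + 5 * E"
    if "p \<le> P" "q \<le> Q" "1 \<le> E" for p q P Q E :: nat
    using that by presburger
  have "2 * (m * pump_const c l + 1 + (1 + m * l)) + 1 \<le>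
      2 * (((c + 3) * (8 * c + 3)) * (n * l ^ 4)) + 2 * ((c + 3) * (n * l ^ 4)) + 5 * (n * l ^ 4)"
    by (rule sums[OF 1 2 3])
  also have "\<dots> = K * (n * l ^ 4)" unfolding K_def by (simp add: algebra_simps)
  finally have base: "2 * (m * pump_const c l + 1 + (1 + m * l)) + 1 \<le> K * (n * l ^ 4)" .
  have "solution_bound c n l \<le> (K * (n * l ^ 4)) ^ (c * n)"
    unfolding solution_bound_def Let_def m_def[symmetric] using base by (rule power_mono) simp
  also have "\<dots> = (K ^ c) ^ n * (n ^ c) ^ n * l ^ (4 * c * n)"
    by (simp add: power_mult_distrib power_mult[symmetric] mult.assoc)
  also have "\<dots> \<le> (K ^ c) ^ n * (c ^ c * 2 ^ n) ^ n * l ^ (4 * c * n)"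
    using power_le_two_power[OF c, of n] by (intro mult_le_mono power_mono order_refl) simp_all
  also have "\<dots> = (K ^ c * c ^ c) ^ n * 2 ^ (n * n) * l ^ (4 * c * n)"
    by (simp add: power_mult_distrib power_mult[symmetric] mult_ac)
  finally show ?thesis unfolding K_def .
qed

lemma clique_number_pos:
  assumes "finite A" "A \<noteq> {}"
  shows "1 \<le> complement_clique_number A I"
proof -
  obtain a where "a \<in> A" using assms by blast
  then have "{a} \<in> {C. C \<subseteq> A \<and> clique C (complement_edges A I)}" by (simp add: clique_def)
  then have "1 \<in> card ` {C. C \<subseteq> A \<and> clique C (complement_edges A I)}" by (metis card_1_singleton_iff imageI One_nat_def)
  moreover have "finite (card ` {C. C \<subseteq> A \<and> clique C (complement_edges A I)})"
    using assms(1) by simp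
  ultimately show ?thesis unfolding complement_clique_number_def by (rule Max_ge[rotated])
qed

theorem theorem14:
  fixes A :: "'a set" and I :: "('a \<times> 'a) set" and \<alpha> :: nat
  assumes "independence_alphabet A I"
    and "\<alpha> = complement_clique_number A I"
  shows
    "(\<forall>n k x u v. exponent_equation (graph_group A I) n k x u v \<longrightarrow>
        semilinear_set k (solutions (graph_group A I) n k x u v)) \<and>
     (\<exists>(B :: nat \<times> nat \<Rightarrow> real) (\<mu> :: nat \<times> nat \<Rightarrow> real) (\<nu> :: nat \<times> nat \<Rightarrow> real).
        B \<in> O[principal UNIV](\<lambda>(n, l). fact (\<alpha> * n) * 2 ^ (2 * \<alpha>^2 * n * (n + 3))
              * \<mu> (n, l) ^ (8 * \<alpha> * (n + 1)) * \<nu> (n, l) ^ (8 * \<alpha> * card A * (n + 1))) \<and>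
        \<mu> \<in> O[principal UNIV](\<lambda>(n, l). real (card A) ^ \<alpha> * 2 ^ (2 * \<alpha>^2 * n) * real l ^ \<alpha>) \<and>
        \<nu> \<in> O[principal UNIV](\<lambda>(n, l). real l ^ \<alpha>) \<and>
        (\<forall>n k x u v. exponent_equation (graph_group A I) n k x u v \<longrightarrow>
           solutions (graph_group A I) n k x u v \<noteq> {} \<longrightarrow>
           (\<exists>s \<in> solutions (graph_group A I) n k x u v. \<forall>i\<in>{1..n}.
              real (s (x i)) \<le> B (n, max_norm A I n u v))))"
proof -
  interpret graph_group_alphabet A I using assms(1) by unfold_locales
  \<comment> \<open>with \<open>\<mu>\<close> scaled by \<open>K\<close>, the factor \<open>K ^ n\<close> is absorbed by \<open>\<mu>\<close>, the factor \<open>l ^ (8 * card A * n)\<close> by \<open>\<nu>\<close>\<close>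
  define c where "c = 2 * card A"
  define K where "K = (2 * (c + 3) * (8 * c + 3) + 2 * (c + 3) + 5) ^ c * c ^ c"
  define \<mu> :: "nat \<times> nat \<Rightarrow> real" where
    "\<mu> = (\<lambda>(n, l). real K * (real (card A) ^ \<alpha> * 2 ^ (2 * \<alpha>^2 * n) * real l ^ \<alpha>))"
  define \<nu> :: "nat \<times> nat \<Rightarrow> real" where "\<nu> = (\<lambda>(n, l). real l ^ \<alpha>)"
  define B :: "nat \<times> nat \<Rightarrow> real" where "B = (\<lambda>(n, l). fact (\<alpha> * n) * 2 ^ (2 * \<alpha>^2 * n * (n + 3))
              * \<mu> (n, l) ^ (8 * \<alpha> * (n + 1)) * \<nu> (n, l) ^ (8 * \<alpha> * card A * (n + 1)))"
  have semi: "semilinear_set k (solutions G n k x u v)" if "exponent_equation G n k x u v" for n k x u v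
  proof (rule semilinear_by_bounded_cones)
    show "\<exists>a F. a \<in> {f \<in> nat_vectors k. \<forall>i. f i \<le> solution_bound (2 * card A) n (max 1 (max_norm A I n u v))} \<and>
         F \<subseteq> {f \<in> nat_vectors k. \<forall>i. f i \<le> solution_bound (2 * card A) n (max 1 (max_norm A I n u v))} \<and>
         s \<in> cone a F \<and> cone a F \<subseteq> solutions G n k x u v" if "s \<in> solutions G n k x u v" for s
      using solutions_bounded_cones[OF \<open>exponent_equation G n k x u v\<close> _ _ that] by simp
  qed
  have small: "\<exists>s\<in>solutions G n k x u v. \<forall>i\<in>{1..n}. real (s (x i)) \<le> B (n, max_norm A I n u v)"
    if eqn: "exponent_equation G n k x u v" and ne: "solutions G n k x u v \<noteq> {}" for n k x u v
  proof (cases "n = 0")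
    case True
    then show ?thesis using ne by auto
  next
    case False
    then have n: "1 \<le> n" by simp
    define l where "l = max_norm A I n u v"
    have u1: "u 1 \<in> carrier G" "u 1 \<noteq> \<one>\<^bsub>G\<^esub>" using eqn n by (auto simp: exponent_equation_def)
    obtain w where w: "w \<in> lists X" "u 1 = val w" "length w = group_norm A I (u 1)"
      using group_norm_word[OF u1(1)] by metis
    have wn: "w \<noteq> []" using u1(2) w(2) val_Nil by auto
    have "group_norm A I (u 1) \<le> l" unfolding l_def max_norm_def using n by (intro Max_ge) auto
    \<comment> \<open>as \<open>u 1\<close> is not trivial, the norm, the alphabet and the clique number are positive\<close>
    then have l: "1 \<le> l" using wn w(3) by (cases w) auto
    have "A \<noteq> {}" using wn w(1) by (cases w) (auto simp: signed_letters_def)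
    then have a: "1 \<le> card A" "1 \<le> \<alpha>"
      using finite_A clique_number_pos[OF finite_A] assms(2) by (simp_all add: Suc_le_eq card_gt_0_iff)
    then have c: "1 \<le> c" by (simp add: c_def)
    obtain s0 where "s0 \<in> solutions G n k x u v" using ne by blast
    then obtain s F where s: "\<forall>i. s i \<le> solution_bound c n l" "cone s F \<subseteq> solutions G n k x u v"
      using solutions_bounded_cones[OF eqn _ l] unfolding l_def c_def by blast
    have "s \<in> cone s F" unfolding cone_def by (intro CollectI exI[of _ "[]"]) simp
    then have sol: "s \<in> solutions G n k x u v" using s(2) by blast
    have "0 < K" unfolding K_def using c by simp
    then have K1: "1 \<le> real K" by simp
    have l1: "1 \<le> real l" using l by simp
    have "real (solution_bound c n l) \<le> real (K ^ n * 2 ^ (n * n) * l ^ (4 * c * n))"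
      using solution_bound_le[OF c n l] unfolding K_def of_nat_le_iff .
    also have "\<dots> = 1 * (2 ^ (n * n)) * (real K ^ n) * real l ^ (8 * card A * n)" by (simp add: c_def mult_ac)
    also have "\<dots> \<le> fact (\<alpha> * n) * 2 ^ (2 * \<alpha>^2 * n * (n + 3)) * \<mu> (n, l) ^ (8 * \<alpha> * (n + 1)) * \<nu> (n, l) ^ (8 * \<alpha> * card A * (n + 1))"
    proof (intro mult_mono)
      have a2: "1 \<le> \<alpha>^2" using a by simp
      then have "1 * (n * n) \<le> 2 * \<alpha>^2 * (n * (n + 3))" by (intro mult_le_mono) auto
      then show "(2::real) ^ (n * n) \<le> 2 ^ (2 * \<alpha>^2 * n * (n + 3))" by (intro power_increasing) (simp_all add: mult.assoc)
      have "1 * 1 * 1 \<le> real (card A) ^ \<alpha> * 2 ^ (2 * \<alpha>^2 * n) * real l ^ \<alpha>"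
        using a l1 by (intro mult_mono one_le_power) auto
      then have "real K * 1 \<le> \<mu> (n, l)" unfolding \<mu>_def prod.case using K1 by (intro mult_left_mono) auto
      then have mu: "real K \<le> \<mu> (n, l)" by simp
      have "n \<le> 8 * \<alpha> * (n + 1)" using mult_le_mono[of 1 "8 * \<alpha>" n "n + 1"] a by simp
      then have "real K ^ n \<le> real K ^ (8 * \<alpha> * (n + 1))" using K1 by (rule power_increasing)
      also have "\<dots> \<le> \<mu> (n, l) ^ (8 * \<alpha> * (n + 1))" using mu K1 by (intro power_mono) auto
      finally show "real K ^ n \<le> \<mu> (n, l) ^ (8 * \<alpha> * (n + 1))" .
      have "8 * card A * n \<le> \<alpha> * (8 * \<alpha> * card A * (n + 1))"
        using mult_le_mono[of 1 "\<alpha> * \<alpha>" "8 * card A * n" "8 * card A * (n + 1)"] a by (simp add: mult_ac)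
      then have "real l ^ (8 * card A * n) \<le> real l ^ (\<alpha> * (8 * \<alpha> * card A * (n + 1)))" using l1 by (rule power_increasing)
      then show "real l ^ (8 * card A * n) \<le> \<nu> (n, l) ^ (8 * \<alpha> * card A * (n + 1))"
        by (simp add: \<nu>_def power_mult)
      have "0 \<le> \<mu> (n, l) ^ (8 * \<alpha> * (n + 1))" using mu K1 by (intro zero_le_power) linarith
      then show "0 \<le> fact (\<alpha> * n) * 2 ^ (2 * \<alpha>^2 * n * (n + 3)) * \<mu> (n, l) ^ (8 * \<alpha> * (n + 1))" by simp
    qed (auto simp: fact_ge_1)
    also have "\<dots> = B (n, l)" by (simp add: B_def)
    finally have T: "real (solution_bound c n l) \<le> B (n, l)" .
    have "real (s (x i)) \<le> B (n, l)" for i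
      using s(1)[rule_format, of "x i"] T by (meson of_nat_mono order_trans)
    then show ?thesis using sol unfolding l_def by blast
  qed
  have "B \<in> O[principal UNIV](\<lambda>(n, l). fact (\<alpha> * n) * 2 ^ (2 * \<alpha>^2 * n * (n + 3))
              * \<mu> (n, l) ^ (8 * \<alpha> * (n + 1)) * \<nu> (n, l) ^ (8 * \<alpha> * card A * (n + 1)))"
    unfolding B_def by (rule landau_o.big_refl)
  moreover have "\<mu> \<in> O[principal UNIV](\<lambda>(n, l). real (card A) ^ \<alpha> * 2 ^ (2 * \<alpha>^2 * n) * real l ^ \<alpha>)"
    by (rule bigoI[of _ "real K"]) (auto simp: \<mu>_def abs_mult)
  moreover have "\<nu> \<in> O[principal UNIV](\<lambda>(n, l). real l ^ \<alpha>)"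
    unfolding \<nu>_def by (rule landau_o.big_refl)
  ultimately show ?thesis using semi small by blast
qed

end
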